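(* Let $K$ be a compact subset of $\mathbb L^2$ and let $\mathcal F$ be a dimension-one foliation on $\mathbb L^2-K$. Then there is a closed unbounded set $C\subset\mathbb L_+$ such that, up to rotation of the axes, one of the following six cases holds, where in each case the listed sets are leaves of $\mathcal F$ for every $\alpha\in C$: 1. $(\{\pm\alpha\}\times[-\alpha,\alpha])\cup([-\alpha,\alpha]\times\{\pm\alpha\})$ (a single leaf, the boundary of a square); 2. $(\{\pm\alpha\}\times(-\omega_1,\alpha])\cup([-\alpha,\alpha]\times\{\alpha\})$ (a single leaf); 3. $(\{\alpha\}\times(-\omega_1,\alpha])\cup((-\omega_1,\alpha]\times\{\alpha\})$; 4. $(-\omega_1,\omega_1)\times\{\alpha\}$ and $(-\omega_1,\omega_1)\times\{-\alpha\}$; 5. $(-\omega_1,\omega_1)\times\{\alpha\}$, $((-\omega_1,-\alpha]\times\{-\alpha\})\cup(\{-\alpha\}\times(-\omega_1,-\alpha])$ and $([\alpha,\omega_1)\times\{-\alpha\})\cup(\{\alpha\}\times(-\omega_1,-\alpha])$; 6. $((-\omega_1,-\alpha]\times\{\alpha\})\cup(\{-\alpha\}\times[\alpha,\omega_1))$, $([\alpha,\omega_1)\times\{\alpha\})\cup(\{\alpha\}\times[\alpha,\omega_1))$, $((-\omega_1,-\alpha]\times\{-\alpha\})\cup(\{-\alpha\}\times(-\omega_1,-\alpha])$ and $([\alpha,\omega_1)\times\{-\alpha\})\cup(\{\alpha\}\times(-\omega_1,-\alpha])$. Further, where the leaves listed above are unbounded, $C$ may be chosen so that, in addition, for every $\alpha\in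 C$ and every $x\in[-\alpha,\alpha]$ each of the following sets lies entirely in one leaf of $\mathcal F$: in Case 2, $\{x\}\times(-\omega_1,-\alpha]$; in Case 3, $\{x\}\times(-\omega_1,-\alpha]$ and $(-\omega_1,-\alpha]\times\{x\}$; in Case 4, $(-\omega_1,-\alpha]\times\{x\}$ and $[\alpha,\omega_1)\times\{x\}$; in Case 5, $(-\omega_1,-\alpha]\times\{x\}$, $[\alpha,\omega_1)\times\{x\}$ and $\{x\}\times(-\omega_1,-\alpha]$; in Case 6, all four of $\{x\}\times[\alpha,\omega_1)$, $\{x\}\times(-\omega_1,-\alpha]$, $[\alpha,\omega_1)\times\{x\}$, $(-\omega_1,-\alpha]\times\{x\}$.
   Context: The closed long ray $\mathbb L_{\ge 0}$ is $\omega_1\times[0,1)$ with the order topology of the lexicographic order; the long ray is $\mathbb L_+=\mathbb L_{\ge0}\setminus\{0\}$. The long line $\mathbb L$ is the double of $\mathbb L_{\ge0}$: two copies of $\mathbb L_{\ge 0}$ glued at $0$, linearly ordered with the second copy reversed and placed below $0$; $x\mapsto -x$ is the order-reversing involution exchanging the copies. Intervals: $(-\omega_1,\omega_1)=\mathbb L$, $(-\omega_1,a]=\{x\in\mathbb L:x\le a\}$, $[a,\omega_1)=\{x\in\mathbb L:x\ge a\}$. A subset of $\mathbb L_+$ is unbounded if it has no upper bound in $\mathbb L_+$. "Up to rotation of the axes" means: after replacing $(K,\mathcal F)$ by its image under a power of the quarter-turn homeomorphism $(x,y)\mapsto(-y,x)$ of $\mathbb L^2$. Foliation: a foliation $\mathcal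 F$ of dimension $p$ on an $n$-manifold (Hausdorff, not necessarily metrisable) is a maximal atlas $\{(U_i,\varphi_i)\}_{i\in I}$ such that all coordinate changes have the form $\varphi_j\varphi_i^{-1}(x,y)=(g_{i,j}(x,y),h_{i,j}(y))$ for $(x,y)\in\varphi_i(U_i\cap U_j)\subset\mathbb R^p\times\mathbb R^{n-p}$, where $h_{i,j}$ is an embedding of a relevant open subset of $\mathbb R^{n-p}$ into $\mathbb R^{n-p}$ (only continuity is required). Components of the sets $\varphi_i^{-1}(\mathbb R^p\times\{y\})$ are called plaques; they form a basis of the leaf topology, whose path components are the leaves. *)

theory Defs
  imports "HOL-Analysis.Analysis" "HOL-Library.Countable_Set_Type"
begin

section \<open>The first uncountable ordinal\<close>

lemma cardSuc_natLeq_Card_order: "Card_order (cardSuc natLeq)"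
  by (simp add: cardSuc_Card_order natLeq_Card_order)

lemma cardSuc_natLeq_Well_order: "Well_order (cardSuc natLeq)"
  using cardSuc_natLeq_Card_order card_order_on_well_order_on by blast

lemma Field_cardSuc_natLeq_infinite: "infinite (Field (cardSuc natLeq))"
  using cardSuc_finite[OF natLeq_Card_order] by (simp add: Field_natLeq)

typedef omega1 = "Field (cardSuc natLeq)"
  using Field_cardSuc_natLeq_infinite by (metis ex_in_conv finite.emptyI)

setup_lifting type_definition_omega1

instantiation omega1 :: wellorder
begin

lift_definition less_eq_omega1 :: "omega1 \<Rightarrow> omega1 \<Rightarrow> bool"
  is "\<lambda>a b. (a, b) \<in> cardSuc natLeq" .

definition less_omega1 :: "omega1 \<Rightarrow> omega1 \<Rightarrow> bool"
  where "less_omega1 a b \<longleftrightarrow> a \<le> b \<and> \<not> b \<le> a"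

instance
proof
  let ?r = "cardSuc natLeq"
  note wo = cardSuc_natLeq_Well_order[unfolded well_order_on_def linear_order_on_def
      partial_order_on_def preorder_on_def]
  fix a b c :: omega1
  show "a < b \<longleftrightarrow> a \<le> b \<and> \<not> b \<le> a"
    by (rule less_omega1_def)
  show "a \<le> a"
    using wo by transfer (auto simp: refl_on_def)
  show "a \<le> b \<Longrightarrow> b \<le> c \<Longrightarrow> a \<le> c"
    using wo by transfer (meson transD)
  show antisym: "a \<le> b \<Longrightarrow> b \<le> a \<Longrightarrow> a = b" for a b :: omega1
    using wo by transfer (meson antisymD)
  show "a \<le> b \<or> b \<le> a"
    using wo by transfer (metis refl_onD total_on_def)
  fix P :: "omega1 \<Rightarrow> bool"
  assume step: "\<And>x. (\<And>y. y < x \<Longrightarrow> P y) \<Longrightarrow> P x"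
  have "{(x, y). x < y} \<subseteq> inv_image (?r - Id) Rep_omega1"
    by (auto simp: less_omega1_def less_eq_omega1.rep_eq Rep_omega1_inject)
  moreover have "wf (inv_image (?r - Id) Rep_omega1)"
    using wo by (simp add: wf_inv_image)
  ultimately have "wf {(x, y :: omega1). x < y}"
    using wf_subset by blast
  then show "P a"
    by (rule wf_induct_rule) (use step in blast)
qed

end

lemma uncountable_UNIV_omega1:
  includes cardinal_syntax
  shows "uncountable (UNIV :: omega1 set)"
proof
  assume "countable (UNIV :: omega1 set)"
  then have "countable (Rep_omega1 ` UNIV)"
    by (rule countable_image)
  then have "countable (Field (cardSuc natLeq))"
    using type_definition.Rep_range[OF type_definition_omega1] by simp
  then have "|Field (cardSuc natLeq)| \<le>o natLeq"
    by (simp add: countable_card_le_natLeq)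
  then have "cardSuc natLeq \<le>o natLeq"
    using card_of_Field_ordIso[OF cardSuc_natLeq_Card_order]
      ordIso_ordLeq_trans ordIso_symmetric by blast
  then show False
    using cardSuc_greater[OF natLeq_Card_order] not_ordLess_ordLeq by blast
qed

lemma countable_lessThan_omega1:
  includes cardinal_syntax
  shows "countable {..<a :: omega1}"
proof -
  have "Rep_omega1 ` {..<a} \<subseteq> underS (cardSuc natLeq) (Rep_omega1 a)"
    by (auto simp: underS_def less_omega1_def less_eq_omega1.rep_eq)
  moreover have "|underS (cardSuc natLeq) (Rep_omega1 a)| <o cardSuc natLeq"
    using card_of_underS[OF cardSuc_natLeq_Card_order Rep_omega1] .
  then have "|underS (cardSuc natLeq) (Rep_omega1 a)| \<le>o natLeq"
    using cardSuc_ordLeq_ordLess[OF natLeq_Card_order card_of_Card_order] by blast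
  then have "countable (underS (cardSuc natLeq) (Rep_omega1 a))"
    by (simp add: countable_card_le_natLeq)
  ultimately have "countable (Rep_omega1 ` {..<a})"
    using countable_subset by blast
  then show ?thesis
    by (rule countable_image_inj_on) (simp add: inj_on_def Rep_omega1_inject)
qed


section \<open>The closed long ray and the long line\<close>

typedef closed_long_ray = "(UNIV :: omega1 set) \<times> {0 ..< 1 :: real}"
  by (intro exI[of _ "(undefined, 0)"]) simp

setup_lifting type_definition_closed_long_ray

instantiation closed_long_ray :: "{linorder, zero}"
begin

lift_definition less_eq_closed_long_ray :: "closed_long_ray \<Rightarrow> closed_long_ray \<Rightarrow> bool"
  is "\<lambda>(a, s) (b, t). a < b \<or> a = b \<and> s \<le> t" .

lift_definition less_closed_long_ray :: "closed_long_ray \<Rightarrow> closed_long_ray \<Rightarrow> bool"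
  is "\<lambda>(a, s) (b, t). a < b \<or> a = b \<and> s < t" .

lift_definition zero_closed_long_ray :: closed_long_ray
  is "(LEAST a. True, 0)" by simp

instance
  by standard (transfer; auto)+

end

lemma closed_long_ray_zero_le: "0 \<le> (x :: closed_long_ray)"
proof transfer
  fix p :: "omega1 \<times> real"
  assume "p \<in> UNIV \<times> {0..<1}"
  moreover have "(LEAST a. True) \<le> fst p"
    by (rule Least_le) simp
  ultimately show "(case (LEAST a. True, 0 :: real) of (a, s) \<Rightarrow> \<lambda>(b, t). a < b \<or> a = b \<and> s \<le> t) p"
    by (auto simp: order.order_iff_strict)
qed

instantiation closed_long_ray :: linorder_topology
begin

definition open_closed_long_ray :: "closed_long_ray set \<Rightarrow> bool"
  where "open_closed_long_ray = generate_topology (range lessThan \<union> range greaterThan)"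

instance
  by standard (rule open_closed_long_ray_def)

end

text \<open>The pair \<open>(True, x)\<close> stands for the point \<open>x\<close> of the upper copy of the closed long ray and
  \<open>(False, x)\<close> for the point \<open>- x\<close> of the lower, reversed copy.\<close>

definition glue :: "bool \<times> closed_long_ray \<Rightarrow> bool \<times> closed_long_ray \<Rightarrow> bool"
  where "glue p q \<longleftrightarrow> p = q \<or> snd p = 0 \<and> snd q = 0"

quotient_type long_line = "bool \<times> closed_long_ray" / glue
  by (rule equivpI) (auto simp: reflp_def symp_def transp_def glue_def)

fun double_le :: "bool \<times> closed_long_ray \<Rightarrow> bool \<times> closed_long_ray \<Rightarrow> bool" where
  "double_le (True, x) (True, y) \<longleftrightarrow> x \<le> y"
| "double_le (False, x) (False, y) \<longleftrightarrow> y \<le> x"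
| "double_le (False, x) (True, y) \<longleftrightarrow> True"
| "double_le (True, x) (False, y) \<longleftrightarrow> x = 0 \<and> y = 0"

lemma double_le_glue:
  assumes "glue p p'" "glue q q'"
  shows "double_le p q \<longleftrightarrow> double_le p' q'"
proof -
  have z: "x \<le> 0 \<longleftrightarrow> x = 0" for x :: closed_long_ray
    using closed_long_ray_zero_le antisym by blast
  show ?thesis
    using assms
    by (cases "(p, q)" rule: double_le.cases; cases "(p', q')" rule: double_le.cases)
       (auto simp: glue_def z closed_long_ray_zero_le)
qed

instantiation long_line :: "{linorder, zero, uminus}"
begin

lift_definition less_eq_long_line :: "long_line \<Rightarrow> long_line \<Rightarrow> bool"
  is double_le by (rule double_le_glue)

definition less_long_line :: "long_line \<Rightarrow> long_line \<Rightarrow> bool"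
  where "less_long_line x y \<longleftrightarrow> x \<le> y \<and> \<not> y \<le> x"

lift_definition zero_long_line :: long_line
  is "(True, 0)" .

lift_definition uminus_long_line :: "long_line \<Rightarrow> long_line"
  is "\<lambda>(s, x). (\<not> s, x)"
  by (auto simp: glue_def)

instance
proof
  fix x y z :: long_line
  have z: "x \<le> 0 \<longleftrightarrow> x = 0" for x :: closed_long_ray
    using closed_long_ray_zero_le antisym by blast
  show "x < y \<longleftrightarrow> x \<le> y \<and> \<not> y \<le> x"
    by (rule less_long_line_def)
  show "x \<le> x"
  proof transfer
    fix p show "double_le p p" by (cases "(p, p)" rule: double_le.cases) auto
  qed
  show "x \<le> y \<Longrightarrow> y \<le> z \<Longrightarrow> x \<le> z"
  proof transfer
    fix p q r assume "double_le p q" "double_le q r"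
    then show "double_le p r"
      by (cases "(p, q)" rule: double_le.cases; cases "(q, r)" rule: double_le.cases)
         (auto simp: z closed_long_ray_zero_le)
  qed
  show "x \<le> y \<Longrightarrow> y \<le> x \<Longrightarrow> x = y"
  proof transfer
    fix p q assume "double_le p q" "double_le q p"
    then show "glue p q"
      by (cases "(p, q)" rule: double_le.cases) (auto simp: glue_def)
  qed
  show "x \<le> y \<or> y \<le> x"
  proof transfer
    fix p q show "double_le p q \<or> double_le q p"
      by (cases "(p, q)" rule: double_le.cases) auto
  qed
qed

end

text \<open>The topology glued from the two copies of the closed long ray is the order topology.\<close>

instantiation long_line :: linorder_topology
begin

definition open_long_line :: "long_line set \<Rightarrow> bool"
  where "open_long_line = generate_topology (range lessThan \<union> range greaterThan)"

instance
  by standard (rule open_long_line_def)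

end

lemma long_line_minus_minus: "- (- x) = (x :: long_line)"
  by transfer (auto simp: glue_def)

lemma long_line_minus_le: "- x \<le> - y \<longleftrightarrow> y \<le> (x :: long_line)"
proof transfer
  fix p q :: "bool \<times> closed_long_ray"
  show "double_le (case p of (s, x) \<Rightarrow> (\<not> s, x)) (case q of (s, x) \<Rightarrow> (\<not> s, x)) = double_le q p"
    by (cases "(p, q)" rule: double_le.cases) auto
qed


section \<open>Foliations\<close>

text \<open>Charts map open subsets of the manifold \<open>M\<close>, an open subset of an ambient Hausdorff space,
  homeomorphically onto open subsets of \<open>'p \<times> 'q\<close>; the leaf dimension is \<open>DIM('p)\<close> and the
  codimension is \<open>DIM('q)\<close>. A chart is the pair of its domain and its map, the latter being
  undefined outside the domain so that charts are determined as partial functions.\<close>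

type_synonym ('m, 'p, 'q) atlas = "('m set \<times> ('m \<Rightarrow> 'p \<times> 'q)) set"

definition chart_on :: "'m::t2_space set \<Rightarrow> 'm set \<times> ('m \<Rightarrow> 'p::euclidean_space \<times> 'q::euclidean_space) \<Rightarrow> bool"
  where "chart_on M = (\<lambda>(U, \<phi>). open U \<and> U \<subseteq> M \<and> \<phi> \<in> extensional U \<and>
    open (\<phi> ` U) \<and> (\<exists>\<psi>. homeomorphism U (\<phi> ` U) \<phi> \<psi>))"

definition foliated_change ::
    "'m set \<times> ('m \<Rightarrow> 'p::euclidean_space \<times> 'q::euclidean_space) \<Rightarrow> 'm set \<times> ('m \<Rightarrow> 'p \<times> 'q) \<Rightarrow> bool"
  where "foliated_change = (\<lambda>(U, \<phi>) (V, \<psi>). \<exists>g h h'.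
    homeomorphism (snd ` \<phi> ` (U \<inter> V)) (h ` snd ` \<phi> ` (U \<inter> V)) h h' \<and>
    (\<forall>(x, y) \<in> \<phi> ` (U \<inter> V). \<psi> (inv_into U \<phi> (x, y)) = (g (x, y), h y)))"

definition foliated_atlas ::
    "'m::t2_space set \<Rightarrow> ('m, 'p::euclidean_space, 'q::euclidean_space) atlas \<Rightarrow> bool"
  where "foliated_atlas M F \<longleftrightarrow>
    (\<forall>c\<in>F. chart_on M c) \<and> \<Union> (fst ` F) = M \<and> (\<forall>c\<in>F. \<forall>d\<in>F. foliated_change c d)"

definition foliation ::
    "'m::t2_space set \<Rightarrow> ('m, 'p::euclidean_space, 'q::euclidean_space) atlas \<Rightarrow> bool"
  where "foliation M F \<longleftrightarrow>
    foliated_atlas M F \<and> (\<forall>F'. foliated_atlas M F' \<and> F \<subseteq> F' \<longrightarrow> F' = F)"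

definition plaques :: "('m::t2_space, 'p::euclidean_space, 'q::euclidean_space) atlas \<Rightarrow> 'm set set"
  where "plaques F = (\<Union>(U, \<phi>)\<in>F. \<Union>y. components {z \<in> U. snd (\<phi> z) = y})"

definition leaf_topology :: "('m::t2_space, 'p::euclidean_space, 'q::euclidean_space) atlas \<Rightarrow> 'm topology"
  where "leaf_topology F = topology_generated_by (plaques F)"

definition leaves :: "('m::t2_space, 'p::euclidean_space, 'q::euclidean_space) atlas \<Rightarrow> 'm set set"
  where "leaves F = path_components_of (leaf_topology F)"

definition image_atlas :: "('m \<Rightarrow> 'm) \<Rightarrow> ('m, 'p, 'q) atlas \<Rightarrow> ('m, 'p, 'q) atlas"
  where "image_atlas f F = (\<lambda>(U, \<phi>). (f ` U, restrict (\<phi> \<circ> inv f) (f ` U))) ` F"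

definition quarter_turn :: "long_line \<times> long_line \<Rightarrow> long_line \<times> long_line"
  where "quarter_turn = (\<lambda>(x, y). (- y, x))"

text \<open>\<open>C\<close> is closed and unbounded in the open long ray \<open>{0<..}\<close>.\<close>

definition closed_unbounded :: "long_line set \<Rightarrow> bool"
  where "closed_unbounded C \<longleftrightarrow> closedin (top_of_set {0<..}) C \<and> \<not> (\<exists>b\<in>{0<..}. \<forall>c\<in>C. c \<le> b)"

definition in_leaf :: "('m::t2_space, 'p::euclidean_space, 'q::euclidean_space) atlas \<Rightarrow> 'm set \<Rightarrow> bool"
  where "in_leaf F S \<longleftrightarrow> (\<exists>L\<in>leaves F. S \<subseteq> L)"

end

theory Submission
  imports Defs
begin

text \<open>Countable subsets of the long ray are bounded, so every \<open>x\<close> has a compact neighbourhood \<open>I\<close> and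
  a height \<open>\<beta>\<close> such that each rectangle \<open>I \<times> [\<beta>, \<delta>]\<close> lies in a single chart. The transverse
  coordinates of these charts induce one coherent linear preorder on the strip \<open>I \<times> [\<beta>, \<omega>\<^sub>1)\<close>. If it is
  bounded, it is given by a single real function, which must be eventually constant on verticals. If
  it is unbounded, all of \<open>I\<close> leaves every bounded part simultaneously, and continuity at limit heights
  puts \<open>I \<times> {\<alpha>}\<close> into one level set for a closed unbounded set of \<open>\<alpha>\<close>. The alternative does not
  depend on \<open>x\<close> because the long line is connected, so each of the four ends of the plane is either
  vertical or horizontal. Up to rotation this leaves six patterns; in each of them the segments
  obtained from the ends fit together into closed connected sets tangent to the foliation, and such
  a set without end points is a leaf.\<close>

section \<open>The long line as a linear continuum\<close>

text \<open>Countable boundedness enters in two ways: countably many choices (dense points, pairs of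
  levels, candidate neighbourhoods) can be passed by one height, and every increasing sequence of
  heights has a limit height where continuity in a single chart applies. Intermediate statements
  speak of tangent sets, along which transverse coordinates are locally constant, instead of leaves:
  tangency is local, passes to unions of closed sets and commutes with rotations; leaves return only
  when the pieces are assembled. Codimension one is used through monotonicity: an injective
  continuous change of transverse coordinate is monotone on the interval of values of a rectangle,
  so order is independent of the chart up to a sign. The main obstacle is that good heights depend
  on the width of the strip, whereas in the theorem one \<alpha> controls both. Horizontality is
  therefore a condition on limits of sequences that eventually outrun a threshold function; in this
  form finitely many strips, and then all widths along one sequence, can be treated at once.\<close>

lemma omega1_countable_bounded:
  fixes A :: "omega1 set"
  assumes "countable A"
  shows "\<exists>b. \<forall>a\<in>A. a < b"
proof (rule ccontr)
  assume "\<not> ?thesis"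
  then have "UNIV \<subseteq> (\<Union>a\<in>A. insert a {..<a})"
    by (auto simp: not_less order.order_iff_strict)
  moreover have "countable (\<Union>a\<in>A. insert a {..<a})"
    using assms by (simp add: countable_lessThan_omega1)
  ultimately show False
    using uncountable_UNIV_omega1 countable_subset by blast
qed

definition ray_ord :: "closed_long_ray \<Rightarrow> omega1" where "ray_ord x = fst (Rep_closed_long_ray x)"
definition ray_frac :: "closed_long_ray \<Rightarrow> real" where "ray_frac x = snd (Rep_closed_long_ray x)"

lemma ray_less_iff: "x < y \<longleftrightarrow> ray_ord x < ray_ord y \<or> ray_ord x = ray_ord y \<and> ray_frac x < ray_frac y"
  by (simp add: less_closed_long_ray.rep_eq ray_ord_def ray_frac_def case_prod_unfold)

lemma ray_frac_range: "0 \<le> ray_frac x" "ray_frac x < 1"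
  using Rep_closed_long_ray[of x] by (auto simp: ray_frac_def)

lemma ray_point_exists: "0 \<le> t \<Longrightarrow> t < 1 \<Longrightarrow> \<exists>x. ray_ord x = a \<and> ray_frac x = t"
  by (rule exI[of _ "Abs_closed_long_ray (a, t)"])
    (simp add: ray_ord_def ray_frac_def Abs_closed_long_ray_inverse)

text \<open>Take the least \<open>a\<close> such that \<open>level a\<close>, the left end of its
  unit interval, bounds \<open>A\<close>. Either \<open>level a\<close> is the supremum, or some
  upper bound \<open>v\<close> lies strictly lower. Then \<open>A\<close> reaches past the left end
  of the interval of \<open>v\<close>, and a real supremum of fractional parts in that interval
  gives the answer.\<close>

lemma ray_lub:
  fixes A :: "closed_long_ray set"
  assumes "A \<noteq> {}" and "\<forall>x\<in>A. x \<le> u"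
  shows "\<exists>s. (\<forall>x\<in>A. x \<le> s) \<and> (\<forall>v. (\<forall>x\<in>A. x \<le> v) \<longrightarrow> s \<le> v)"
proof -
  define level where "level a = (SOME x. ray_ord x = a \<and> ray_frac x = 0)" for a
  have level: "ray_ord (level a) = a" "ray_frac (level a) = 0" for a
    unfolding level_def using someI_ex[OF ray_point_exists[of 0 a]] by auto
  obtain b where b: "ray_ord u < b"
    using omega1_countable_bounded[of "{ray_ord u}"] by auto
  define a where "a = (LEAST a. \<forall>x\<in>A. x \<le> level a)"
  have "\<forall>x\<in>A. x \<le> level b"
    using assms(2) b by (metis level(1) less_le_not_le linorder_linear order_trans ray_less_iff)
  then have a: "\<forall>x\<in>A. x \<le> level a"
    unfolding a_def by (rule LeastI)
  show ?thesis
  proof (cases "\<forall>v. (\<forall>x\<in>A. x \<le> v) \<longrightarrow> level a \<le> v")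
    case True
    with a show ?thesis by blast
  next
    case False
    then obtain v where v: "\<forall>x\<in>A. x \<le> v" "v < level a"
      by (auto simp: not_le)
    then have "ray_ord v < a"
      using ray_frac_range(1)[of v] by (auto simp: ray_less_iff level)
    then have "\<not> (\<forall>x\<in>A. x \<le> level (ray_ord v))"
      unfolding a_def using not_less_Least by blast
    then obtain p where p: "p \<in> A" "level (ray_ord v) < p"
      by (auto simp: not_le)
    then have ordp: "ray_ord p = ray_ord v"
      using v(1) by (metis antisym_conv3 leD level(1) less_asym' ray_less_iff)
    define T where "T = {ray_frac x |x. x \<in> A \<and> ray_ord x = ray_ord v}"
    have Tne: "ray_frac p \<in> T" using p ordp T_def by auto
    have Tb: "t \<le> ray_frac v" if "t \<in> T" for t
      using that v(1) unfolding T_def by (auto simp: not_less[symmetric] ray_less_iff)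
    have bdd: "bdd_above T" using Tb by (rule bdd_aboveI)
    have "Sup T \<le> ray_frac v" using Tb Tne by (intro cSup_least) auto
    then have S: "0 \<le> Sup T" "Sup T < 1"
      using cSup_upper[OF Tne bdd] ray_frac_range[of p] ray_frac_range[of v] by linarith+
    obtain s where s: "ray_ord s = ray_ord v" "ray_frac s = Sup T"
      using ray_point_exists[OF S] by blast
    have "x \<le> s" if x: "x \<in> A" for x
    proof (rule ccontr)
      assume "\<not> x \<le> s"
      then have "s < x" by simp
      moreover have "\<not> v < x" using v(1) x by (auto simp: not_less)
      ultimately have "ray_ord x = ray_ord v" "Sup T < ray_frac x"
        by (auto simp: ray_less_iff s)
      moreover from this have "ray_frac x \<in> T" using x T_def by auto
      ultimately show False using cSup_upper[OF _ bdd] by (meson leD)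
    qed
    moreover have "s \<le> w" if w: "\<forall>x\<in>A. x \<le> w" for w
    proof (rule ccontr)
      assume "\<not> s \<le> w"
      then have ws: "w < s" by simp
      have "\<not> w < p" using w p by (auto simp: not_less)
      then have ow: "ray_ord w = ray_ord v" "ray_frac w < Sup T"
        using ws by (auto simp: ray_less_iff s ordp)
      then obtain t where "t \<in> T" "ray_frac w < t"
        using less_cSup_iff[OF _ bdd] Tne by blast
      then obtain x where "x \<in> A" "w < x"
        unfolding T_def using ow(1) by (auto simp: ray_less_iff)
      then show False using w by (auto simp: not_less[symmetric])
    qed
    ultimately show ?thesis by blast
  qed
qed

text \<open>Only countably many unit intervals meet the part below \<open>u\<close>, so their
  rational points form a countable set that is dense there.\<close>

lemma ray_dense_countable:
  "\<exists>D. countable D \<and> (\<forall>p q. p < q \<and> q \<le> (u :: closed_long_ray) \<longrightarrow> (\<exists>d\<in>D. p < d \<and> d < q))"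
proof -
  define pt where "pt z = (SOME x. ray_ord x = fst z \<and> ray_frac x = snd z)" for z
  have pt: "ray_ord (pt z) = fst z" "ray_frac (pt z) = snd z" if "0 \<le> snd z" "snd z < 1" for z
    unfolding pt_def using someI_ex[OF ray_point_exists[OF that]] by auto
  define D where "D = pt ` ({..ray_ord u} \<times> \<rat>)"
  have "{..ray_ord u} = insert (ray_ord u) {..<ray_ord u}" by auto
  then have "countable D"
    unfolding D_def by (simp add: countable_lessThan_omega1 countable_rat)
  moreover have "\<exists>d\<in>D. p < d \<and> d < q" if "p < q" "q \<le> u" for p q
  proof -
    have "ray_ord p \<le> ray_ord u"
      using that by (metis less_le_not_le less_le_trans nle_le ray_less_iff)
    \<comment> \<open>If \<open>q\<close> lies in a later unit interval, any rational point beyond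
      \<open>p\<close> in the interval of \<open>p\<close> separates them, hence the bound
      1.\<close>
    have "ray_frac p < (if ray_ord p = ray_ord q then ray_frac q else 1)"
      using that(1) ray_frac_range[of p] by (auto simp: ray_less_iff)
    then obtain r where r: "r \<in> \<rat>" "ray_frac p < r" "r < (if ray_ord p = ray_ord q then ray_frac q else 1)"
      using Rats_dense_in_real by metis
    then have r1: "0 \<le> r" "r < 1"
      using ray_frac_range[of p] ray_frac_range[of q] by (auto split: if_splits)
    then have "p < pt (ray_ord p, r) \<and> pt (ray_ord p, r) < q"
      using r that(1) by (auto simp: ray_less_iff pt split: if_splits)
    moreover have "pt (ray_ord p, r) \<in> D"
      unfolding D_def using r(1) \<open>ray_ord p \<le> ray_ord u\<close> by auto
    ultimately show ?thesis by blast
  qed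
  ultimately show ?thesis by blast
qed

lifting_forget closed_long_ray.lifting
lifting_forget omega1.lifting

text \<open>The lifting set-ups of the two inner types are dropped beforehand, so that only the
  gluing quotient is lifted and \<open>closed_long_ray\<close> stays opaque.\<close>

lift_definition pos :: "closed_long_ray \<Rightarrow> long_line" is "\<lambda>x. (True, x)" .

lemma pos_le_iff [simp]: "pos x \<le> pos y \<longleftrightarrow> x \<le> y"
  by transfer simp

lemma pos_less_iff [simp]: "pos x < pos y \<longleftrightarrow> x < y"
  by (simp add: less_le_not_le)

lemma pos_0: "pos 0 = 0"
  by transfer (simp add: glue_def)

lemma pos_ge_0 [simp]: "0 \<le> pos x"
  by (metis closed_long_ray_zero_le pos_0 pos_le_iff)

lemma long_line_minus_0 [simp]: "- 0 = (0 :: long_line)"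
  by transfer (simp add: glue_def)

declare long_line_minus_minus [simp] long_line_minus_le [simp]

lemma long_line_minus_less [simp]: "- x < - y \<longleftrightarrow> y < (x :: long_line)"
  by (simp add: less_le_not_le)

lemma long_line_cases:
  obtains y where "x = pos y" | y where "x = - pos y"
proof -
  have "\<exists>y. x = pos y \<or> x = - pos y"
  proof transfer
    fix p :: "bool \<times> closed_long_ray"
    show "\<exists>y. glue p (True, y) \<or> glue p (case (True, y) of (s, x) \<Rightarrow> (\<not> s, x))"
      by (cases p) (auto simp: glue_def)
  qed
  then show ?thesis using that by blast
qed

lemma long_line_le_minus_iff: "x \<le> - y \<longleftrightarrow> y \<le> - (x :: long_line)"
  using long_line_minus_le[of "- x" y] by simp

lemma long_line_minus_le_iff: "- x \<le> y \<longleftrightarrow> - y \<le> (x :: long_line)"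
  using long_line_minus_le[of x "- y"] by simp

lemma long_line_less_minus_iff: "x < - y \<longleftrightarrow> y < - (x :: long_line)"
  using long_line_minus_less[of "- x" y] by simp

lemma long_line_minus_less_iff: "- x < y \<longleftrightarrow> - y < (x :: long_line)"
  using long_line_minus_less[of x "- y"] by simp

lemma long_line_minus_nonpos_iff [simp]: "- x \<le> 0 \<longleftrightarrow> 0 \<le> (x :: long_line)"
  using long_line_minus_le[of x 0] by simp

lemma long_line_minus_neg_iff [simp]: "- x < 0 \<longleftrightarrow> 0 < (x :: long_line)"
  using long_line_minus_less[of x 0] by simp

lemma long_line_minus_nonneg_iff [simp]: "0 \<le> - x \<longleftrightarrow> (x :: long_line) \<le> 0"
  using long_line_minus_le[of 0 x] by simp

lemma long_line_minus_pos_iff [simp]: "0 < - x \<longleftrightarrow> (x :: long_line) < 0"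
  using long_line_minus_less[of 0 x] by simp

lemma nonneg_pos_cases:
  assumes "0 \<le> x" obtains y where "x = pos y"
proof (cases x rule: long_line_cases)
  case (2 y)
  then have "pos y \<le> 0" using assms by simp
  then have "x = pos y" using 2 by (metis antisym pos_ge_0 long_line_minus_0)
  then show ?thesis using that by blast
qed (use that in blast)

text \<open>A nonnegative member reduces the problem to the upper copy. Otherwise \<open>A\<close>
  lies in the reversed copy, where a supremum is an infimum of the ray; it is obtained as the
  supremum of \<open>B\<close>, the lower bounds of the mirror image of \<open>A\<close>.\<close>

lemma long_line_lub:
  fixes A :: "long_line set"
  assumes "A \<noteq> {}" and ub: "\<forall>x\<in>A. x \<le> u"
  shows "\<exists>s. (\<forall>x\<in>A. x \<le> s) \<and> (\<forall>v. (\<forall>x\<in>A. x \<le> v) \<longrightarrow> s \<le> v)"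
proof (cases "\<exists>z\<in>A. 0 \<le> z")
  case True
  then obtain z where z: "z \<in> A" "0 \<le> z" by blast
  obtain y where y: "z = pos y" using nonneg_pos_cases[OF z(2)] .
  obtain u' where u': "u = pos u'"
    using nonneg_pos_cases ub z by (metis order_trans)
  obtain s where s: "\<forall>x\<in>{x. pos x \<in> A}. x \<le> s" "\<And>v. \<forall>x\<in>{x. pos x \<in> A}. x \<le> v \<Longrightarrow> s \<le> v"
    using ray_lub[of "{x. pos x \<in> A}" u'] ub u' y z by (metis (lifting) empty_iff mem_Collect_eq pos_le_iff)
  have "x \<le> pos s" if "x \<in> A" for x
  proof (cases x rule: long_line_cases)
    case (1 y) then show ?thesis using s(1) that by auto
  next
    case (2 y) then show ?thesis by (metis long_line_minus_nonpos_iff order_trans pos_ge_0)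
  qed
  moreover have "pos s \<le> v" if v: "\<forall>x\<in>A. x \<le> v" for v
  proof -
    obtain v' where v': "v = pos v'"
      using nonneg_pos_cases v z by (metis order_trans)
    have "\<forall>x\<in>{x. pos x \<in> A}. x \<le> v'" using v v' by auto
    then show ?thesis using s(2) v' by simp
  qed
  ultimately show ?thesis by blast
next
  case False
  define B where "B = {x. \<forall>z\<in>A. z \<le> - pos x}"
  have nA: "\<exists>y. z = - pos y" if "z \<in> A" for z
    using False that by (metis long_line_cases pos_ge_0)
  obtain y where y: "- pos y \<in> A" using assms(1) nA by fastforce
  have "0 \<in> B" using False unfolding B_def by (auto simp: pos_0 intro: less_imp_le)
  moreover have "\<forall>x\<in>B. x \<le> y" using y unfolding B_def by auto
  ultimately obtain s where s: "\<forall>x\<in>B. x \<le> s" "\<And>v. \<forall>x\<in>B. x \<le> v \<Longrightarrow> s \<le> v"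
    using ray_lub[of B y] by blast
  have "z \<le> - pos s" if z: "z \<in> A" for z
  proof -
    obtain w where w: "z = - pos w" using nA z by blast
    have "\<forall>x\<in>B. x \<le> w" using z w unfolding B_def by auto
    then show ?thesis using s(2) w by simp
  qed
  moreover have "- pos s \<le> v" if v: "\<forall>x\<in>A. x \<le> v" for v
  proof (cases v rule: long_line_cases)
    case (1 v')
    then show ?thesis by (metis long_line_minus_nonpos_iff order_trans pos_ge_0)
  next
    case (2 v')
    then have "v' \<in> B" using v unfolding B_def by auto
    then show ?thesis using s 2 by simp
  qed
  ultimately show ?thesis by blast
qed

text \<open>The point 0 separates the pairs that straddle it; all other pairs lie in one copy and
  are handled by the ray or by its mirror image.\<close>

lemma long_line_dense_countable_upto:
  "\<exists>D. countable D \<and> (\<forall>p q. - u \<le> p \<and> p < q \<and> q \<le> (u :: long_line) \<longrightarrow> (\<exists>d\<in>D. p < d \<and> d < q))"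
proof (cases "0 \<le> u")
  case True
  then obtain u' where u': "u = pos u'" using nonneg_pos_cases by blast
  obtain D where D: "countable D" "\<And>p q. p < q \<Longrightarrow> q \<le> u' \<Longrightarrow> \<exists>d\<in>D. p < d \<and> d < q"
    using ray_dense_countable[of u'] by blast
  define E where "E = insert 0 (pos ` D \<union> (\<lambda>x. - pos x) ` D)"
  have "countable E" unfolding E_def using D(1) by simp
  moreover have "\<exists>d\<in>E. p < d \<and> d < q" if pq: "- u \<le> p" "p < q" "q \<le> u" for p q
  proof -
    consider "0 \<le> p" | "q \<le> 0" | "p < 0" "0 < q" by fastforce
    then show ?thesis
    proof cases
      case 1
      then obtain p' q' where e: "p = pos p'" "q = pos q'"
        using nonneg_pos_cases pq by (metis less_imp_le order_trans)
      then obtain d where "d \<in> D" "p' < d" "d < q'" using D(2) pq u' by auto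
      then have "pos d \<in> E" "p < pos d" "pos d < q" unfolding e E_def by auto
      then show ?thesis by blast
    next
      case 2
      then have "0 \<le> - q" "0 \<le> - p" using pq by auto
      then obtain p' q' where "- p = pos p'" "- q = pos q'"
        using nonneg_pos_cases by metis
      then have e: "p = - pos p'" "q = - pos q'" by (metis long_line_minus_minus)+
      then obtain d where "d \<in> D" "q' < d" "d < p'" using D(2) pq u' by auto
      then have "- pos d \<in> E" "p < - pos d" "- pos d < q" unfolding e E_def by auto
      then show ?thesis by blast
    next
      case 3 then show ?thesis unfolding E_def by auto
    qed
  qed
  ultimately show ?thesis by blast
next
  case False
  then have "u < - u" by (meson less_trans long_line_minus_pos_iff not_le)
  then show ?thesis by (intro exI[of _ "{}"]) fastforce
qed

lemma long_line_abs_bounds: "\<exists>v::long_line. 0 \<le> v \<and> - v \<le> x \<and> x \<le> v"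
proof (cases "0 \<le> x")
  case True then show ?thesis by (metis long_line_minus_nonpos_iff order_trans order_refl)
next
  case False
  then have "0 \<le> - x" by (auto intro: less_imp_le)
  then have "x \<le> - x" using False by (meson order_trans not_le less_imp_le)
  then show ?thesis using False by (intro exI[of _ "- x"]) auto
qed

lemma long_line_abs_bounds2: "\<exists>v::long_line. 0 \<le> v \<and> - v \<le> x \<and> x \<le> v \<and> - v \<le> y \<and> y \<le> v"
proof -
  obtain v w :: long_line where "0 \<le> v" "- v \<le> x" "x \<le> v" "0 \<le> w" "- w \<le> y" "y \<le> w"
    using long_line_abs_bounds by metis
  then show ?thesis
    by (intro exI[of _ "max v w"])
      (auto simp: max_def long_line_minus_le_iff[of _ x] long_line_minus_le_iff[of _ y])
qed

lemma long_line_dense_countable: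
  "\<exists>D. countable D \<and> (\<forall>p q. l \<le> p \<and> p < q \<and> q \<le> (u :: long_line) \<longrightarrow> (\<exists>d\<in>D. p < d \<and> d < q))"
proof -
  obtain v :: long_line where "- v \<le> l" "u \<le> v" using long_line_abs_bounds2[of l u] by blast
  moreover obtain D where D: "countable D"
    "\<And>p q. - v \<le> p \<and> p < q \<and> q \<le> v \<Longrightarrow> \<exists>d\<in>D. p < d \<and> d < q"
    using long_line_dense_countable_upto[of v] by blast
  ultimately show ?thesis by (metis (no_types) order_trans)
qed

lemma long_line_countable_bounded:
  fixes A :: "long_line set"
  assumes "countable A"
  shows "\<exists>b. \<forall>a\<in>A. a < b"
proof -
  have "countable (pos ` {x. pos x \<in> A})"
    using assms by (rule countable_subset[rotated]) auto
  moreover have "inj_on pos {x. pos x \<in> A}"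
    by (rule inj_onI) (metis antisym order_refl pos_le_iff)
  ultimately have "countable (ray_ord ` {x. pos x \<in> A})"
    using countable_image_inj_on by blast
  from omega1_countable_bounded[OF this]
  obtain b where b: "\<And>x. pos x \<in> A \<Longrightarrow> ray_ord x < b" by auto
  \<comment> \<open>The ordinal \<open>b\<close> beats all points of the upper copy. A fraction
    above 0 keeps \<open>pos y\<close> positive even when \<open>b\<close> is the first ordinal, so
    the lower copy is dominated strictly as well.\<close>
  obtain y where y: "ray_ord y = b" "ray_frac y = 1/2"
    using ray_point_exists[of "1/2" b] by auto
  obtain z where z: "ray_ord z = b" "ray_frac z = 0"
    using ray_point_exists[of 0 b] by auto
  have "z < y" by (simp add: ray_less_iff y z)
  then have "0 < pos y" using pos_ge_0 pos_less_iff order_le_less_trans by blast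
  have "a < pos y" if "a \<in> A" for a
  proof (cases a rule: long_line_cases)
    case (1 x)
    then show ?thesis using b that y by (auto simp: ray_less_iff)
  next
    case (2 x)
    then have "a \<le> 0" by simp
    then show ?thesis using \<open>0 < pos y\<close> by simp
  qed
  then show ?thesis by blast
qed

section \<open>Topology of the long line: completeness, compact intervals, convergent
  sequences\<close>

instantiation long_line :: linear_continuum
begin

definition Sup_long_line :: "long_line set \<Rightarrow> long_line"
  where "Sup_long_line A = (SOME s. (\<forall>x\<in>A. x \<le> s) \<and> (\<forall>v. (\<forall>x\<in>A. x \<le> v) \<longrightarrow> s \<le> v))"

definition Inf_long_line :: "long_line set \<Rightarrow> long_line"
  where "Inf_long_line A = - Sup (uminus ` A)"

definition sup_long_line :: "long_line \<Rightarrow> long_line \<Rightarrow> long_line"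
  where "sup_long_line = max"

definition inf_long_line :: "long_line \<Rightarrow> long_line \<Rightarrow> long_line"
  where "inf_long_line = min"

instance
proof
  fix x y z :: long_line and X :: "long_line set"
  show "inf x y \<le> x" "inf x y \<le> y" "x \<le> y \<Longrightarrow> x \<le> z \<Longrightarrow> x \<le> inf y z"
    "x \<le> sup x y" "y \<le> sup x y" "y \<le> x \<Longrightarrow> z \<le> x \<Longrightarrow> sup y z \<le> x"
    by (auto simp: inf_long_line_def sup_long_line_def)
  have Sup: "(\<forall>x\<in>X. x \<le> Sup X) \<and> (\<forall>v. (\<forall>x\<in>X. x \<le> v) \<longrightarrow> Sup X \<le> v)"
    if "X \<noteq> {}" "\<forall>x\<in>X. x \<le> u" for X and u :: long_line
    unfolding Sup_long_line_def by (rule someI_ex[OF long_line_lub[OF that]])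
  show "x \<le> Sup X" if "x \<in> X" "bdd_above X"
    using Sup[of X] that by (auto simp: bdd_above_def)
  show "Sup X \<le> z" if "X \<noteq> {}" "\<And>x. x \<in> X \<Longrightarrow> x \<le> z"
    using Sup[of X z] that by auto
  show "Inf X \<le> x" if x: "x \<in> X" and bdd: "bdd_below X"
  proof -
    obtain m where "\<forall>x\<in>X. m \<le> x" using bdd by (auto simp: bdd_below_def)
    then show ?thesis
      unfolding Inf_long_line_def using Sup[of "uminus ` X" "- m"] x
      by (auto simp: long_line_minus_le_iff)
  qed
  show "z \<le> Inf X" if "X \<noteq> {}" "\<And>x. x \<in> X \<Longrightarrow> z \<le> x"
  proof -
    have "\<forall>x\<in>uminus ` X. x \<le> - z" using that by auto
    then have "Sup (uminus ` X) \<le> - z"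
      using Sup[of "uminus ` X" "- z"] that(1) by blast
    then show ?thesis
      unfolding Inf_long_line_def by (simp add: long_line_le_minus_iff)
  qed
  show "\<exists>z. x < z \<and> z < y" if "x < y"
    using long_line_dense_countable[of x y] that by blast
  show "\<exists>a b :: long_line. a \<noteq> b"
    using long_line_countable_bounded[of "{0}"] by (metis countable_empty countable_insert insertI1 less_irrefl)
qed

end

instance long_line :: linear_continuum_topology ..

instance long_line :: no_top
  by standard (use long_line_countable_bounded[of "{_}"] in auto)

instance long_line :: no_bot
  by standard (metis gt_ex long_line_minus_less_iff)

lemma long_line_minus_image [simp]:
  fixes a b :: long_line
  shows "uminus ` {a..b} = {- b..- a}" "uminus ` {a..} = {..- a}" "uminus ` {..a} = {- a..}"
  by (auto simp: image_iff long_line_minus_le_iff long_line_le_minus_iff long_line_minus_less_iff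
      long_line_less_minus_iff intro!: bexI[of _ "- _"] exI[of _ "- _"])

lemma continuous_on_long_line_minus [continuous_intros]:
  fixes f :: "'a::topological_space \<Rightarrow> long_line"
  assumes "continuous_on S f"
  shows "continuous_on S (\<lambda>x. - f x)"
proof -
  have "continuous_on UNIV (uminus :: long_line \<Rightarrow> long_line)"
    unfolding continuous_on_def
  proof (intro ballI order_tendstoI)
    fix x a :: long_line
    show "eventually (\<lambda>y. a < - y) (at x)" if "a < - x"
      using that unfolding eventually_at_topological long_line_less_minus_iff[of a]
      by (intro exI[of _ "{..<- a}"]) auto
    show "eventually (\<lambda>y. - y < a) (at x)" if "- x < a"
      using that unfolding eventually_at_topological long_line_minus_less_iff[of _ a]
      by (intro exI[of _ "{- a<..}"]) auto
  qed
  then show ?thesis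
    using assms continuous_on_compose2 by blast
qed

lemma long_line_open_interval:
  fixes x :: long_line
  assumes "open S" "x \<in> S"
  obtains a b where "a < x" "x < b" "{a<..<b} \<subseteq> S"
proof -
  obtain b' where "x < b'" using gt_ex by blast
  then obtain b where b: "x < b" "{x..<b} \<subseteq> S" using open_right[OF assms] by blast
  obtain a' where "a' < x" using lt_ex by blast
  then obtain a where a: "a < x" "{a<..x} \<subseteq> S" using open_left[OF assms] by blast
  have "{a<..<b} \<subseteq> {a<..x} \<union> {x..<b}" by auto
  then show ?thesis using that a b by blast
qed

text \<open>A supremum argument. \<open>local\<close> says that near every point of [a, b] finite
  coverability up to one point spreads to all nearby points, since a single further member of the
  cover suffices. The supremum of the coverable points is then coverable and cannot be smaller than
  \<open>b\<close>.\<close>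

lemma compact_long_line_Icc: "compact {a..b :: long_line}"
proof (rule compactI)
  fix \<C> :: "long_line set set"
  assume op: "\<forall>t\<in>\<C>. open t" and cov: "{a..b} \<subseteq> \<Union>\<C>"
  define P where "P x \<longleftrightarrow> (\<exists>C'\<subseteq>\<C>. finite C' \<and> {a..x} \<subseteq> \<Union>C')" for x
  show "\<exists>C'\<subseteq>\<C>. finite C' \<and> {a..b} \<subseteq> \<Union>C'"
  proof (cases "a \<le> b")
    case False
    then show ?thesis by (intro exI[of _ "{}"]) auto
  next
    case True
    define S where "S = {x\<in>{a..b}. P x}"
    have local: "\<exists>w z. w < x \<and> x < z \<and> (\<forall>p\<in>{w<..<z}. \<forall>q\<in>{w<..<z}. P p \<longrightarrow> P q)" if x: "x \<in> {a..b}" for x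
    proof -
      obtain U where U: "U \<in> \<C>" "x \<in> U" using cov x by blast
      have "open U" using op U by blast
      obtain w z where w: "w < x" and z: "x < z" and sub: "{w<..<z} \<subseteq> U"
        using long_line_open_interval[OF \<open>open U\<close> U(2)] .
      have "P q" if p: "p \<in> {w<..<z}" "P p" and q: "q \<in> {w<..<z}" for p q
      proof -
        obtain C' where "C' \<subseteq> \<C>" "finite C'" "{a..p} \<subseteq> \<Union>C'" using p unfolding P_def by blast
        moreover have "{a..q} \<subseteq> {a..p} \<union> {w<..<z}" using p q by auto
        ultimately show ?thesis
          unfolding P_def using U(1) sub by (intro exI[of _ "insert U C'"]) auto
      qed
      then show ?thesis using w z by blast
    qed
    have "P a"
    proof -
      obtain U where "U \<in> \<C>" "a \<in> U" using cov True by fastforce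
      then show ?thesis unfolding P_def by (intro exI[of _ "{U}"]) auto
    qed
    then have aS: "a \<in> S" using True S_def by auto
    have bdd: "bdd_above S" unfolding S_def by (auto intro: bdd_aboveI)
    define s where "s = Sup S"
    have as: "a \<le> s" unfolding s_def using cSup_upper[OF aS bdd] .
    have sb: "s \<le> b" unfolding s_def by (rule cSup_least) (use aS S_def in auto)
    then obtain w z where wz: "w < s" "s < z" "\<And>p q. p \<in> {w<..<z} \<Longrightarrow> q \<in> {w<..<z} \<Longrightarrow> P p \<Longrightarrow> P q"
      using local[of s] as unfolding atLeastAtMost_iff by metis
    obtain p where p: "p \<in> S" "w < p" using wz(1) less_cSup_iff[of S w] aS bdd unfolding s_def by blast
    have "p \<le> s" unfolding s_def using cSup_upper[OF p(1) bdd] .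
    then have Pq: "P q" if "q \<in> {w<..<z}" for q
      using wz(3)[of p q] that p wz(2) S_def by auto
    have "s = b"
    proof (rule ccontr)
      assume "s \<noteq> b"
      then have "s < min z b" using wz(2) sb by auto
      then obtain q where q: "s < q" "q < min z b" using dense by blast
      have "P q" using Pq[of q] q wz(1) by simp
      moreover have "q < b" using q(2) by simp
      moreover have "a \<le> q" using as q(1) by order
      ultimately have "q \<in> S" unfolding S_def by simp
      then show False using cSup_upper[OF _ bdd] q(1) unfolding s_def by (meson leD)
    qed
    have "P s" using Pq[of s] wz(1,2) by simp
    then show ?thesis unfolding P_def \<open>s = b\<close> .
  qed
qed

text \<open>The range is countable, hence bounded: an increasing recursion of heights never runs off
  the end of the long line and always has a limit height.\<close>

lemma incseq_tendsto_Sup_long_line: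
  fixes a :: "nat \<Rightarrow> long_line"
  assumes "incseq a"
  shows "a \<longlonglongrightarrow> Sup (range a)" and "a k \<le> Sup (range a)"
proof -
  obtain b where "\<forall>x\<in>range a. x < b" using long_line_countable_bounded[of "range a"] by auto
  then have bdd: "bdd_above (range a)" by (metis bdd_aboveI less_imp_le)
  show le: "a k \<le> Sup (range a)" for k using bdd by (auto intro: cSup_upper)
  show "a \<longlonglongrightarrow> Sup (range a)"
  proof (rule order_tendstoI)
    fix y assume "y < Sup (range a)"
    then obtain k where "y < a k" using less_cSup_iff[OF _ bdd] by auto
    then show "eventually (\<lambda>n. y < a n) sequentially"
      using assms unfolding eventually_sequentially incseq_def by (intro exI[of _ k]) (auto intro: less_le_trans)
  next
    fix y assume "Sup (range a) < y"
    then show "eventually (\<lambda>n. a n < y) sequentially"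
      using le by (auto intro: always_eventually order_le_less_trans)
  qed
qed

section \<open>Sets tangent to a foliation\<close>

text \<open>The neighbourhood is intersected with \<open>A\<close>, so this is local constancy in
  the subspace topology of \<open>A\<close> and says nothing about nearby points outside
  \<open>A\<close>. It holds vacuously at points outside all charts; membership in the manifold is
  asked for separately where leaves are produced.\<close>

definition tangent :: "('m::t2_space, 'p::euclidean_space, 'q::euclidean_space) atlas \<Rightarrow> 'm set \<Rightarrow> bool"
  where "tangent F A \<longleftrightarrow> (\<forall>p U \<phi>. p \<in> A \<longrightarrow> (U, \<phi>) \<in> F \<longrightarrow> p \<in> U \<longrightarrow>
    (\<exists>N. open N \<and> p \<in> N \<and> (\<forall>q\<in>N \<inter> A \<inter> U. snd (\<phi> q) = snd (\<phi> p))))"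

lemma foliated_atlas_chart:
  assumes "foliated_atlas M F" "(U, \<phi>) \<in> F"
  shows "open U" "U \<subseteq> M" "\<phi> \<in> extensional U" "open (\<phi> ` U)" "continuous_on U \<phi>" "inj_on \<phi> U"
    and "continuous_on (\<phi> ` U) (inv_into U \<phi>)"
proof -
  obtain \<psi> where *: "open U" "U \<subseteq> M" "\<phi> \<in> extensional U" "open (\<phi> ` U)" "homeomorphism U (\<phi> ` U) \<phi> \<psi>"
    using assms unfolding foliated_atlas_def chart_on_def by fastforce
  show "open U" "U \<subseteq> M" "\<phi> \<in> extensional U" "open (\<phi> ` U)" using * by auto
  show "continuous_on U \<phi>" using *(5) by (simp add: homeomorphism_def)
  show inj: "inj_on \<phi> U" using *(5) by (metis homeomorphism_apply1 inj_onI)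
  have "continuous_on (\<phi> ` U) \<psi>" using *(5) by (simp add: homeomorphism_def)
  moreover have "inv_into U \<phi> z = \<psi> z" if "z \<in> \<phi> ` U" for z
    using that inj *(5) by (auto simp: homeomorphism_apply1)
  ultimately show "continuous_on (\<phi> ` U) (inv_into U \<phi>)"
    by (simp cong: continuous_on_cong)
qed

text \<open>One function \<open>h\<close> of the transverse coordinate serves the whole overlap,
  however many components it has; this is what later compares two charts on an entire
  rectangle.\<close>

lemma foliated_atlas_change:
  assumes F: "foliated_atlas M F" "(U, \<phi>) \<in> F" "(V, \<psi>) \<in> F"
  obtains h where "continuous_on (snd ` \<phi> ` (U \<inter> V)) h" "inj_on h (snd ` \<phi> ` (U \<inter> V))"
    "\<And>q. q \<in> U \<Longrightarrow> q \<in> V \<Longrightarrow> snd (\<psi> q) = h (snd (\<phi> q))"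
proof -
  have "foliated_change (U, \<phi>) (V, \<psi>)" using F unfolding foliated_atlas_def by blast
  then obtain g h h' where h: "homeomorphism (snd ` \<phi> ` (U \<inter> V)) (h ` snd ` \<phi> ` (U \<inter> V)) h h'"
    and e: "\<forall>(x, y)\<in>\<phi> ` (U \<inter> V). \<psi> (inv_into U \<phi> (x, y)) = (g (x, y), h y)"
    unfolding foliated_change_def prod.case by blast
  have "continuous_on (snd ` \<phi> ` (U \<inter> V)) h" using h by (simp add: homeomorphism_def)
  moreover have "inj_on h (snd ` \<phi> ` (U \<inter> V))"
    by (rule inj_on_inverseI) (rule homeomorphism_apply1[OF h])
  moreover have "snd (\<psi> q) = h (snd (\<phi> q))" if q: "q \<in> U" "q \<in> V" for q
  proof -
    have "(fst (\<phi> q), snd (\<phi> q)) \<in> \<phi> ` (U \<inter> V)" using q by auto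
    with e have "\<psi> (inv_into U \<phi> (fst (\<phi> q), snd (\<phi> q))) = (g (fst (\<phi> q), snd (\<phi> q)), h (snd (\<phi> q)))"
      by blast
    then show ?thesis using q foliated_atlas_chart(6)[OF F(1,2)] by simp
  qed
  ultimately show ?thesis using that by blast
qed

lemma foliated_atlas_cover:
  assumes "foliated_atlas M F" "p \<in> M"
  obtains U \<phi> where "(U, \<phi>) \<in> F" "p \<in> U"
  using assms unfolding foliated_atlas_def by fastforce

text \<open>One chart per point is enough, since the transverse coordinate in any other chart is a
  function of the one in the given chart.\<close>

lemma tangentI:
  assumes F: "foliated_atlas M F"
    and ex: "\<And>p. p \<in> A \<Longrightarrow> \<exists>U \<phi> N. (U, \<phi>) \<in> F \<and> p \<in> U \<and> open N \<and> p \<in> N \<and>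
      (\<forall>q\<in>N \<inter> A \<inter> U. snd (\<phi> q) = snd (\<phi> p))"
  shows "tangent F A"
  unfolding tangent_def
proof (intro allI impI)
  fix p V \<psi> assume p: "p \<in> A" "(V, \<psi>) \<in> F" "p \<in> V"
  obtain U \<phi> N where *: "(U, \<phi>) \<in> F" "p \<in> U" "open N" "p \<in> N"
    "\<forall>q\<in>N \<inter> A \<inter> U. snd (\<phi> q) = snd (\<phi> p)" using ex[OF p(1)] by blast
  obtain h where h: "\<And>q. q \<in> U \<Longrightarrow> q \<in> V \<Longrightarrow> snd (\<psi> q) = h (snd (\<phi> q))"
    using foliated_atlas_change[OF F *(1) p(2)] by metis
  have "open (N \<inter> U)" using * foliated_atlas_chart(1)[OF F *(1)] by auto
  moreover have "snd (\<psi> q) = snd (\<psi> p)" if q: "q \<in> N \<inter> U \<inter> A \<inter> V" for q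
  proof -
    have "snd (\<phi> q) = snd (\<phi> p)" using q *(5) by blast
    then show ?thesis using h[of q] h[of p] q *(2) p(3) by simp
  qed
  ultimately show "\<exists>N. open N \<and> p \<in> N \<and> (\<forall>q\<in>N \<inter> A \<inter> V. snd (\<psi> q) = snd (\<psi> p))"
    using *(2,4) by (intro exI[of _ "N \<inter> U"]) blast
qed

lemma tangentD:
  assumes "tangent F A" "p \<in> A" "(U, \<phi>) \<in> F" "p \<in> U"
  obtains N where "open N" "p \<in> N" "\<And>q. q \<in> N \<Longrightarrow> q \<in> A \<Longrightarrow> q \<in> U \<Longrightarrow> snd (\<phi> q) = snd (\<phi> p)"
proof -
  have "\<exists>N. open N \<and> p \<in> N \<and> (\<forall>q\<in>N \<inter> A \<inter> U. snd (\<phi> q) = snd (\<phi> p))"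
    using assms unfolding tangent_def by blast
  then show ?thesis using that by blast
qed

lemma tangent_subset:
  assumes "tangent F B" "A \<subseteq> B"
  shows "tangent F A"
  unfolding tangent_def
proof (intro allI impI)
  fix p U \<phi> assume p: "p \<in> A" "(U, \<phi>) \<in> F" "p \<in> U"
  then have "p \<in> B" using assms(2) by blast
  then obtain N where "open N" "p \<in> N" "\<And>q. q \<in> N \<Longrightarrow> q \<in> B \<Longrightarrow> q \<in> U \<Longrightarrow> snd (\<phi> q) = snd (\<phi> p)"
    using tangentD[OF assms(1) _ p(2,3)] by metis
  then show "\<exists>N. open N \<and> p \<in> N \<and> (\<forall>q\<in>N \<inter> A \<inter> U. snd (\<phi> q) = snd (\<phi> p))"
    using assms(2) by (intro exI[of _ N]) blast
qed

text \<open>At a point outside one of the sets, closedness lets the complement of that set serve as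
  neighbourhood; at a common point both sets take the value of the transverse coordinate at that
  very point.\<close>

lemma tangent_Un:
  assumes A: "tangent F A" "closed A" and B: "tangent F B" "closed B"
  shows "tangent F (A \<union> B)"
  unfolding tangent_def
proof (intro allI impI)
  fix p U \<phi> assume p: "p \<in> A \<union> B" "(U, \<phi>) \<in> F" "p \<in> U"
  have *: "\<exists>N. open N \<and> p \<in> N \<and> (\<forall>q\<in>N \<inter> C \<inter> U. snd (\<phi> q) = snd (\<phi> p))"
    if C: "tangent F C" "closed C" for C
  proof (cases "p \<in> C")
    case True
    obtain N where "open N" "p \<in> N" "\<And>q. q \<in> N \<Longrightarrow> q \<in> C \<Longrightarrow> q \<in> U \<Longrightarrow> snd (\<phi> q) = snd (\<phi> p)"
      using tangentD[OF C(1) True p(2,3)] by metis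
    then show ?thesis by (intro exI[of _ N]) simp
  next
    case False then show ?thesis using C(2) by (intro exI[of _ "- C"]) auto
  qed
  obtain N N' where N: "open N" "p \<in> N" "\<forall>q\<in>N \<inter> A \<inter> U. snd (\<phi> q) = snd (\<phi> p)"
    "open N'" "p \<in> N'" "\<forall>q\<in>N' \<inter> B \<inter> U. snd (\<phi> q) = snd (\<phi> p)" using *[OF A] *[OF B] by blast
  then show "\<exists>N. open N \<and> p \<in> N \<and> (\<forall>q\<in>N \<inter> (A \<union> B) \<inter> U. snd (\<phi> q) = snd (\<phi> p))"
    by (intro exI[of _ "N \<inter> N'"]) blast
qed

lemma tangent_connected_const:
  assumes "tangent F A" "connected A" "A \<subseteq> U" "(U, \<phi>) \<in> F" "p \<in> A" "q \<in> A"
  shows "snd (\<phi> p) = snd (\<phi> q)"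
proof (rule connected_local_const[of A p q "\<lambda>z. snd (\<phi> z)"])
  show "\<forall>a\<in>A. \<forall>\<^sub>F b in at a within A. snd (\<phi> a) = snd (\<phi> b)"
  proof
    fix a assume a: "a \<in> A"
    then have "a \<in> U" using assms by auto
    obtain N where "open N" "a \<in> N" "\<And>q. q \<in> N \<Longrightarrow> q \<in> A \<Longrightarrow> q \<in> U \<Longrightarrow> snd (\<phi> q) = snd (\<phi> a)"
      using tangentD[OF assms(1) a assms(4) \<open>a \<in> U\<close>] by metis
    then show "\<forall>\<^sub>F b in at a within A. snd (\<phi> a) = snd (\<phi> b)"
      using assms(3) unfolding eventually_at_topological by (metis subsetD)
  qed
qed (use assms in auto)

section \<open>Plaques, the leaf topology and the recognition of leaves\<close>

lemma openin_top_of_setI: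
  assumes "\<And>p. p \<in> A \<Longrightarrow> \<exists>T. open T \<and> p \<in> T \<and> T \<inter> S \<subseteq> A" and "A \<subseteq> S"
  shows "openin (top_of_set S) A"
proof -
  have "A = S \<inter> \<Union> {T. open T \<and> T \<inter> S \<subseteq> A}" using assms by auto blast
  then show ?thesis unfolding openin_open by (metis (mono_tags, lifting) mem_Collect_eq open_Union)
qed

text \<open>The leaf coordinates of a plaque form a connected, hence convex, set of reals, so the
  straight segment between those of \<open>p\<close> and \<open>q\<close> lifts to the plaque. The
  work is in the continuity of the lift into the leaf topology, which is tested on the generating
  plaques of all charts.\<close>

lemma plaque_path_component:
  fixes F :: "('m::t2_space, real, real) atlas"
  assumes F: "foliated_atlas M F" and P: "P \<in> plaques F" and pq: "p \<in> P" "q \<in> P"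
  shows "path_component_of (leaf_topology F) p q"
proof -
  obtain U \<phi> y where U: "(U, \<phi>) \<in> F" and Pc: "P \<in> components {z \<in> U. snd (\<phi> z) = y}"
    using P unfolding plaques_def by auto
  note c = foliated_atlas_chart[OF F U]
  have PU: "P \<subseteq> U" and Py: "\<And>z. z \<in> P \<Longrightarrow> snd (\<phi> z) = y"
    using in_components_subset[OF Pc] by auto
  have conn: "connected (fst ` \<phi> ` P)"
    using in_components_connected[OF Pc] PU c(5)
    by (intro connected_continuous_image continuous_on_fst continuous_on_id)
      (auto intro: continuous_on_subset)
  define s where "s t = (1 - t) * fst (\<phi> p) + t * fst (\<phi> q)" for t :: real
  define \<gamma> where "\<gamma> t = inv_into U \<phi> (s t, y)" for t
  have s: "s t \<in> fst ` \<phi> ` P" if "t \<in> {0..1}" for t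
  proof -
    have "convex (fst ` \<phi> ` P)" using conn is_interval_connected_1 is_interval_convex_1 by blast
    then show ?thesis unfolding s_def using pq that
      by (metis (no_types, lifting) atLeastAtMost_iff convex_alt image_eqI real_scaleR_def)
  qed
  have \<gamma>P: "\<gamma> t \<in> P \<and> \<phi> (\<gamma> t) = (s t, y)" if t: "t \<in> {0..1}" for t
  proof -
    obtain z where z: "z \<in> P" "s t = fst (\<phi> z)" using s[OF t] by auto
    then have "(s t, y) = \<phi> z" using Py by (metis prod.collapse)
    moreover have "inv_into U \<phi> (\<phi> z) = z" using z PU c(6) by auto
    ultimately show ?thesis unfolding \<gamma>_def using z by simp
  qed
  have cont: "continuous_on {0..1} \<gamma>"
    unfolding \<gamma>_def
  proof (rule continuous_on_compose2[OF c(7)])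
    show "continuous_on {0..1} (\<lambda>t. (s t, y))" unfolding s_def by (intro continuous_intros)
    show "(\<lambda>t. (s t, y)) ` {0..1} \<subseteq> \<phi> ` U" using \<gamma>P PU by (force simp: image_iff)
  qed
  have "pathin (leaf_topology F) \<gamma>"
    unfolding pathin_def leaf_topology_def
  proof (rule continuous_on_generated_topo)
    fix Q assume "Q \<in> plaques F"
    then obtain V \<psi> y' where V: "(V, \<psi>) \<in> F" and Qc: "Q \<in> components {z \<in> V. snd (\<psi> z) = y'}"
      unfolding plaques_def by auto
    obtain h where h: "\<And>q. q \<in> U \<Longrightarrow> q \<in> V \<Longrightarrow> snd (\<psi> q) = h (snd (\<phi> q))"
      using foliated_atlas_change[OF F U V] by metis
    \<comment> \<open>While the path stays in \<open>V\<close>, its transverse coordinate there is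
      \<open>h y\<close>, hence constant; a short connected piece around \<open>t\<close> therefore
      stays in the component \<open>Q\<close>.\<close>
    have "\<exists>T. open T \<and> t \<in> T \<and> T \<inter> {0..1} \<subseteq> \<gamma> -` Q" if t: "t \<in> \<gamma> -` Q \<inter> {0..1}" for t
    proof -
      have tV: "\<gamma> t \<in> V" "snd (\<psi> (\<gamma> t)) = y'" using t in_components_subset[OF Qc] by auto
      obtain T where T: "open T" "T \<inter> {0..1} = \<gamma> -` V \<inter> {0..1}"
        using cont[unfolded continuous_on_open_invariant, rule_format, OF foliated_atlas_chart(1)[OF F V]]
        by auto
      have "t \<in> T" using T(2) t tV(1) by blast
      with T(1) obtain e where e: "e > 0" "ball t e \<subseteq> T" by (rule openE)
      define B where "B = ball t e \<inter> {0..1}"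
      have "connected B" unfolding B_def by (intro convex_connected convex_Int) auto
      then have "connected (\<gamma> ` B)" using cont B_def by (auto intro!: connected_continuous_image continuous_on_subset[OF cont])
      moreover have sub: "\<gamma> ` B \<subseteq> {z \<in> V. snd (\<psi> z) = y'}"
      proof clarify
        fix u assume u: "u \<in> B"
        then have uV: "\<gamma> u \<in> V" using T(2) e(2) B_def by blast
        have "snd (\<psi> (\<gamma> u)) = h y" "snd (\<psi> (\<gamma> t)) = h y"
          using h[of "\<gamma> u"] h[of "\<gamma> t"] \<gamma>P[of u] \<gamma>P[of t] u t uV tV PU by (auto simp: B_def)
        then show "\<gamma> u \<in> V \<and> snd (\<psi> (\<gamma> u)) = y'" using uV tV by simp
      qed
      moreover have "Q \<inter> \<gamma> ` B \<noteq> {}" using t e(1) B_def by auto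
      ultimately have "\<gamma> ` B \<subseteq> Q" using components_maximal[OF Qc] by blast
      then show ?thesis using e(1) B_def by (intro exI[of _ "ball t e"]) auto
    qed
    then show "openin (top_of_set {0..1}) (\<gamma> -` Q \<inter> topspace (top_of_set {0..1}))"
      by (intro openin_top_of_setI) auto
  next
    show "\<gamma> ` topspace (top_of_set {0..1}) \<subseteq> \<Union> (plaques F)"
      using \<gamma>P P by auto
  qed
  moreover have "\<gamma> 0 = p" "\<gamma> 1 = q"
    unfolding \<gamma>_def s_def using pq PU c(6) Py[of p, symmetric] Py[of q, symmetric]
    by (auto intro: inv_into_f_f) (metis inv_into_f_f prod.collapse subsetD)+
  ultimately show ?thesis unfolding path_component_of_def by blast
qed

text \<open>A slice of a ball at constant transverse coordinate is convex, so its preimage is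
  connected and lies in a single plaque. Without shrinking to a ball, points of the chart at the
  same level could belong to different plaques.\<close>

lemma local_plaque:
  fixes F :: "('m::t2_space, real, real) atlas"
  assumes F: "foliated_atlas M F" and U: "(U, \<phi>) \<in> F" "p \<in> U"
  obtains N P where "open N" "p \<in> N" "N \<subseteq> U" "P \<in> plaques F"
    "\<And>q. q \<in> N \<Longrightarrow> snd (\<phi> q) = snd (\<phi> p) \<Longrightarrow> q \<in> P"
proof -
  note c = foliated_atlas_chart[OF F U(1)]
  have "\<phi> p \<in> \<phi> ` U" using U(2) by simp
  with c(4) obtain e where e: "e > 0" "ball (\<phi> p) e \<subseteq> \<phi> ` U" by (rule openE)
  define N where "N = U \<inter> \<phi> -` ball (\<phi> p) e"
  have "open N" unfolding N_def using c(1,5) by (simp add: continuous_open_preimage)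
  define Y where "Y = ball (\<phi> p) e \<inter> {z. snd z = snd (\<phi> p)}"
  have "convex {z :: real \<times> real. snd z = snd (\<phi> p)}"
    by (auto simp: convex_def algebra_simps) (metis distrib_right mult_1)
  then have "connected Y" unfolding Y_def by (intro convex_connected convex_Int) auto
  then have conn: "connected (inv_into U \<phi> ` Y)"
    using e(2) by (intro connected_continuous_image continuous_on_subset[OF c(7)]) (auto simp: Y_def)
  let ?S = "{z \<in> U. snd (\<phi> z) = snd (\<phi> p)}"
  have sub: "inv_into U \<phi> ` Y \<subseteq> ?S"
    using e(2) c(6) by (auto simp: Y_def inv_into_into f_inv_into_f subset_iff)
  define P where "P = connected_component_set ?S p"
  have "P \<in> components ?S" unfolding P_def components_def using U by auto
  then have "P \<in> plaques F" unfolding plaques_def using U(1) by fastforce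
  moreover have "q \<in> P" if q: "q \<in> N" "snd (\<phi> q) = snd (\<phi> p)" for q
  proof -
    have "q \<in> inv_into U \<phi> ` Y" if "q \<in> N" "snd (\<phi> q) = snd (\<phi> p)" for q
      using that c(6) by (intro image_eqI[of _ _ "\<phi> q"]) (auto simp: Y_def N_def)
    moreover have "p \<in> N" using e(1) U N_def by auto
    ultimately show ?thesis unfolding P_def
      using connected_component_maximal[OF _ conn sub] q by blast
  qed
  ultimately show ?thesis using that \<open>open N\<close> e(1) U N_def by fastforce
qed

lemma topspace_leaf_topology:
  fixes F :: "('m::t2_space, real, real) atlas"
  assumes F: "foliated_atlas M F"
  shows "topspace (leaf_topology F) = M"
proof -
  have "P \<subseteq> M" if "P \<in> plaques F" for P
    using that foliated_atlas_chart(2)[OF F] in_components_subset unfolding plaques_def by fastforce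
  moreover have "p \<in> \<Union> (plaques F)" if "p \<in> M" for p
    using foliated_atlas_cover[OF F that] local_plaque[OF F] by (metis UnionI)
  ultimately show ?thesis unfolding leaf_topology_def by auto
qed

text \<open>The path component is locally constant along \<open>A\<close>: tangency and the local
  plaque put nearby points of \<open>A\<close> into the same plaque.\<close>

lemma tangent_connected_in_leaf:
  fixes F :: "('m::t2_space, real, real) atlas"
  assumes F: "foliated_atlas M F" and A: "tangent F A" "connected A" "A \<noteq> {}" "A \<subseteq> M"
  shows "in_leaf F A"
proof -
  obtain a where a: "a \<in> A" using A by blast
  let ?X = "leaf_topology F"
  have "path_component_of_set ?X a = path_component_of_set ?X b" if "b \<in> A" for b
  proof (rule connected_local_const[OF A(2) a that, of "path_component_of_set ?X"], intro ballI)
    fix p assume p: "p \<in> A"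
    then obtain U \<phi> where U: "(U, \<phi>) \<in> F" "p \<in> U" using foliated_atlas_cover[OF F] A by blast
    obtain N where N: "open N" "p \<in> N" "\<And>q. q \<in> N \<Longrightarrow> q \<in> A \<Longrightarrow> q \<in> U \<Longrightarrow> snd (\<phi> q) = snd (\<phi> p)"
      using tangentD[OF A(1) p U] by metis
    obtain N' P where N': "open N'" "p \<in> N'" "N' \<subseteq> U" "P \<in> plaques F"
      "\<And>q. q \<in> N' \<Longrightarrow> snd (\<phi> q) = snd (\<phi> p) \<Longrightarrow> q \<in> P" using local_plaque[OF F U] by metis
    have "path_component_of_set ?X p = path_component_of_set ?X q" if "q \<in> N \<inter> N'" "q \<in> A" for q
    proof -
      have "q \<in> P" "p \<in> P" using N N' that by auto
      then have "path_component_of ?X p q" using plaque_path_component[OF F N'(4)] by blast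
      then show ?thesis by (metis path_component_of_equiv)
    qed
    then show "\<forall>\<^sub>F q in at p within A. path_component_of_set ?X p = path_component_of_set ?X q"
      unfolding eventually_at_topological using N N' by (intro exI[of _ "N \<inter> N'"]) auto
  qed
  moreover have "b \<in> path_component_of_set ?X b" if "b \<in> A" for b
    using that A(4) by (auto simp: path_component_of_refl topspace_leaf_topology[OF F])
  ultimately have "A \<subseteq> path_component_of_set ?X a" by blast
  moreover have "path_component_of_set ?X a \<in> leaves F"
    unfolding leaves_def path_components_of_def using a A(4) by (auto simp: topspace_leaf_topology[OF F])
  ultimately show ?thesis unfolding in_leaf_def by blast
qed

text \<open>Two nontrivial intervals on a common side of \<open>c\<close> would share further
  points; hence they lie on opposite sides and together surround \<open>c\<close>.\<close>

lemma two_sided_interval: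
  fixes A B :: "real set"
  assumes "connected A" "connected B" "A \<inter> B = {c}" "A \<noteq> {c}" "B \<noteq> {c}"
  shows "\<exists>e>0. ball c e \<subseteq> A \<union> B"
proof -
  have c: "c \<in> A" "c \<in> B" using assms(3) by auto
  obtain a b where ab: "a \<in> A" "a \<noteq> c" "b \<in> B" "b \<noteq> c" using c assms(4,5) by blast
  have seg: "{min x z..max x z} \<subseteq> C" if "connected C" "x \<in> C" "z \<in> C" for x z and C :: "real set"
    using connected_contains_Icc[OF that(1)] that by (simp add: min_def max_def)
  note segA = seg[OF assms(1) c(1) ab(1)] and segB = seg[OF assms(2) c(2) ab(3)]
  have "\<not> (a > c \<and> b > c)"
  proof
    assume "a > c \<and> b > c"
    then have "min a b \<in> A \<inter> B" "min a b \<noteq> c"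
      using seg[OF assms(1) c(1) ab(1)] seg[OF assms(2) c(2) ab(3)] by (auto simp: min_def max_def)
    then show False using assms(3) by auto
  qed
  moreover have "\<not> (a < c \<and> b < c)"
  proof
    assume "a < c \<and> b < c"
    then have "max a b \<in> A \<inter> B" "max a b \<noteq> c"
      using seg[OF assms(1) c(1) ab(1)] seg[OF assms(2) c(2) ab(3)] by (auto simp: min_def max_def)
    then show False using assms(3) by auto
  qed
  ultimately consider "a < c" "c < b" | "b < c" "c < a" using ab by linarith
  then have "min a b < c \<and> c < max a b \<and> {min a b..max a b} \<subseteq> A \<union> B"
  proof cases
    case 1
    then have "{a..c} \<subseteq> A" "{c..b} \<subseteq> B" using segA segB by simp_all
    moreover have "{a..b} \<subseteq> {a..c} \<union> {c..b}" by auto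
    ultimately show ?thesis using 1 by auto
  next
    case 2
    then have "{c..a} \<subseteq> A" "{b..c} \<subseteq> B" using segA segB by simp_all
    moreover have "{b..a} \<subseteq> {b..c} \<union> {c..a}" by auto
    ultimately show ?thesis using 2 by auto
  qed
  moreover have "ball c (min (c - min a b) (max a b - c)) \<subseteq> {min a b..max a b}"
    by (auto simp: dist_real_def)
  ultimately show ?thesis
    by (intro exI[of _ "min (c - min a b) (max a b - c)"]) auto
qed

text \<open>Two arcs in \<open>S\<close> that meet only at \<open>p\<close> cover a neighbourhood of \<open>p\<close> in its plaque, so \<open>S\<close> is
  open, as well as closed, in the leaf topology.\<close>

lemma tangent_leafI:
  fixes F :: "('m::t2_space, real, real) atlas"
  assumes F: "foliated_atlas M F"
    and S: "tangent F S" "connected S" "S \<noteq> {}" "S \<subseteq> M" "closed S"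
    and arcs: "\<And>p N. p \<in> S \<Longrightarrow> open N \<Longrightarrow> p \<in> N \<Longrightarrow>
      \<exists>A B. connected A \<and> connected B \<and> A \<subseteq> S \<inter> N \<and> B \<subseteq> S \<inter> N \<and> A \<inter> B = {p} \<and> A \<noteq> {p} \<and> B \<noteq> {p}"
  shows "S \<in> leaves F"
proof -
  let ?X = "leaf_topology F"
  \<comment> \<open>The plaque is connected and \<open>P \<inter> S\<close> is closed in it, so only
    openness of \<open>P \<inter> S\<close> in \<open>P\<close> is at stake; this is where the arcs
    are needed.\<close>
  have sat: "P \<subseteq> S" if P: "P \<in> plaques F" "P \<inter> S \<noteq> {}" for P
  proof -
    obtain U \<phi> y where U: "(U, \<phi>) \<in> F" and Pc: "P \<in> components {z \<in> U. snd (\<phi> z) = y}"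
      using P unfolding plaques_def by auto
    note c = foliated_atlas_chart[OF F U]
    have PU: "P \<subseteq> U" and Py: "\<And>z. z \<in> P \<Longrightarrow> snd (\<phi> z) = y"
      using in_components_subset[OF Pc] by auto
    have "\<exists>T. open T \<and> p \<in> T \<and> T \<inter> P \<subseteq> S" if p: "p \<in> P \<inter> S" for p
    proof -
      have pU: "p \<in> U" and py: "snd (\<phi> p) = y" using p PU Py by auto
      obtain N where N: "open N" "p \<in> N" "\<And>q. q \<in> N \<Longrightarrow> q \<in> S \<Longrightarrow> q \<in> U \<Longrightarrow> snd (\<phi> q) = snd (\<phi> p)"
        using tangentD[OF S(1) _ U pU] p by (metis IntD2)
      obtain A B where AB: "connected A" "connected B" "A \<subseteq> S \<inter> (N \<inter> U)" "B \<subseteq> S \<inter> (N \<inter> U)"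
        "A \<inter> B = {p}" "A \<noteq> {p}" "B \<noteq> {p}"
        using arcs[of p "N \<inter> U"] p pU N c(1) by (metis Int_iff open_Int)
      let ?e = "\<lambda>z. fst (\<phi> z)"
      have \<phi>: "\<phi> z = (?e z, y)" if "z \<in> A \<union> B" for z
        using N(3)[of z] that AB py by (metis IntD1 IntD2 Un_iff prod.collapse subsetD)
      \<comment> \<open>On the arcs the transverse coordinate is fixed, so the leaf coordinate alone
        distinguishes points and turns the arcs into two real intervals meeting in one
        point.\<close>
      have inj: "inj_on ?e (A \<union> B)"
      proof (rule inj_onI)
        fix z w assume zw: "z \<in> A \<union> B" "w \<in> A \<union> B" "?e z = ?e w"
        then have "\<phi> z = \<phi> w" using \<phi>[of z] \<phi>[of w] by simp
        moreover have "z \<in> U" "w \<in> U" using zw AB(3,4) by blast+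
        ultimately show "z = w" using c(6) by (simp add: inj_on_def)
      qed
      have "connected (?e ` A)" "connected (?e ` B)"
        using AB(1-4) by (auto intro!: connected_continuous_image continuous_on_fst continuous_on_subset[OF c(5)])
      moreover have "?e ` A \<inter> ?e ` B = {?e p}"
        using inj AB(5) by (metis image_empty image_insert inj_on_image_Int sup_ge1 sup_ge2)
      moreover have "?e ` C \<noteq> {?e p}" if C: "C = A \<or> C = B" for C
      proof
        assume eq: "?e ` C = {?e p}"
        have "z = p" if "z \<in> C" for z
          using inj_onD[OF inj, of z p] that eq C AB(5) by blast
        then show False using C AB(5-7) by blast
      qed
      ultimately obtain r where r: "r > 0" "ball (?e p) r \<subseteq> ?e ` A \<union> ?e ` B"
        using two_sided_interval[of "?e ` A" "?e ` B" "?e p"] by auto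
      define T where "T = U \<inter> ?e -` ball (?e p) r"
      have "open T" unfolding T_def using c(1,5)
        by (intro continuous_open_preimage continuous_on_fst) auto
      moreover have "p \<in> T" using pU r(1) T_def by auto
      moreover have "q \<in> S" if q: "q \<in> T \<inter> P" for q
      proof -
        have "?e q \<in> ?e ` (A \<union> B)" using q r(2) unfolding T_def by auto
        then obtain q' where q': "q' \<in> A \<union> B" "?e q = ?e q'" by blast
        then have "\<phi> q = \<phi> q'" using \<phi>[OF q'(1)] Py[of q] q by (metis IntD2 prod.collapse)
        moreover have "q \<in> U" "q' \<in> U" using q' q PU AB(3,4) by blast+
        ultimately have "q = q'" using c(6) by (simp add: inj_on_def)
        then show ?thesis using q' AB by auto
      qed
      ultimately show ?thesis by blast
    qed
    then have "openin (top_of_set P) (P \<inter> S)"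
      by (intro openin_top_of_setI) auto
    moreover have "closedin (top_of_set P) (P \<inter> S)"
      using S(5) by (simp add: closedin_closed_Int)
    ultimately show ?thesis
      using in_components_connected[OF Pc] P(2) unfolding connected_clopen by blast
  qed
  have cover: "\<Union> (plaques F) = M"
    using topspace_leaf_topology[OF F] unfolding leaf_topology_def by simp
  have plo: "openin ?X P" if "P \<in> plaques F" for P
    unfolding leaf_topology_def by (rule topology_generated_by_Basis[OF that])
  \<comment> \<open>Every plaque lies in \<open>S\<close> or misses it, so \<open>S\<close> and its
    complement in \<open>M\<close> are unions of generating open sets: \<open>S\<close> is clopen,
    and a connected leaf containing \<open>S\<close> cannot be larger.\<close>
  have "S = \<Union> {P \<in> plaques F. P \<inter> S \<noteq> {}}" using sat cover S(4) by blast
  then have op: "openin ?X S" using plo by (metis (no_types, lifting) mem_Collect_eq openin_Union)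
  have "M - S = \<Union> {P \<in> plaques F. P \<inter> S = {}}" using sat cover S(4) by blast
  then have "openin ?X (M - S)" using plo by (metis (no_types, lifting) mem_Collect_eq openin_Union)
  then have cl: "closedin ?X S"
    using S(4) unfolding closedin_def topspace_leaf_topology[OF F] by simp
  obtain L where L: "L \<in> leaves F" "S \<subseteq> L"
    using tangent_connected_in_leaf[OF F S(1-4)] unfolding in_leaf_def by blast
  have "connectedin ?X L"
    using L(1) unfolding leaves_def path_components_of_def
    by (auto intro: path_connectedin_imp_connectedin path_connectedin_path_component_of)
  then have "L \<subseteq> S" using connectedin_clopen_cases[OF _ cl op] L(2) S(3) by (auto simp: disjnt_iff)
  then show ?thesis using L by auto
qed

text \<open>Composing with the inverse of \<open>g\<close> leaves the images of charts and overlaps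
  under the chart maps unchanged (\<open>img\<close>), so the old transition data \<open>k\<close>,
  \<open>h\<close>, \<open>h'\<close> can be reused.\<close>

lemma image_atlas_foliated:
  assumes g: "bij g" "continuous_on UNIV g" "continuous_on UNIV (inv g)" and F: "foliated_atlas M F"
  shows "foliated_atlas (g ` M) (image_atlas g F)"
proof -
  let ?r = "\<lambda>U \<phi>. restrict (\<phi> \<circ> inv g) (g ` U)"
  have inv [simp]: "inv g (g x) = x" "g (inv g x) = x" for x
    using g(1) by (simp_all add: bij_is_inj bij_is_surj surj_f_inv_f)
  have img: "?r U \<phi> ` (g ` U') = \<phi> ` U'" if "U' \<subseteq> U" for U \<phi> U'
    unfolding image_image using that by (intro image_cong) auto
  have im: "open (g ` U)" if "open U" for U
  proof -
    have "g ` U = inv g -` U" by (metis g(1) bij_vimage_eq_inv_image inv_inv_eq bij_imp_bij_inv)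
    then show ?thesis using g(3) that by (simp add: open_vimage)
  qed
  have intg: "g ` U \<inter> g ` V = g ` (U \<inter> V)" for U V
    using g(1) by (simp add: bij_is_inj image_Int)
  have "chart_on (g ` M) (g ` U, ?r U \<phi>)" if U: "(U, \<phi>) \<in> F" for U \<phi>
  proof -
    note c = foliated_atlas_chart[OF F U]
    have "homeomorphism (g ` U) (\<phi> ` U) (?r U \<phi>) (g \<circ> inv_into U \<phi>)"
      unfolding homeomorphism_def
    proof (intro conjI)
      show "continuous_on (\<phi> ` U) (g \<circ> inv_into U \<phi>)"
        unfolding comp_def by (rule continuous_on_compose2[OF g(2) c(7)]) simp
      have "continuous_on (g ` U) (\<phi> \<circ> inv g)"
        unfolding comp_def
        by (rule continuous_on_compose2[OF c(5) continuous_on_subset[OF g(3)]]) auto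
      then show "continuous_on (g ` U) (?r U \<phi>)" by (simp cong: continuous_on_cong)
    qed (use c(6) img[of U U \<phi>] in \<open>auto simp: image_image\<close>)
    then show ?thesis
      unfolding chart_on_def using c(1,2,4) im img[of U U \<phi>] by auto
  qed
  moreover have "foliated_change (g ` U, ?r U \<phi>) (g ` V, ?r V \<psi>)"
    if U: "(U, \<phi>) \<in> F" and V: "(V, \<psi>) \<in> F" for U \<phi> V \<psi>
  proof -
    have "foliated_change (U, \<phi>) (V, \<psi>)" using F U V unfolding foliated_atlas_def by blast
    then obtain k h h' where h: "homeomorphism (snd ` \<phi> ` (U \<inter> V)) (h ` snd ` \<phi> ` (U \<inter> V)) h h'"
      and e: "\<forall>(x, y)\<in>\<phi> ` (U \<inter> V). \<psi> (inv_into U \<phi> (x, y)) = (k (x, y), h y)"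
      unfolding foliated_change_def prod.case by blast
    note c = foliated_atlas_chart[OF F U]
    have injr: "inj_on (?r U \<phi>) (g ` U)" using c(6) by (auto simp: inj_on_def)
    have inv_r: "inv_into (g ` U) (?r U \<phi>) (\<phi> q) = g q" if "q \<in> U" for q
      using inv_into_f_f[OF injr, of "g q"] that by simp
    have "?r V \<psi> (inv_into (g ` U) (?r U \<phi>) (x, y)) = (k (x, y), h y)" if xy: "(x, y) \<in> \<phi> ` (U \<inter> V)" for x y
    proof -
      obtain q where q: "q \<in> U" "q \<in> V" "(x, y) = \<phi> q" using xy by auto
      have "\<psi> (inv_into U \<phi> (x, y)) = (k (x, y), h y)" using e xy by blast
      then show ?thesis using q inv_r[OF q(1)] c(6) by auto
    qed
    then have "\<forall>(x, y)\<in>\<phi> ` (U \<inter> V). ?r V \<psi> (inv_into (g ` U) (?r U \<phi>) (x, y)) = (k (x, y), h y)"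
      by blast
    moreover have "?r U \<phi> ` (g ` U \<inter> g ` V) = \<phi> ` (U \<inter> V)"
      unfolding intg by (rule img) simp
    ultimately show ?thesis
      unfolding foliated_change_def prod.case using h
      by (intro exI[of _ k] exI[of _ h] exI[of _ h']) simp
  qed
  moreover have "\<Union> (fst ` image_atlas g F) = g ` M"
  proof -
    have "\<Union> (fst ` F) = M" using F unfolding foliated_atlas_def by blast
    then show ?thesis unfolding image_atlas_def by (force simp: image_image case_prod_unfold)
  qed
  ultimately show ?thesis
    unfolding foliated_atlas_def image_atlas_def by fastforce
qed

lemma tangent_image_atlas:
  assumes g: "bij g" "continuous_on UNIV (inv g)" and A: "tangent F A"
  shows "tangent (image_atlas g F) (g ` A)"
  unfolding tangent_def
proof (intro allI impI)
  have inv [simp]: "inv g (g x) = x" for x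
    using g(1) by (simp add: bij_is_inj)
  fix p' V \<psi> assume p': "p' \<in> g ` A" "(V, \<psi>) \<in> image_atlas g F" "p' \<in> V"
  then obtain p where p: "p \<in> A" "(V, \<psi>) \<in> image_atlas g F" "g p \<in> V" "p' = g p" by blast
  then obtain U \<phi> where U: "(U, \<phi>) \<in> F" "V = g ` U" "\<psi> = restrict (\<phi> \<circ> inv g) (g ` U)"
    unfolding image_atlas_def by auto
  have "p \<in> U" using p(3) g(1) U(2) by (simp add: bij_is_inj inj_image_mem_iff)
  obtain N where N: "open N" "p \<in> N" "\<And>q. q \<in> N \<Longrightarrow> q \<in> A \<Longrightarrow> q \<in> U \<Longrightarrow> snd (\<phi> q) = snd (\<phi> p)"
    using tangentD[OF A p(1) U(1) \<open>p \<in> U\<close>] by metis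
  have "open (inv g -` N)" using g(2) N(1) by (simp add: open_vimage)
  moreover have "snd (\<psi> q) = snd (\<psi> p')" if "q \<in> inv g -` N \<inter> g ` A \<inter> V" for q
    using that N U \<open>p \<in> U\<close> p(4) by (auto simp: inj_eq[OF bij_is_inj[OF g(1)]])
  ultimately show "\<exists>N. open N \<and> p' \<in> N \<and> (\<forall>q\<in>N \<inter> g ` A \<inter> V. snd (\<psi> q) = snd (\<psi> p'))"
    using N(2) p(4) by (intro exI[of _ "inv g -` N"]) auto
qed

section \<open>Coherent families of functions on a long strip\<close>

lemma long_line_Icc_separable:
  fixes l u :: long_line
  assumes "l \<le> u"
  obtains D where "countable D" "closure D = {l..u}"
proof (cases "l = u")
  case True
  then show ?thesis using that[of "{l}"] by simp
next
  case False
  obtain E where E: "countable E" "\<And>p q. l \<le> p \<and> p < q \<and> q \<le> u \<Longrightarrow> \<exists>d\<in>E. p < d \<and> d < q"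
    using long_line_dense_countable[of l u] by metis
  define D where "D = E \<inter> {l..u}"
  have "x \<in> closure D" if x: "x \<in> {l..u}" for x
    unfolding closure_iff_nhds_not_empty
  proof (intro allI impI)
    fix A V assume V: "V \<subseteq> A" "open V" "x \<in> V"
    show "D \<inter> A \<noteq> {}"
    proof (cases "x < u")
      case True
      obtain z where z: "x < z" "{x..<z} \<subseteq> V" using open_right[OF V(2,3) True] by blast
      obtain d where "d \<in> E" "x < d" "d < min z u" using E(2)[of x "min z u"] z x True by auto
      then show ?thesis using V(1) z x unfolding D_def by fastforce
    next
      case False
      then have "x = u" "l < x" using x \<open>l \<noteq> u\<close> by auto
      obtain z where z: "z < x" "{z<..x} \<subseteq> V" using open_left[OF V(2,3) \<open>l < x\<close>] by blast
      obtain d where "d \<in> E" "max z l < d" "d < x" using E(2)[of "max z l" x] z x \<open>l < x\<close> by auto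
      then show ?thesis using V(1) z x unfolding D_def by fastforce
    qed
  qed
  moreover have "closure D \<subseteq> {l..u}" unfolding D_def by (rule closure_minimal) auto
  ultimately show ?thesis using that[of D] E(1) unfolding D_def by blast
qed

text \<open>Connectedness yields a point of the closure with the middle value, and the open
  condition of lying strictly between \<open>a\<close> and \<open>b\<close> then also holds at some
  point of \<open>Q\<close>.\<close>

lemma continuous_on_dense_between:
  fixes f :: "'a::topological_space \<Rightarrow> real"
  assumes f: "continuous_on (closure Q) f" "connected (closure Q)"
    and "p \<in> closure Q" "q \<in> closure Q" "f p \<le> a" "a < b" "b \<le> f q"
  obtains z where "z \<in> Q" "a < f z" "f z < b"
proof -
  have "connected (f ` closure Q)" using f by (rule connected_continuous_image)
  then have "(a + b) / 2 \<in> f ` closure Q"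
    by (rule connectedD_interval[of _ "f p" "f q"]) (use assms(3-7) in \<open>simp_all add: field_simps\<close>)
  then obtain v where v: "v \<in> closure Q" "f v = (a + b) / 2" by auto
  obtain T where T: "open T" "T \<inter> closure Q = f -` {a<..<b} \<inter> closure Q"
    using f(1)[unfolded continuous_on_open_invariant, rule_format, OF open_greaterThanLessThan[of a b]]
    by (elim exE conjE)
  have "v \<in> T" using T(2) v assms(6) by auto
  then have "T \<inter> Q \<noteq> {}" using v(1) T(1) open_Int_closure_eq_empty by blast
  then obtain z where z: "z \<in> T" "z \<in> Q" by blast
  then have "z \<in> f -` {a<..<b}" using T(2) closure_subset[of Q] by blast
  then show ?thesis using that z(2) by simp
qed

text \<open>\<open>g \<delta>\<close> stands for the transverse coordinate of a chart containing \<open>{l..u} \<times> {\<beta>..\<delta>}\<close>.\<close>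

locale coherent_family =
  fixes l u \<beta> :: long_line and g :: "long_line \<Rightarrow> long_line \<times> long_line \<Rightarrow> real"
  assumes lu: "l \<le> u"
    and cont: "\<beta> \<le> \<delta> \<Longrightarrow> continuous_on ({l..u} \<times> {\<beta>..\<delta>}) (g \<delta>)"
    and coherent: "\<beta> \<le> \<delta> \<Longrightarrow> \<delta> \<le> e \<Longrightarrow> p \<in> {l..u} \<times> {\<beta>..\<delta>} \<Longrightarrow> q \<in> {l..u} \<times> {\<beta>..\<delta>} \<Longrightarrow>
      g e p \<le> g e q \<longleftrightarrow> g \<delta> p \<le> g \<delta> q"
begin

definition strip :: "(long_line \<times> long_line) set"
  where "strip = {l..u} \<times> {\<beta>..}"

text \<open>Each pair is compared in the lowest rectangle containing both points; by coherence any
  higher rectangle gives the same answer. This is the strict part of a total preorder on the strip,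
  and two points are level when neither is below the other.\<close>

definition below :: "long_line \<times> long_line \<Rightarrow> long_line \<times> long_line \<Rightarrow> bool"
  where "below p q \<longleftrightarrow> g (max (snd p) (snd q)) p < g (max (snd p) (snd q)) q"

lemma mem_strip: "p \<in> {l..u} \<times> {\<beta>..\<delta>} \<longleftrightarrow> p \<in> strip \<and> snd p \<le> \<delta>"
  by (auto simp: strip_def)

lemma pair_strip [simp]: "(x, y) \<in> strip \<longleftrightarrow> l \<le> x \<and> x \<le> u \<and> \<beta> \<le> y"
  by (auto simp: strip_def)

lemma strip_ge: "p \<in> strip \<Longrightarrow> \<beta> \<le> snd p"
  by (auto simp: strip_def)

lemma below_iff:
  assumes "p \<in> strip" "q \<in> strip" "snd p \<le> \<delta>" "snd q \<le> \<delta>"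
  shows "below p q \<longleftrightarrow> g \<delta> p < g \<delta> q"
proof -
  have "g \<delta> q \<le> g \<delta> p \<longleftrightarrow> g (max (snd p) (snd q)) q \<le> g (max (snd p) (snd q)) p"
    using assms strip_ge by (intro coherent) (auto simp: mem_strip le_max_iff_disj)
  then show ?thesis unfolding below_def by (auto simp: not_le[symmetric])
qed

lemma below_trans:
  assumes "below p q" "below q r" "p \<in> strip" "q \<in> strip" "r \<in> strip"
  shows "below p r"
proof -
  define \<delta> where "\<delta> = max (snd p) (max (snd q) (snd r))"
  have "snd p \<le> \<delta>" "snd q \<le> \<delta>" "snd r \<le> \<delta>" unfolding \<delta>_def by (simp_all add: le_max_iff_disj)
  then show ?thesis using assms below_iff[of _ _ \<delta>] by (meson less_trans)
qed

lemma not_below_below: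
  assumes "\<not> below q p" "below q r" "p \<in> strip" "q \<in> strip" "r \<in> strip"
  shows "below p r"
proof -
  define \<delta> where "\<delta> = max (snd p) (max (snd q) (snd r))"
  have "snd p \<le> \<delta>" "snd q \<le> \<delta>" "snd r \<le> \<delta>" unfolding \<delta>_def by (simp_all add: le_max_iff_disj)
  then show ?thesis using assms below_iff[of _ _ \<delta>] by (meson le_less_trans not_le)
qed

lemma below_not_below:
  assumes "below p q" "\<not> below r q" "p \<in> strip" "q \<in> strip" "r \<in> strip"
  shows "below p r"
proof -
  define \<delta> where "\<delta> = max (snd p) (max (snd q) (snd r))"
  have "snd p \<le> \<delta>" "snd q \<le> \<delta>" "snd r \<le> \<delta>" unfolding \<delta>_def by (simp_all add: le_max_iff_disj)
  then show ?thesis using assms below_iff[of _ _ \<delta>] by (meson less_le_trans not_le)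
qed

lemma below_asym: "below p q \<Longrightarrow> p \<in> strip \<Longrightarrow> q \<in> strip \<Longrightarrow> \<not> below q p"
  using below_iff[of p q "max (snd p) (snd q)"] below_iff[of q p "max (snd p) (snd q)"] by auto

lemma vertical_tendsto:
  assumes "x \<in> {l..u}" "c \<longlonglongrightarrow> \<alpha>" "\<And>k. \<beta> \<le> c k" "\<And>k. c k \<le> \<alpha>"
  shows "(\<lambda>k. g \<alpha> (x, c k)) \<longlonglongrightarrow> g \<alpha> (x, \<alpha>)"
proof (rule continuous_on_tendsto_compose[OF cont])
  show "\<beta> \<le> \<alpha>" using assms order_trans by blast
  then show "(x, \<alpha>) \<in> {l..u} \<times> {\<beta>..\<alpha>}" using assms(1) by auto
  show "\<forall>\<^sub>F k in sequentially. (x, c k) \<in> {l..u} \<times> {\<beta>..\<alpha>}"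
    using assms by (auto intro: always_eventually)
  show "(\<lambda>k. (x, c k)) \<longlonglongrightarrow> (x, \<alpha>)" using assms(2) by (intro tendsto_Pair) auto
qed

lemma continuous_on_slice:
  assumes "\<beta> \<le> y" "y \<le> \<delta>"
  shows "continuous_on {l..u} (\<lambda>x. g \<delta> (x, y))"
proof -
  have \<beta>: "\<beta> \<le> \<delta>" using assms by simp
  have "continuous_on {l..u} (\<lambda>x. (x, y))" by (intro continuous_intros)
  then show ?thesis
    by (rule continuous_on_compose2[OF cont[OF \<beta>]]) (use assms in auto)
qed

text \<open>A function that kept returning below \<open>s\<close> and above \<open>t\<close> would be discontinuous at the
  supremum of an alternating sequence of heights.\<close>

lemma eventually_above_or_below:
  assumes x: "x \<in> {l..u}" and st: "s \<in> strip" "t \<in> strip" "below s t"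
  obtains \<gamma> where "\<beta> \<le> \<gamma>" "(\<forall>y\<ge>\<gamma>. below s (x, y)) \<or> (\<forall>y\<ge>\<gamma>. below (x, y) t)"
proof (rule ccontr)
  note found = that
  assume "\<not> thesis"
  then have "\<exists>y\<ge>\<gamma>. \<not> below s (x, y)" "\<exists>y\<ge>\<gamma>. \<not> below (x, y) t" if "\<beta> \<le> \<gamma>" for \<gamma>
    using found[OF that] by blast+
  then obtain A B where A: "\<And>\<gamma>. \<beta> \<le> \<gamma> \<Longrightarrow> \<gamma> \<le> A \<gamma> \<and> \<not> below s (x, A \<gamma>)"
    and B: "\<And>\<gamma>. \<beta> \<le> \<gamma> \<Longrightarrow> \<gamma> \<le> B \<gamma> \<and> \<not> below (x, B \<gamma>) t" by metis
  \<comment> \<open>Starting no lower than \<open>s\<close> and \<open>t\<close> lets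
    \<open>g \<alpha>\<close>, at the limit height \<alpha>, compare both with every term of the
    alternating sequence \<open>a 0\<close>, \<open>A (a 0)\<close>, \<open>a 1\<close>, and so
    on.\<close>
  define \<gamma>0 where "\<gamma>0 = max (snd s) (snd t)"
  define a where "a = rec_nat \<gamma>0 (\<lambda>_ y. B (A y))"
  have a0: "a 0 = \<gamma>0" and aS: "a (Suc k) = B (A (a k))" for k by (simp_all add: a_def)
  have "\<beta> \<le> \<gamma>0" unfolding \<gamma>0_def using strip_ge[OF st(1)] by (simp add: le_max_iff_disj)
  have a\<beta>: "\<beta> \<le> a k" for k
  proof (induction k)
    case 0 show ?case using \<open>\<beta> \<le> \<gamma>0\<close> a0 by simp
  next
    case (Suc k)
    then show ?case unfolding aS using A B by (meson order_trans)
  qed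
  have A\<beta>: "\<beta> \<le> A (a k)" for k using A[OF a\<beta>] a\<beta> by (meson order_trans)
  have aA: "a k \<le> A (a k)" and Aa: "A (a k) \<le> a (Suc k)" for k
    using A[OF a\<beta>] B[OF A\<beta>] unfolding aS by auto
  have inc: "incseq a" using aA Aa by (intro incseq_SucI) (meson order_trans)
  define \<alpha> where "\<alpha> = Sup (range a)"
  note lim = incseq_tendsto_Sup_long_line[OF inc, folded \<alpha>_def]
  have a\<alpha>: "snd s \<le> \<alpha>" "snd t \<le> \<alpha>" using lim(2)[of 0] unfolding a0 \<gamma>0_def by auto
  have A\<alpha>: "A (a k) \<le> \<alpha>" for k using Aa lim(2) by (meson order_trans)
  have limS: "(\<lambda>k. a (Suc k)) \<longlonglongrightarrow> \<alpha>" using lim(1) by (rule LIMSEQ_Suc)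
  have limA: "(\<lambda>k. A (a k)) \<longlonglongrightarrow> \<alpha>"
    by (rule tendsto_sandwich[OF _ _ lim(1) limS]) (use aA Aa in auto)
  have "g \<alpha> (x, A (a k)) \<le> g \<alpha> s" for k
    using A[OF a\<beta>] below_iff[of s "(x, A (a k))" \<alpha>] st x A\<alpha> a\<alpha> A\<beta> by (auto simp: not_less)
  then have 1: "g \<alpha> (x, \<alpha>) \<le> g \<alpha> s"
    using vertical_tendsto[OF x limA A\<beta> A\<alpha>] by (intro LIMSEQ_le_const2) auto
  have "g \<alpha> t \<le> g \<alpha> (x, a (Suc k))" for k
    using B[OF A\<beta>[of k]] below_iff[of "(x, a (Suc k))" t \<alpha>] st x lim(2)[of "Suc k"] a\<alpha> a\<beta>[of "Suc k"]
    by (auto simp: not_less aS)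
  then have 2: "g \<alpha> t \<le> g \<alpha> (x, \<alpha>)"
    using vertical_tendsto[OF x limS a\<beta> lim(2)] by (intro LIMSEQ_le_const) auto
  show False using 1 2 below_iff[OF st(1,2) a\<alpha>] st(3) by simp
qed

text \<open>By \<open>bd\<close> no level occurs beyond those of the rectangle up to \<delta>, and
  these are separated by the countable dense set \<open>?Q\<close>. For each dense vertical and each
  pair in \<open>?Q\<close> there is a height beyond which the vertical stays above the lower point
  or below the upper one. Past a common bound \<gamma> of these countably many heights a dense
  vertical cannot change its level; continuity in \<open>x\<close> gives the rest.\<close>

lemma bounded_vertical:
  assumes \<delta>: "\<beta> \<le> \<delta>"
    and bd: "\<And>p. p \<in> strip \<Longrightarrow> \<exists>r\<in>strip. snd r \<le> \<delta> \<and> \<not> below p r \<and> \<not> below r p"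
  shows "\<exists>\<gamma>\<ge>\<beta>. \<forall>x\<in>{l..u}. \<forall>y\<ge>\<gamma>. \<forall>e\<ge>y. g e (x, y) = g e (x, \<gamma>)"
proof -
  obtain D where D: "countable D" "closure D = {l..u}" using long_line_Icc_separable[OF lu] .
  obtain E where E: "countable E" "closure E = {\<beta>..\<delta>}" using long_line_Icc_separable[OF \<delta>] .
  let ?Q = "D \<times> E"
  have clQ: "closure ?Q = {l..u} \<times> {\<beta>..\<delta>}" using D E by (simp add: closure_Times)
  have Ds: "x \<in> {l..u}" if "x \<in> D" for x using that closure_subset D(2) by blast
  have Qs: "q \<in> strip" "snd q \<le> \<delta>" if "q \<in> ?Q" for q
    using that closure_subset[of ?Q] mem_strip[of q \<delta>] unfolding clQ by blast+
  have "\<exists>\<gamma>\<ge>\<beta>. below s t \<longrightarrow> (\<forall>y\<ge>\<gamma>. below s (x, y)) \<or> (\<forall>y\<ge>\<gamma>. below (x, y) t)"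
    if "x \<in> D" "s \<in> ?Q" "t \<in> ?Q" for x s t
    using eventually_above_or_below[of x s t] Ds Qs that by (metis order_refl)
  then obtain G where G: "\<And>x s t. x \<in> D \<Longrightarrow> s \<in> ?Q \<Longrightarrow> t \<in> ?Q \<Longrightarrow> below s t \<Longrightarrow>
      (\<forall>y\<ge>G x s t. below s (x, y)) \<or> (\<forall>y\<ge>G x s t. below (x, y) t)" by metis
  have "countable (insert \<beta> ((\<lambda>(x, s, t). G x s t) ` (D \<times> ?Q \<times> ?Q)))"
    using D(1) E(1) by (intro countable_insert countable_image countable_SIGMA) auto
  from long_line_countable_bounded[OF this] obtain \<gamma> where \<gamma>: "\<beta> < \<gamma>"
    "\<And>x s t. x \<in> D \<Longrightarrow> s \<in> ?Q \<Longrightarrow> t \<in> ?Q \<Longrightarrow> G x s t < \<gamma>" by auto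
  have between: "\<exists>q\<in>?Q. below r q \<and> below q r'"
    if r: "r \<in> strip" "snd r \<le> \<delta>" "r' \<in> strip" "snd r' \<le> \<delta>" "below r r'" for r r'
  proof -
    have "r \<in> closure ?Q" "r' \<in> closure ?Q" unfolding clQ using r mem_strip by blast+
    moreover have "g \<delta> r < g \<delta> r'" using r below_iff by blast
    moreover have "continuous_on (closure ?Q) (g \<delta>)" "connected (closure ?Q)"
      unfolding clQ using cont[OF \<delta>] by (auto intro: connected_Times)
    ultimately obtain q where "q \<in> ?Q" "g \<delta> r < g \<delta> q" "g \<delta> q < g \<delta> r'"
      using continuous_on_dense_between[of ?Q "g \<delta>" r r' "g \<delta> r" "g \<delta> r'"] by (metis order_refl)
    then show ?thesis using below_iff r Qs by blast
  qed
  have nb: "\<not> below (x, y) (x, y')" if x: "x \<in> D" and y: "\<gamma> \<le> y" "\<gamma> \<le> y'" for x y y'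
  proof
    assume b: "below (x, y) (x, y')"
    have s: "(x, y) \<in> strip" "(x, y') \<in> strip" using x y Ds[OF x] \<gamma>(1) by auto
    obtain r where r: "r \<in> strip" "snd r \<le> \<delta>" "\<not> below (x, y) r" "\<not> below r (x, y)" using bd[OF s(1)] by blast
    obtain r' where r': "r' \<in> strip" "snd r' \<le> \<delta>" "\<not> below (x, y') r'" "\<not> below r' (x, y')" using bd[OF s(2)] by blast
    \<comment> \<open>Two separating points \<open>q\<close> and \<open>p\<close> are inserted: the
      vertical is below \<open>q\<close> at height \<open>y\<close> and above \<open>p\<close> at
      height \<open>y'\<close>, which refutes both alternatives for this pair.\<close>
    have "below r r'" using b r r' s by (meson below_not_below not_below_below)
    then obtain q where q: "q \<in> ?Q" "below r q" "below q r'" using between r r' by blast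
    obtain p where p: "p \<in> ?Q" "below q p" "below p r'" using between q r' Qs by blast
    have "below (x, y) q" using r q s Qs by (meson not_below_below)
    moreover have "below p (x, y')" using r' p s Qs by (meson below_not_below)
    moreover have "(\<forall>y\<ge>G x q p. below q (x, y)) \<or> (\<forall>y\<ge>G x q p. below (x, y) p)" using G x q(1) p(1,2) by blast
    moreover have "G x q p \<le> y" "G x q p \<le> y'" using \<gamma>(2)[OF x q(1) p(1)] y by auto
    ultimately show False using below_asym s Qs q(1) p(1) by blast
  qed
  have "g e (x, y) = g e (x, \<gamma>)" if x: "x \<in> {l..u}" and y: "\<gamma> \<le> y" "y \<le> e" for x y e
  proof -
    have "\<gamma> \<le> e" "\<beta> \<le> \<gamma>" "\<beta> \<le> y" using y \<gamma>(1) by (simp, simp, meson less_imp_le order_trans)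
    then have "g e (d, y) - g e (d, \<gamma>) = 0" if d: "d \<in> D" for d
      using nb[OF d, of y \<gamma>] nb[OF d, of \<gamma> y] below_iff[of "(d, y)" "(d, \<gamma>)" e] below_iff[of "(d, \<gamma>)" "(d, y)" e]
        Ds[OF d] y by auto
    moreover have "continuous_on (closure D) (\<lambda>d. g e (d, y) - g e (d, \<gamma>))"
      unfolding D(2) using y \<gamma>(1) by (intro continuous_on_diff continuous_on_slice) auto
    ultimately have "g e (x, y) - g e (x, \<gamma>) = 0"
      using x by (intro continuous_constant_on_closure[of D "\<lambda>d. g e (d, y) - g e (d, \<gamma>)" 0 x]) (auto simp: D(2))
    then show ?thesis by simp
  qed
  then show ?thesis using less_imp_le[OF \<gamma>(1)] by blast
qed

definition unbounded_above :: bool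
  where "unbounded_above \<longleftrightarrow> (\<forall>\<delta>\<ge>\<beta>. \<exists>p\<in>strip. \<forall>r\<in>strip. snd r \<le> \<delta> \<longrightarrow> below r p)"

text \<open>The bound \<gamma> is uniform in \<open>x\<close>, in contrast to
  \<open>unbounded_above\<close>, where one exceptional point for each \<delta> suffices.\<close>

definition escapes_above :: bool
  where "escapes_above \<longleftrightarrow> (\<forall>\<delta>\<ge>\<beta>. \<exists>\<gamma>\<ge>\<beta>. \<forall>p\<in>strip. \<forall>x\<in>{l..u}. \<forall>y\<ge>\<gamma>. snd p \<le> \<delta> \<longrightarrow> below p (x, y))"

text \<open>On a countable dense set of verticals, each vertical is either bounded or escapes every bound. A
  common bound for the former leaves a gap in the values at some height, which the intermediate
  value theorem forbids unless all verticals are of the same kind.\<close>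

lemma unbounded_escapes:
  assumes unb: unbounded_above
  shows escapes_above
proof -
  obtain D where D: "countable D" "closure D = {l..u}" using long_line_Icc_separable[OF lu] .
  have Ds: "x \<in> {l..u}" if "x \<in> D" for x using that closure_subset D(2) by blast
  have above: "\<exists>t\<in>strip. \<forall>r\<in>strip. snd r \<le> \<delta> \<longrightarrow> below r t" if "\<beta> \<le> \<delta>" for \<delta>
    using unb that unfolding unbounded_above_def by blast
  have above1: "\<exists>t\<in>strip. below s t" if "s \<in> strip" for s
    using above[OF strip_ge[OF that]] that by blast
  define bnd where "bnd x \<longleftrightarrow> (\<exists>t\<in>strip. \<forall>y\<ge>\<beta>. below (x, y) t)" for x
  have esc: "\<exists>\<gamma>\<ge>\<beta>. \<forall>y\<ge>\<gamma>. below t (x, y)" if x: "x \<in> D" "\<not> bnd x" and t: "t \<in> strip" for x t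
  proof -
    obtain t' where t': "t' \<in> strip" "below t t'" using above1[OF t] by blast
    obtain \<gamma> where \<gamma>: "\<beta> \<le> \<gamma>" "(\<forall>y\<ge>\<gamma>. below t (x, y)) \<or> (\<forall>y\<ge>\<gamma>. below (x, y) t')"
      using eventually_above_or_below[OF Ds[OF x(1)] t t'] .
    have "\<not> (\<forall>y\<ge>\<gamma>. below (x, y) t')"
    proof
      assume b: "\<forall>y\<ge>\<gamma>. below (x, y) t'"
      have "\<beta> \<le> max \<gamma> (snd t')" using \<gamma>(1) by (simp add: le_max_iff_disj)
      \<comment> \<open>\<open>w\<close> lies above the part of the vertical up to \<gamma> and also
        above \<open>t'\<close>, hence above the whole vertical, which would make it
        bounded.\<close>
      then obtain w where w: "w \<in> strip" "\<And>r. r \<in> strip \<Longrightarrow> snd r \<le> max \<gamma> (snd t') \<Longrightarrow> below r w"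
        using above by blast
      have "below (x, y) w" if y: "\<beta> \<le> y" for y
      proof (cases "y \<le> \<gamma>")
        case True
        then show ?thesis using w(2)[of "(x, y)"] y Ds[OF x(1)] by (simp add: le_max_iff_disj)
      next
        case False
        then have "below (x, y) t'" using b by simp
        then show ?thesis using below_trans w(1) w(2)[of t'] t'(1) y Ds[OF x(1)]
          by (metis atLeastAtMost_iff max.cobounded2 pair_strip)
      qed
      then show False using x(2) w(1) unfolding bnd_def by blast
    qed
    then show ?thesis using \<gamma> by blast
  qed
  have "\<exists>t\<in>strip. bnd x \<longrightarrow> (\<forall>y\<ge>\<beta>. below (x, y) t)" for x
  proof (cases "bnd x")
    case True then show ?thesis unfolding bnd_def by blast
  next
    case False
    have "(l, \<beta>) \<in> strip" using lu by simp
    then show ?thesis using False by blast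
  qed
  then obtain T where T: "\<And>x. T x \<in> strip" "\<And>x y. bnd x \<Longrightarrow> \<beta> \<le> y \<Longrightarrow> below (x, y) (T x)" by metis
  have "countable (insert \<beta> ((\<lambda>x. snd (T x)) ` D))" using D(1) by simp
  from long_line_countable_bounded[OF this] obtain \<delta> where \<delta>: "\<beta> < \<delta>" "\<And>x. x \<in> D \<Longrightarrow> snd (T x) < \<delta>" by auto
  obtain t1 where t1: "t1 \<in> strip" "\<And>r. r \<in> strip \<Longrightarrow> snd r \<le> \<delta> \<Longrightarrow> below r t1"
    using above[of \<delta>] \<delta>(1) by (metis less_imp_le)
  have bndD: "below (x, y) t1" if "x \<in> D" "bnd x" "\<beta> \<le> y" for x y
    using below_trans[OF T(2)[OF that(2,3)] t1(2)[OF T(1)]] T(1) t1(1) \<delta>(2)[OF that(1)] that Ds[OF that(1)]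
    by (simp add: less_imp_le)
  \<comment> \<open>Bounded dense verticals stay below \<open>t1\<close>, while the others
    eventually exceed \<open>t2\<close>; the values between the two form the gap.\<close>
  obtain t2 where t2: "t2 \<in> strip" "below t1 t2" using above1[OF t1(1)] by blast
  have esc_all: "\<exists>\<gamma>\<ge>\<beta>. \<forall>x\<in>D. \<not> bnd x \<longrightarrow> (\<forall>y\<ge>\<gamma>. below t (x, y))" if t: "t \<in> strip" for t
  proof -
    have "\<exists>\<gamma>\<ge>\<beta>. x \<in> D \<longrightarrow> \<not> bnd x \<longrightarrow> (\<forall>y\<ge>\<gamma>. below t (x, y))" for x
      using esc[of x t] t by blast
    then obtain G where G: "\<And>x y. x \<in> D \<Longrightarrow> \<not> bnd x \<Longrightarrow> G x \<le> y \<Longrightarrow> below t (x, y)" by metis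
    have "countable (insert \<beta> (G ` D))" using D(1) by simp
    from long_line_countable_bounded[OF this] obtain \<gamma> where \<gamma>: "\<beta> < \<gamma>" "\<And>x. x \<in> D \<Longrightarrow> G x < \<gamma>" by auto
    have "below t (x, y)" if "x \<in> D" "\<not> bnd x" "\<gamma> \<le> y" for x y
      using G[OF that(1,2)] \<gamma>(2)[OF that(1)] that(3) by (meson less_imp_le order_trans)
    then show ?thesis using \<gamma>(1) by (meson less_imp_le)
  qed
  have "bnd x \<longleftrightarrow> bnd x'" if x: "x \<in> D" "x' \<in> D" for x x'
  proof -
    have False if b: "v \<in> D" "bnd v" "w \<in> D" "\<not> bnd w" for v w
    proof -
      obtain \<gamma> where \<gamma>: "\<beta> \<le> \<gamma>" "\<And>x y. x \<in> D \<Longrightarrow> \<not> bnd x \<Longrightarrow> \<gamma> \<le> y \<Longrightarrow> below t2 (x, y)"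
        using esc_all[OF t2(1)] by blast
      define e where "e = max \<gamma> (max (snd t1) (snd t2))"
      have e: "\<gamma> \<le> e" "snd t1 \<le> e" "snd t2 \<le> e"
        unfolding e_def by (simp_all add: le_max_iff_disj)
      let ?k = "\<lambda>x. g e (x, \<gamma>)"
      have lo: "?k x < g e t1" if "x \<in> D" "bnd x" for x
        using bndD[OF that \<gamma>(1)] below_iff[of "(x, \<gamma>)" t1 e] Ds[OF that(1)] \<gamma>(1) e t1(1) by simp
      have hi: "g e t2 < ?k x" if "x \<in> D" "\<not> bnd x" for x
        using \<gamma>(2)[OF that order_refl] below_iff[of t2 "(x, \<gamma>)" e] Ds[OF that(1)] \<gamma>(1) e t2(1) by simp
      have lt: "g e t1 < g e t2" using t2 t1(1) e below_iff by blast
      have "v \<in> closure D" "w \<in> closure D" using b closure_subset by blast+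
      moreover have "continuous_on (closure D) ?k" unfolding D(2) using continuous_on_slice \<gamma>(1) e(1) by blast
      moreover have "connected (closure D)" unfolding D(2) by simp
      ultimately obtain z where "z \<in> D" "g e t1 < ?k z" "?k z < g e t2"
        using continuous_on_dense_between[of D ?k v w "g e t1" "g e t2"] lo[OF b(1,2)] hi[OF b(3,4)] lt
        by (metis less_imp_le)
      then show False using lo[of z] hi[of z] by (cases "bnd z") auto
    qed
    then show ?thesis using x by blast
  qed
  \<comment> \<open>If all dense verticals were bounded, \<open>t1\<close> would bound the whole
    strip by continuity in \<open>x\<close>.\<close>
  moreover have "\<not> (\<forall>x\<in>D. bnd x)"
  proof
    assume all: "\<forall>x\<in>D. bnd x"
    obtain p where p: "p \<in> strip" "below t1 p" using above1[OF t1(1)] by blast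
    define e where "e = max (snd p) (snd t1)"
    have e: "snd p \<le> e" "snd t1 \<le> e" unfolding e_def by auto
    have "g e (x, snd p) \<le> g e t1" if "x \<in> D" for x
      using bndD[OF that _ strip_ge[OF p(1)]] all that below_iff[of "(x, snd p)" t1 e] Ds[OF that] e t1(1)
        strip_ge[OF p(1)] by simp
    moreover have "continuous_on (closure D) (\<lambda>x. g e (x, snd p))"
      unfolding D(2) using continuous_on_slice strip_ge[OF p(1)] e(1) by blast
    moreover have "fst p \<in> closure D" using p(1) D(2) by (auto simp: strip_def)
    ultimately have "g e (fst p, snd p) \<le> g e t1"
      using continuous_le_on_closure[of D "\<lambda>x. g e (x, snd p)" "fst p" "g e t1"] by blast
    then show False using p t1(1) e below_iff[of t1 p e] by simp
  qed
  ultimately have nbnd: "\<not> bnd x" if "x \<in> D" for x using that by blast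
  show ?thesis
    unfolding escapes_above_def
  proof (intro allI impI)
    fix \<delta> assume "\<beta> \<le> \<delta>"
    then obtain t where t: "t \<in> strip" "\<And>r. r \<in> strip \<Longrightarrow> snd r \<le> \<delta> \<Longrightarrow> below r t" using above by blast
    \<comment> \<open>The spare point \<open>t'\<close> absorbs the loss of strictness in passing
      from dense verticals to all \<open>x\<close>.\<close>
    obtain t' where t': "t' \<in> strip" "below t t'" using above1[OF t(1)] by blast
    obtain \<gamma> where \<gamma>: "\<beta> \<le> \<gamma>" "\<And>x y. x \<in> D \<Longrightarrow> \<gamma> \<le> y \<Longrightarrow> below t' (x, y)"
      using esc_all[OF t'(1)] nbnd by blast
    have "below p (x, y)" if p: "p \<in> strip" "snd p \<le> \<delta>" and x: "x \<in> {l..u}" and y: "\<gamma> \<le> y" for p x y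
    proof -
      define e where "e = max y (max (snd t) (snd t'))"
      have e: "y \<le> e" "snd t \<le> e" "snd t' \<le> e"
        unfolding e_def by (simp_all add: le_max_iff_disj)
      have \<beta>y: "\<beta> \<le> y" using \<gamma>(1) y by simp
      have "g e t' \<le> g e (d, y)" if "d \<in> D" for d
        using \<gamma>(2)[OF that y] below_iff[of t' "(d, y)" e] Ds[OF that] e t'(1) \<beta>y by simp
      moreover have "continuous_on (closure D) (\<lambda>x. g e (x, y))"
        unfolding D(2) using continuous_on_slice \<beta>y e(1) by blast
      ultimately have "g e t' \<le> g e (x, y)"
        using continuous_ge_on_closure[of D "\<lambda>x. g e (x, y)" x "g e t'"] x D(2) by blast
      moreover have "g e t < g e t'" using t(1) t' e below_iff by blast
      ultimately have "below t (x, y)" using below_iff[of t "(x, y)" e] t(1) x \<beta>y e by simp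
      then show ?thesis using below_trans[OF t(2)[OF p]] p(1) t(1) x \<beta>y by simp
    qed
    then show "\<exists>\<gamma>\<ge>\<beta>. \<forall>p\<in>strip. \<forall>x\<in>{l..u}. \<forall>y\<ge>\<gamma>. snd p \<le> \<delta> \<longrightarrow> below p (x, y)" using \<gamma>(1) by blast
  qed
qed

text \<open>The first clause replaces a closed unbounded set of level heights by limits of sequences
  that outrun a threshold \<theta>; thresholds can be enlarged and combined, and \<open>k0\<close>
  allows one to be respected only from some step on. The second clause denies that any vertical
  becomes constant, so that the two kinds of end exclude each other. Both clauses compare values of
  \<open>g\<close> only by equality and so ignore its sign.\<close>

definition horizontal :: bool
  where "horizontal \<longleftrightarrow>
    (\<exists>\<theta>. \<forall>a k0 \<alpha>. incseq a \<and> a \<longlonglongrightarrow> \<alpha> \<and> (\<forall>k\<ge>k0. \<theta> (a k) \<le> a (Suc k)) \<longrightarrow>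
      \<beta> \<le> \<alpha> \<and> (\<forall>x\<in>{l..u}. \<forall>x'\<in>{l..u}. g \<alpha> (x, \<alpha>) = g \<alpha> (x', \<alpha>))) \<and>
    (\<forall>x\<in>{l..u}. \<forall>\<gamma>\<ge>\<beta>. \<exists>y\<ge>\<gamma>. g y (x, \<gamma>) \<noteq> g y (x, y))"

text \<open>From height \<open>\<theta> \<delta>\<close> on, every point exceeds everything up to
  \<delta>. Along a sequence outrunning \<theta>, the values on any two verticals therefore
  interlace and have the same limit at \<alpha>.\<close>

lemma escapes_horizontal:
  assumes esc: escapes_above
  shows horizontal
proof -
  have "\<exists>\<gamma>\<ge>\<beta>. \<forall>p\<in>strip. \<forall>x\<in>{l..u}. \<forall>y\<ge>\<gamma>. snd p \<le> \<delta> \<longrightarrow> below p (x, y)" for \<delta>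
  proof (cases "\<beta> \<le> \<delta>")
    case True then show ?thesis using esc unfolding escapes_above_def by blast
  next
    case False
    then have "\<not> snd p \<le> \<delta>" if "p \<in> strip" for p using strip_ge[OF that] by (meson order_trans)
    then show ?thesis by blast
  qed
  then obtain \<theta> where \<theta>: "\<And>\<delta>. \<beta> \<le> \<theta> \<delta>"
    "\<And>\<delta> p x y. p \<in> strip \<Longrightarrow> x \<in> {l..u} \<Longrightarrow> \<theta> \<delta> \<le> y \<Longrightarrow> snd p \<le> \<delta> \<Longrightarrow> below p (x, y)" by metis
  have "\<beta> \<le> \<alpha> \<and> (\<forall>x\<in>{l..u}. \<forall>x'\<in>{l..u}. g \<alpha> (x, \<alpha>) = g \<alpha> (x', \<alpha>))"
    if a: "incseq a" "a \<longlonglongrightarrow> \<alpha>" "\<forall>k\<ge>k0. \<theta> (a k) \<le> a (Suc k)" for a k0 \<alpha>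
  proof -
    have a\<alpha>: "a k \<le> \<alpha>" for k using incseq_le[OF a(1,2)] .
    \<comment> \<open>The shift by one more than \<open>k0\<close> secures
      \<open>\<beta> \<le> b k\<close>: a term is known to be at least \<beta> only once it is at
      least some value of \<theta>.\<close>
    define b where "b k = a (k + Suc k0)" for k
    have b\<theta>: "\<theta> (b k) \<le> b (Suc k)" for k using a(3) unfolding b_def by simp
    have b\<beta>: "\<beta> \<le> b k" for k
      unfolding b_def using \<theta>(1)[of "a (k + k0)"] a(3)[rule_format, of "k + k0"] by simp
    have b\<alpha>: "b k \<le> \<alpha>" for k using a\<alpha> b_def by simp
    have limb: "b \<longlonglongrightarrow> \<alpha>" unfolding b_def using a(2) by (rule LIMSEQ_ignore_initial_segment)
    have le: "g \<alpha> (x, \<alpha>) \<le> g \<alpha> (x', \<alpha>)" if x: "x \<in> {l..u}" "x' \<in> {l..u}" for x x'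
    proof (rule LIMSEQ_le)
      show "(\<lambda>k. g \<alpha> (x, b k)) \<longlonglongrightarrow> g \<alpha> (x, \<alpha>)" using vertical_tendsto[OF x(1) limb b\<beta> b\<alpha>] .
      show "(\<lambda>k. g \<alpha> (x', b (Suc k))) \<longlonglongrightarrow> g \<alpha> (x', \<alpha>)"
        using vertical_tendsto[OF x(2) LIMSEQ_Suc[OF limb] b\<beta> b\<alpha>] .
      have "g \<alpha> (x, b k) \<le> g \<alpha> (x', b (Suc k))" for k
        using \<theta>(2)[of "(x, b k)" x' "b k" "b (Suc k)"] x b\<beta> b\<theta> b\<alpha> below_iff[of "(x, b k)" "(x', b (Suc k))" \<alpha>] by simp
      then show "\<exists>N. \<forall>k\<ge>N. g \<alpha> (x, b k) \<le> g \<alpha> (x', b (Suc k))" by blast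
    qed
    have "\<beta> \<le> \<alpha>" using b\<beta>[of 0] b\<alpha>[of 0] by (rule order_trans)
    then show ?thesis using le by (meson antisym)
  qed
  moreover have "\<exists>y\<ge>\<gamma>. g y (x, \<gamma>) \<noteq> g y (x, y)" if "x \<in> {l..u}" "\<beta> \<le> \<gamma>" for x \<gamma>
  proof (intro exI conjI)
    let ?y = "max \<gamma> (\<theta> \<gamma>)"
    show "\<gamma> \<le> ?y" by simp
    have "below (x, \<gamma>) (x, ?y)" using \<theta>(2)[of "(x, \<gamma>)" x \<gamma> ?y] that by simp
    then show "g ?y (x, \<gamma>) \<noteq> g ?y (x, ?y)"
      using below_iff[of "(x, \<gamma>)" "(x, ?y)" ?y] that by (auto simp: le_max_iff_disj)
  qed
  ultimately show ?thesis unfolding horizontal_def by blast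
qed

text \<open>The image of the rectangle under \<open>g e\<close> is an interval. A point with
  rectangle points both above and below it has its value in that interval and so is level with some
  rectangle point.\<close>

lemma outside_level_sets:
  assumes \<delta>: "\<beta> \<le> \<delta>" and p: "p \<in> strip" and out: "\<And>r. r \<in> strip \<Longrightarrow> snd r \<le> \<delta> \<Longrightarrow> below p r \<or> below r p"
  shows "(\<forall>r\<in>strip. snd r \<le> \<delta> \<longrightarrow> below p r) \<or> (\<forall>r\<in>strip. snd r \<le> \<delta> \<longrightarrow> below r p)"
proof (rule ccontr)
  assume "\<not> ?thesis"
  then obtain r r' where r: "r \<in> strip" "snd r \<le> \<delta>" "below p r" "r' \<in> strip" "snd r' \<le> \<delta>" "below r' p"
    using out by blast
  define e where "e = max \<delta> (snd p)"
  have e: "\<delta> \<le> e" "snd p \<le> e" unfolding e_def by auto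
  have "continuous_on ({l..u} \<times> {\<beta>..\<delta>}) (g e)"
    using cont[OF order_trans[OF \<delta> e(1)]] by (rule continuous_on_subset) (use e(1) in auto)
  then have "connected (g e ` ({l..u} \<times> {\<beta>..\<delta>}))"
    by (intro connected_continuous_image connected_Times) auto
  moreover have "g e r' \<le> g e p" "g e p \<le> g e r"
    using below_iff[of p r e] below_iff[of r' p e] r p e
      order_trans[OF r(2) e(1)] order_trans[OF r(5) e(1)] by auto
  ultimately have "g e p \<in> g e ` ({l..u} \<times> {\<beta>..\<delta>})"
    using connectedD_interval[of _ "g e r'" "g e r"] r mem_strip by blast
  then obtain q where q': "q \<in> {l..u} \<times> {\<beta>..\<delta>}" and q3: "g e p = g e q" by (rule imageE)
  then have q: "q \<in> strip" "snd q \<le> \<delta>" "g e q = g e p" by (simp_all only: mem_strip)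
  then show False
    using out[OF q(1,2)] below_iff[of p q e] below_iff[of q p e] p e order_trans[OF q(2) e(1)] by auto
qed

lemma coherent_family_uminus: "coherent_family l u \<beta> (\<lambda>\<delta> p. - g \<delta> p)"
proof
  show "l \<le> u" by (rule lu)
  show "continuous_on ({l..u} \<times> {\<beta>..\<delta>}) (\<lambda>p. - g \<delta> p)" if "\<beta> \<le> \<delta>" for \<delta>
    using cont[OF that] by (rule continuous_on_minus)
  fix \<delta> e p q
  assume "\<beta> \<le> \<delta>" "\<delta> \<le> e" "p \<in> {l..u} \<times> {\<beta>..\<delta>}" "q \<in> {l..u} \<times> {\<beta>..\<delta>}"
  from coherent[OF this(1,2,4,3)] show "- g e p \<le> - g e q \<longleftrightarrow> - g \<delta> p \<le> - g \<delta> q" by simp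
qed

text \<open>Being unbounded in either direction leads to \<open>horizontal\<close>, the downward one
  by changing the sign of \<open>g\<close>. If neither happens, the larger of two bounding heights
  serves both directions, and every point of the strip is level with some point of that
  rectangle.\<close>

lemma vertical_or_horizontal:
  "(\<exists>\<gamma>\<ge>\<beta>. \<forall>x\<in>{l..u}. \<forall>y\<ge>\<gamma>. \<forall>e\<ge>y. g e (x, y) = g e (x, \<gamma>)) \<or> horizontal"
proof (rule disjCI)
  interpret neg: coherent_family l u \<beta> "\<lambda>\<delta> p. - g \<delta> p"
    by (rule coherent_family_uminus)
  have neg_below: "neg.below p q \<longleftrightarrow> below q p" for p q
    unfolding below_def neg.below_def by (simp add: max.commute)

  have neg_horizontal: "neg.horizontal \<longleftrightarrow> horizontal"
    unfolding horizontal_def neg.horizontal_def by simp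
  assume "\<not> horizontal"
  then have "\<not> unbounded_above" "\<not> neg.unbounded_above"
    using unbounded_escapes escapes_horizontal neg.unbounded_escapes neg.escapes_horizontal neg_horizontal
    by blast+
  then obtain \<delta>1 \<delta>2 where d: "\<beta> \<le> \<delta>1" "\<not> (\<exists>p\<in>strip. \<forall>r\<in>strip. snd r \<le> \<delta>1 \<longrightarrow> below r p)"
    "\<beta> \<le> \<delta>2" "\<not> (\<exists>p\<in>strip. \<forall>r\<in>strip. snd r \<le> \<delta>2 \<longrightarrow> below p r)"
    unfolding unbounded_above_def neg.unbounded_above_def neg_below by blast
  show "\<exists>\<gamma>\<ge>\<beta>. \<forall>x\<in>{l..u}. \<forall>y\<ge>\<gamma>. \<forall>e\<ge>y. g e (x, y) = g e (x, \<gamma>)"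
  proof (rule bounded_vertical)
    show \<beta>: "\<beta> \<le> max \<delta>1 \<delta>2" using d(1) by (simp add: le_max_iff_disj)
    fix p assume p: "p \<in> strip"
    show "\<exists>r\<in>strip. snd r \<le> max \<delta>1 \<delta>2 \<and> \<not> below p r \<and> \<not> below r p"
    proof (rule ccontr)
      assume "\<not> ?thesis"
      then have "(\<forall>r\<in>strip. snd r \<le> max \<delta>1 \<delta>2 \<longrightarrow> below p r) \<or> (\<forall>r\<in>strip. snd r \<le> max \<delta>1 \<delta>2 \<longrightarrow> below r p)"
        by (intro outside_level_sets[OF \<beta> p]) blast
      then show False using d(2,4) p by (meson le_max_iff_disj)
    qed
  qed
qed

end

section \<open>Ends of a foliation of a strip\<close>

lemma long_line_open_box:
  fixes x y :: long_line
  assumes "open U" "(x, y) \<in> U"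
  obtains x1 x2 y1 y2 where "x1 < x" "x < x2" "y1 < y" "y < y2" "{x1<..<x2} \<times> {y1<..<y2} \<subseteq> U"
proof -
  obtain A B where AB: "open A" "open B" "(x, y) \<in> A \<times> B" "A \<times> B \<subseteq> U"
    using open_prod_elim[OF assms] by blast
  obtain x1 x2 where x: "x1 < x" "x < x2" "{x1<..<x2} \<subseteq> A"
    using long_line_open_interval[OF AB(1)] AB(3) by blast
  obtain y1 y2 where y: "y1 < y" "y < y2" "{y1<..<y2} \<subseteq> B"
    using long_line_open_interval[OF AB(2)] AB(3) by blast
  show ?thesis using that[OF x(1,2) y(1,2)] x(3) y(3) AB(4) by blast
qed

text \<open>An identity of transverse coordinates passes from \<open>C\<close> to its closure
  although continuity is known only on a chart neighbourhood \<open>W\<close>; this is how tangency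
  is carried to limit heights and boundary points.\<close>

lemma nonzero_meets_closure:
  fixes k :: "'a::topological_space \<Rightarrow> real"
  assumes "continuous_on W k" "open W" "z \<in> W" "z \<in> closure C" "\<And>w. w \<in> W \<Longrightarrow> w \<in> C \<Longrightarrow> k w = 0"
  shows "k z = 0"
proof (rule ccontr)
  assume "k z \<noteq> 0"
  have "open (W \<inter> k -` (- {0}))" using assms(1,2) by (intro continuous_open_preimage) auto
  moreover have "z \<in> W \<inter> k -` (- {0})" using assms(3) \<open>k z \<noteq> 0\<close> by simp
  ultimately have "C \<inter> (W \<inter> k -` (- {0})) \<noteq> {}"
    using assms(4) unfolding closure_iff_nhds_not_empty by blast
  then show False using assms(5) by auto
qed

text \<open>Only the upward end is studied; the other three ends are upward ends of rotated
  foliations. Positivity of \<open>b\<close> keeps the symmetric intervals [-\<alpha>, \<alpha>]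
  nondegenerate.\<close>

locale foliated_upwards =
  fixes M :: "(long_line \<times> long_line) set" and F :: "(long_line \<times> long_line, real, real) atlas"
    and b :: long_line
  assumes F: "foliated_atlas M F" and above_b: "b \<le> y \<Longrightarrow> (x, y) \<in> M" and b_pos: "0 < b"
begin

text \<open>If no height \<open>\<beta>\<close> and no neighbourhood of \<open>x\<close> worked, one could climb to a limit height
  \<open>\<alpha>\<close> at which the chart around \<open>(x, \<alpha>)\<close> contradicts the choice of an earlier step.\<close>

lemma long_chart_strip:
  obtains l u \<beta> where "l < x" "x < u" "b \<le> \<beta>"
    "\<And>\<delta>. \<beta> \<le> \<delta> \<Longrightarrow> \<exists>U \<phi>. (U, \<phi>) \<in> F \<and> {l..u} \<times> {\<beta>..\<delta>} \<subseteq> U"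
proof (rule ccontr)
  note found = that
  assume nt: "\<not> thesis"
  obtain x0 where x0: "x0 < x" using lt_ex by blast
  obtain x3 where x3: "x < x3" using gt_ex by blast
  obtain D where D: "countable D" "\<And>p q. x0 \<le> p \<and> p < q \<and> q \<le> x3 \<Longrightarrow> \<exists>d\<in>D. p < d \<and> d < q"
    using long_line_dense_countable[of x0 x3] by metis
  \<comment> \<open>End points in a countable dense set leave countably many candidate
    neighbourhoods, so that a single step \<open>s\<close> can pass the failure heights \<Delta> of
    all of them.\<close>
  define P where "P = {(l, u). l \<in> D \<and> u \<in> D \<and> l < x \<and> x < u}"
  have "P \<subseteq> D \<times> D" unfolding P_def by blast
  then have P: "countable P" using D(1) by (meson countable_SIGMA countable_subset)
  have "\<exists>\<delta>\<ge>\<beta>. \<forall>U \<phi>. (U, \<phi>) \<in> F \<longrightarrow> \<not> {fst z..snd z} \<times> {\<beta>..\<delta>} \<subseteq> U" if "z \<in> P" "b \<le> \<beta>" for z \<beta>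
  proof (rule ccontr)
    assume "\<not> ?thesis"
    then have "\<And>\<delta>. \<beta> \<le> \<delta> \<Longrightarrow> \<exists>U \<phi>. (U, \<phi>) \<in> F \<and> {fst z..snd z} \<times> {\<beta>..\<delta>} \<subseteq> U" by blast
    moreover have "fst z < x" "x < snd z" using that(1) unfolding P_def by auto
    ultimately show False using found[of "fst z" "snd z" \<beta>] that(2) nt by blast
  qed
  then obtain \<Delta> where \<Delta>: "\<And>z \<beta>. z \<in> P \<Longrightarrow> b \<le> \<beta> \<Longrightarrow>
      \<beta> \<le> \<Delta> z \<beta> \<and> (\<forall>U \<phi>. (U, \<phi>) \<in> F \<longrightarrow> \<not> {fst z..snd z} \<times> {\<beta>..\<Delta> z \<beta>} \<subseteq> U)" by metis
  have "\<exists>s. \<beta> < s \<and> (\<forall>z\<in>P. \<Delta> z \<beta> < s)" for \<beta>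
  proof -
    have "countable (insert \<beta> ((\<lambda>z. \<Delta> z \<beta>) ` P))" using P by simp
    from long_line_countable_bounded[OF this] show ?thesis by auto
  qed
  then obtain s where s: "\<And>\<beta>. \<beta> < s \<beta>" "\<And>\<beta> z. z \<in> P \<Longrightarrow> \<Delta> z \<beta> < s \<beta>" by metis
  define a where "a = rec_nat b (\<lambda>_. s)"
  have a0: "a 0 = b" and aS: "a (Suc k) = s (a k)" for k by (simp_all add: a_def)
  have inc: "incseq a" using s(1) by (intro incseq_SucI) (simp add: aS less_imp_le)
  define \<alpha> where "\<alpha> = Sup (range a)"
  note lim = incseq_tendsto_Sup_long_line[OF inc, folded \<alpha>_def]
  have ab: "b \<le> a k" for k using incseqD[OF inc, of 0 k] a0 by simp
  have "(x, \<alpha>) \<in> M" using above_b ab lim(2) by (meson order_trans)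
  then obtain U \<phi> where U: "(U, \<phi>) \<in> F" "(x, \<alpha>) \<in> U" using foliated_atlas_cover[OF F] by blast
  obtain x1 x2 y1 y2 where box: "x1 < x" "x < x2" "y1 < \<alpha>" "\<alpha> < y2" "{x1<..<x2} \<times> {y1<..<y2} \<subseteq> U"
    using long_line_open_box[OF foliated_atlas_chart(1)[OF F U(1)] U(2)] .
  obtain l where l: "l \<in> D" "max x0 x1 < l" "l < x" using D(2)[of "max x0 x1" x] box x0 less_imp_le[OF x3] by auto
  obtain u where u: "u \<in> D" "x < u" "u < min x2 x3" using D(2)[of x "min x2 x3"] box x3 less_imp_le[OF x0] by auto
  have lu: "(l, u) \<in> P" unfolding P_def using l u by simp
  obtain k where k: "y1 < a k"
    using order_tendstoD(1)[OF lim(1) box(3)] by (auto simp: eventually_sequentially)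
  have "\<Delta> (l, u) (a k) \<le> \<alpha>"
    using s(2)[OF lu, of "a k"] lim(2)[of "Suc k"] unfolding aS by simp
  then have "{a k..\<Delta> (l, u) (a k)} \<subseteq> {y1<..<y2}"
    using k box(4) by (auto intro: less_le_trans order_le_less_trans)
  moreover have "{l..u} \<subseteq> {x1<..<x2}" using l u by (auto intro: less_le_trans order_le_less_trans)
  ultimately have "{l..u} \<times> {a k..\<Delta> (l, u) (a k)} \<subseteq> U" using box(5) by blast
  then show False using \<Delta>[OF lu ab[of k]] U(1) by auto
qed

definition horizontal_over :: "long_line set \<Rightarrow> bool"
  where "horizontal_over I \<longleftrightarrow>
    (\<exists>\<theta>. \<forall>a k0 \<alpha>. incseq a \<and> a \<longlonglongrightarrow> \<alpha> \<and> (\<forall>k\<ge>k0. \<theta> (a k) \<le> a (Suc k)) \<longrightarrow> tangent F (I \<times> {\<alpha>}))"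

text \<open>The clause that no vertical over the interval ever becomes tangent makes the
  alternatives exclusive at every single point; this is what connectedness of the long line is later
  applied to.\<close>

lemma local_dichotomy:
  obtains l u where "l < x" "x < u"
    "(\<exists>\<gamma>. \<forall>x\<in>{l..u}. tangent F ({x} \<times> {\<gamma>..})) \<or>
     horizontal_over {l..u} \<and> (\<forall>x\<in>{l..u}. \<forall>\<gamma>. \<not> tangent F ({x} \<times> {\<gamma>..}))"
proof -
  obtain l u \<beta> where lxu: "l < x" "x < u" and "b \<le> \<beta>"
    and ch: "\<And>\<delta>. \<beta> \<le> \<delta> \<Longrightarrow> \<exists>U \<phi>. (U, \<phi>) \<in> F \<and> {l..u} \<times> {\<beta>..\<delta>} \<subseteq> U"
    using long_chart_strip[of x] by metis
  obtain U \<phi> where ch: "\<And>\<delta>. \<beta> \<le> \<delta> \<Longrightarrow> (U \<delta>, \<phi> \<delta>) \<in> F" "\<And>\<delta>. \<beta> \<le> \<delta> \<Longrightarrow> {l..u} \<times> {\<beta>..\<delta>} \<subseteq> U \<delta>"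
    using ch by metis
  define f where "f \<delta> p = snd (\<phi> \<delta> p)" for \<delta> p
  have cont: "continuous_on ({l..u} \<times> {\<beta>..\<delta>}) (f \<delta>)" if "\<beta> \<le> \<delta>" for \<delta>
    unfolding f_def using foliated_atlas_chart(5)[OF F ch(1)[OF that]] ch(2)[OF that]
    by (intro continuous_on_snd) (auto intro: continuous_on_subset)
  have vert: "tangent F ({x} \<times> {\<gamma>..})"
    if g: "\<beta> \<le> \<gamma>" "x \<in> {l..u}" "\<And>y e. \<gamma> \<le> y \<Longrightarrow> y \<le> e \<Longrightarrow> f e (x, y) = f e (x, \<gamma>)" for x \<gamma>
  proof (rule tangentI[OF F])
    fix p assume "p \<in> {x} \<times> {\<gamma>..}"
    then obtain y where p: "p = (x, y)" "\<gamma> \<le> y" by auto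
    obtain e where e: "y < e" using gt_ex by blast
    have "\<beta> \<le> e" using g(1) p(2) e by simp
    moreover have "(x, y) \<in> {l..u} \<times> {\<beta>..e}"
      using order_trans[OF g(1) p(2)] g(2) less_imp_le[OF e] by simp
    moreover from this have "p \<in> U e" using ch(2)[OF \<open>\<beta> \<le> e\<close>] p(1) by blast
    moreover have "f e q = f e p" if "q \<in> (UNIV \<times> {..<e}) \<inter> {x} \<times> {\<gamma>..} \<inter> U e" for q
      using that g(3)[of y e] g(3)[of "snd q" e] p e by (cases q) auto
    moreover have "open ((UNIV :: long_line set) \<times> {..<e})" by (intro open_Times) auto
    moreover have "p \<in> UNIV \<times> {..<e}" using p(1) e by simp
    ultimately show "\<exists>U \<phi> N. (U, \<phi>) \<in> F \<and> p \<in> U \<and> open N \<and> p \<in> N \<and>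
        (\<forall>q\<in>N \<inter> {x} \<times> {\<gamma>..} \<inter> U. snd (\<phi> q) = snd (\<phi> p))"
      using ch(1)[OF \<open>\<beta> \<le> e\<close>] unfolding f_def by blast
  qed
  show ?thesis
  proof (cases "\<forall>\<delta>\<ge>\<beta>. \<forall>p\<in>{l..u} \<times> {\<beta>..\<delta>}. \<forall>q\<in>{l..u} \<times> {\<beta>..\<delta>}. f \<delta> p = f \<delta> q")
    case True
    have "tangent F ({x} \<times> {\<beta>..})" if "x \<in> {l..u}" for x
    proof (rule vert[OF order_refl that])
      fix y e assume "\<beta> \<le> y" "y \<le> e"
      then show "f e (x, y) = f e (x, \<beta>)"
        using True[rule_format, of e "(x, y)" "(x, \<beta>)"] that by simp
    qed
    then show ?thesis using that[OF lxu] by blast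
  next
    case False
    \<comment> \<open>A pair with different transverse coordinates fixes an orientation. Only
      heights \<delta> of at least \<delta>1 are used from here on, so that the rectangles from
      \<beta> up to \<delta> contain both points.\<close>
    then obtain \<delta>1 p0 q0 where \<delta>1: "\<beta> \<le> \<delta>1" and pq: "p0 \<in> {l..u} \<times> {\<beta>..\<delta>1}" "q0 \<in> {l..u} \<times> {\<beta>..\<delta>1}"
      "f \<delta>1 p0 \<noteq> f \<delta>1 q0" by blast
    \<comment> \<open>Transition maps are monotone but may reverse the order; \<open>\<sigma>\<close> orients all charts alike.\<close>
    define \<sigma> :: "long_line \<Rightarrow> real" where "\<sigma> \<delta> = (if f \<delta> p0 < f \<delta> q0 then 1 else - 1)" for \<delta>
    define g where "g \<delta> p = \<sigma> \<delta> * f \<delta> p" for \<delta> p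
    have g_eq: "g \<delta> p = g \<delta> q \<longleftrightarrow> f \<delta> p = f \<delta> q" for \<delta> p q
      unfolding g_def \<sigma>_def by simp
    \<comment> \<open>Injectivity and continuity give monotonicity only on an interval. The
      transverse coordinates of an overlap of charts need not form one, but those of the connected
      rectangle do.\<close>
    have mono: "\<exists>h. inj_on h (f \<delta> ` ({l..u} \<times> {\<beta>..\<delta>})) \<and> (strict_mono_on (f \<delta> ` ({l..u} \<times> {\<beta>..\<delta>})) h \<or> strict_antimono_on (f \<delta> ` ({l..u} \<times> {\<beta>..\<delta>})) h) \<and>
        (\<forall>q\<in>{l..u} \<times> {\<beta>..\<delta>}. f e q = h (f \<delta> q))" if de: "\<beta> \<le> \<delta>" "\<delta> \<le> e" for \<delta> e
    proof -
      have "\<beta> \<le> e" using de by simp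
      obtain h where h: "continuous_on (snd ` \<phi> \<delta> ` (U \<delta> \<inter> U e)) h" "inj_on h (snd ` \<phi> \<delta> ` (U \<delta> \<inter> U e))"
        "\<And>q. q \<in> U \<delta> \<Longrightarrow> q \<in> U e \<Longrightarrow> snd (\<phi> e q) = h (snd (\<phi> \<delta> q))"
        using foliated_atlas_change[OF F ch(1)[OF de(1)] ch(1)[OF \<open>\<beta> \<le> e\<close>]] by blast
      have sub: "{l..u} \<times> {\<beta>..\<delta>} \<subseteq> U \<delta> \<inter> U e"
        using ch(2)[OF de(1)] ch(2)[OF \<open>\<beta> \<le> e\<close>] de(2) by fastforce
      let ?J = "f \<delta> ` ({l..u} \<times> {\<beta>..\<delta>})"
      have J: "?J \<subseteq> snd ` \<phi> \<delta> ` (U \<delta> \<inter> U e)" using sub unfolding f_def by blast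
      have "is_interval ?J"
        unfolding is_interval_connected_1 using cont[OF de(1)]
        by (intro connected_continuous_image connected_Times) auto
      moreover have hJ: "continuous_on ?J h" "inj_on h ?J"
        using h(1,2) J by (auto intro: continuous_on_subset inj_on_subset)
      ultimately have "strict_mono_on ?J h \<or> strict_antimono_on ?J h"
        using injective_eq_monotone_map by blast
      then show ?thesis using h(3) hJ(2) sub unfolding f_def by blast
    qed
    have coh: "g e p \<le> g e q \<longleftrightarrow> g \<delta> p \<le> g \<delta> q"
      if de: "\<delta>1 \<le> \<delta>" "\<delta> \<le> e" and p: "p \<in> {l..u} \<times> {\<beta>..\<delta>}" and q: "q \<in> {l..u} \<times> {\<beta>..\<delta>}" for \<delta> e p q
    proof -
      have "\<beta> \<le> \<delta>" using \<delta>1 de by simp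
      obtain h where h: "strict_mono_on (f \<delta> ` ({l..u} \<times> {\<beta>..\<delta>})) h \<or> strict_antimono_on (f \<delta> ` ({l..u} \<times> {\<beta>..\<delta>})) h"
        and fh: "\<And>q. q \<in> {l..u} \<times> {\<beta>..\<delta>} \<Longrightarrow> f e q = h (f \<delta> q)"
        using mono[OF \<open>\<beta> \<le> \<delta>\<close> de(2)] by blast
      obtain h1 where fh1: "\<And>q. q \<in> {l..u} \<times> {\<beta>..\<delta>1} \<Longrightarrow> f \<delta> q = h1 (f \<delta>1 q)"
        and "inj_on h1 (f \<delta>1 ` ({l..u} \<times> {\<beta>..\<delta>1}))"
        using mono[OF \<delta>1 de(1)] by metis
      \<comment> \<open>The pair stays separated in every higher chart, so a decreasing change of
        coordinate really flips \<sigma>.\<close>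
      then have ne: "f \<delta> p0 \<noteq> f \<delta> q0" using pq by (auto simp: inj_on_def)
      have pq': "p0 \<in> {l..u} \<times> {\<beta>..\<delta>}" "q0 \<in> {l..u} \<times> {\<beta>..\<delta>}" using pq(1,2) de(1) by auto
      from h show ?thesis
      proof
        assume m: "strict_mono_on (f \<delta> ` ({l..u} \<times> {\<beta>..\<delta>})) h"
        have lt: "f e r < f e s \<longleftrightarrow> f \<delta> r < f \<delta> s" if "r \<in> {l..u} \<times> {\<beta>..\<delta>}" "s \<in> {l..u} \<times> {\<beta>..\<delta>}" for r s
          using strict_mono_on_less[OF m] fh that by simp
        then have "\<sigma> e = \<sigma> \<delta>" unfolding \<sigma>_def using pq' by simp
        then show ?thesis using lt[OF p q] lt[OF q p] unfolding g_def \<sigma>_def by auto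
      next
        assume m: "strict_antimono_on (f \<delta> ` ({l..u} \<times> {\<beta>..\<delta>})) h"
        have lt: "f e r < f e s \<longleftrightarrow> f \<delta> s < f \<delta> r" if "r \<in> {l..u} \<times> {\<beta>..\<delta>}" "s \<in> {l..u} \<times> {\<beta>..\<delta>}" for r s
          using m fh that unfolding monotone_on_def
          by (metis imageI not_less_iff_gr_or_eq)
        then have "\<sigma> e = - \<sigma> \<delta>" unfolding \<sigma>_def using pq' ne by auto
        then show ?thesis using lt[OF p q] lt[OF q p] unfolding g_def \<sigma>_def by auto
      qed
    qed
    interpret coherent_family l u \<delta>1 g
    proof
      show "l \<le> u" using lxu by simp
      show "continuous_on ({l..u} \<times> {\<delta>1..\<delta>}) (g \<delta>)" if "\<delta>1 \<le> \<delta>" for \<delta>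
      proof -
        have "\<beta> \<le> \<delta>" using \<delta>1 that by simp
        then show ?thesis unfolding g_def using \<delta>1
          by (intro continuous_on_mult continuous_on_const continuous_on_subset[OF cont]) auto
      qed
      fix \<delta> e p q
      assume *: "\<delta>1 \<le> \<delta>" "\<delta> \<le> e" "p \<in> {l..u} \<times> {\<delta>1..\<delta>}" "q \<in> {l..u} \<times> {\<delta>1..\<delta>}"
      have "{l..u} \<times> {\<delta>1..\<delta>} \<subseteq> {l..u} \<times> {\<beta>..\<delta>}" using \<delta>1 by auto
      then show "g e p \<le> g e q \<longleftrightarrow> g \<delta> p \<le> g \<delta> q" using coh[OF *(1,2)] *(3,4) by blast
    qed
    from vertical_or_horizontal show ?thesis
    proof
      assume "\<exists>\<gamma>\<ge>\<delta>1. \<forall>x\<in>{l..u}. \<forall>y\<ge>\<gamma>. \<forall>e\<ge>y. g e (x, y) = g e (x, \<gamma>)"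
      then obtain \<gamma> where \<gamma>: "\<delta>1 \<le> \<gamma>" "\<And>x y e. x \<in> {l..u} \<Longrightarrow> \<gamma> \<le> y \<Longrightarrow> y \<le> e \<Longrightarrow> f e (x, y) = f e (x, \<gamma>)"
        unfolding g_eq by blast
      have "\<beta> \<le> \<gamma>" using \<delta>1 \<gamma>(1) by simp
      then have "\<forall>x\<in>{l..u}. tangent F ({x} \<times> {\<gamma>..})" using vert \<gamma>(2) by blast
      then show ?thesis using that[OF lxu] by blast
    next
      assume hor: horizontal
      have \<beta>: "\<beta> \<le> \<alpha>" if "\<delta>1 \<le> \<alpha>" for \<alpha> using that \<delta>1 by simp
      have tan: "tangent F ({l..u} \<times> {\<alpha>})"
        if \<alpha>: "\<delta>1 \<le> \<alpha>" "\<forall>x\<in>{l..u}. \<forall>x'\<in>{l..u}. f \<alpha> (x, \<alpha>) = f \<alpha> (x', \<alpha>)" for \<alpha>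
      proof (rule tangentI[OF F])
        fix p assume p: "p \<in> {l..u} \<times> {\<alpha>}"
        then have "p \<in> U \<alpha>" using ch(2)[OF \<beta>[OF \<alpha>(1)]] \<beta>[OF \<alpha>(1)] by auto
        moreover have "snd (\<phi> \<alpha> q) = snd (\<phi> \<alpha> p)" if "q \<in> UNIV \<inter> {l..u} \<times> {\<alpha>} \<inter> U \<alpha>" for q
          using that p \<alpha>(2) unfolding f_def by blast
        ultimately show "\<exists>U \<phi> N. (U, \<phi>) \<in> F \<and> p \<in> U \<and> open N \<and> p \<in> N \<and>
            (\<forall>q\<in>N \<inter> {l..u} \<times> {\<alpha>} \<inter> U. snd (\<phi> q) = snd (\<phi> p))"
          using ch(1)[OF \<beta>[OF \<alpha>(1)]]
          by (intro exI[of _ "U \<alpha>"] exI[of _ "\<phi> \<alpha>"] exI[of _ UNIV]) simp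
      qed
      obtain \<theta> where \<theta>: "\<forall>a k0 \<alpha>. incseq a \<and> a \<longlonglongrightarrow> \<alpha> \<and> (\<forall>k\<ge>k0. \<theta> (a k) \<le> a (Suc k)) \<longrightarrow>
          \<delta>1 \<le> \<alpha> \<and> (\<forall>x\<in>{l..u}. \<forall>x'\<in>{l..u}. f \<alpha> (x, \<alpha>) = f \<alpha> (x', \<alpha>))"
        using hor unfolding horizontal_def g_eq by (elim exE conjE)
      have "horizontal_over {l..u}"
        unfolding horizontal_over_def
      proof (rule exI[of _ \<theta>], intro allI impI)
        fix a k0 \<alpha>
        assume "incseq a \<and> a \<longlonglongrightarrow> \<alpha> \<and> (\<forall>k\<ge>k0. \<theta> (a k) \<le> a (Suc k))"
        with \<theta> have "\<delta>1 \<le> \<alpha> \<and> (\<forall>x\<in>{l..u}. \<forall>x'\<in>{l..u}. f \<alpha> (x, \<alpha>) = f \<alpha> (x', \<alpha>))" by blast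
        then show "tangent F ({l..u} \<times> {\<alpha>})" using tan by blast
      qed
      moreover have "\<not> tangent F ({x} \<times> {\<gamma>..})" if x: "x \<in> {l..u}" for x \<gamma>
      proof
        assume t: "tangent F ({x} \<times> {\<gamma>..})"
        let ?\<gamma> = "max \<gamma> \<delta>1"
        obtain y where y: "?\<gamma> \<le> y" "f y (x, ?\<gamma>) \<noteq> f y (x, y)"
          using hor x max.cobounded2[of \<delta>1 \<gamma>] unfolding horizontal_def g_eq by blast
        have "\<delta>1 \<le> y" using y(1) by simp
        \<comment> \<open>The chart \<open>U y\<close> contains the whole segment, so a tangent
          vertical would have constant coordinate there.\<close>
        have "snd (\<phi> y (x, ?\<gamma>)) = snd (\<phi> y (x, y))"
        proof (rule tangent_connected_const[OF tangent_subset[OF t]])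
          show "{x} \<times> {?\<gamma>..y} \<subseteq> {x} \<times> {\<gamma>..}" by auto
          show "connected ({x} \<times> {?\<gamma>..y})" by (intro connected_Times) auto
          have "{x} \<times> {?\<gamma>..y} \<subseteq> {l..u} \<times> {\<beta>..y}" using x \<delta>1 by auto
          then show "{x} \<times> {?\<gamma>..y} \<subseteq> U y" using ch(2)[OF \<beta>[OF \<open>\<delta>1 \<le> y\<close>]] by blast
          show "(U y, \<phi> y) \<in> F" using ch(1)[OF \<beta>[OF \<open>\<delta>1 \<le> y\<close>]] .
        qed (use y(1) in auto)
        then show False using y(2) unfolding f_def by simp
      qed
      ultimately show ?thesis using that[OF lxu] by blast
    qed
  qed
qed

lemma Icc_interior_cover:
  fixes L R :: "long_line \<Rightarrow> long_line"
  assumes "\<And>x. L x < x" "\<And>x. x < R x"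
  obtains T where "finite T" "{- c..c} \<subseteq> (\<Union>x\<in>T. {L x<..<R x})"
proof -
  have cover: "{- c..c} \<subseteq> (\<Union>x\<in>{- c..c}. {L x<..<R x})" using assms by auto
  show ?thesis
    by (rule compactE_image[OF compact_long_line_Icc _ cover]) (simp_all add: that)
qed

section \<open>From local to global: the alternative for a whole end\<close>

definition vertical_end :: bool
  where "vertical_end \<longleftrightarrow> (\<forall>c. \<exists>\<gamma>. \<forall>x\<in>{- c..c}. tangent F ({x} \<times> {\<gamma>..}))"

text \<open>Whether the vertical over \<open>x\<close> eventually becomes tangent is locally
  constant in \<open>x\<close>, since the local alternatives are exclusive, hence constant.
  Compactness of [-c, c] then reduces uniformity to finitely many intervals.\<close>

lemma end_dichotomy: "vertical_end \<or> (\<forall>c. horizontal_over {- c..c})"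
proof -
  have "\<exists>l u. l < x \<and> x < u \<and> ((\<exists>\<gamma>. \<forall>x\<in>{l..u}. tangent F ({x} \<times> {\<gamma>..})) \<or>
     horizontal_over {l..u} \<and> (\<forall>x\<in>{l..u}. \<forall>\<gamma>. \<not> tangent F ({x} \<times> {\<gamma>..})))" for x
    by (rule local_dichotomy[of x]) blast
  then obtain L R where LR: "\<And>x. L x < x" "\<And>x. x < R x"
    "\<And>x. (\<exists>\<gamma>. \<forall>z\<in>{L x..R x}. tangent F ({z} \<times> {\<gamma>..})) \<or>
     horizontal_over {L x..R x} \<and> (\<forall>z\<in>{L x..R x}. \<forall>\<gamma>. \<not> tangent F ({z} \<times> {\<gamma>..}))" by metis
  define V where "V x \<longleftrightarrow> (\<exists>\<gamma>. tangent F ({x} \<times> {\<gamma>..}))" for x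
  have Vloc: "V z \<longleftrightarrow> V x" if "z \<in> {L x<..<R x}" for x z
  proof -
    have "z \<in> {L x..R x}" "x \<in> {L x..R x}" using that LR(1,2)[of x] by auto
    then show ?thesis using LR(3)[of x] unfolding V_def by blast
  qed
  have "V x = V y" for x y
  proof (rule connected_local_const[of UNIV x y V])
    show "\<forall>a\<in>UNIV. \<forall>\<^sub>F b in at a within UNIV. V a = V b"
    proof
      fix a
      have "open {L a<..<R a}" "a \<in> {L a<..<R a}" using LR(1,2) by auto
      then show "\<forall>\<^sub>F b in at a within UNIV. V a = V b"
        unfolding eventually_at_topological using Vloc[of _ a] by blast
    qed
  qed auto
  then consider "\<forall>x. V x" | "\<forall>x. \<not> V x" by blast
  then show ?thesis
  proof cases
    case 1
    have "\<exists>\<gamma>. \<forall>z\<in>{L x..R x}. tangent F ({z} \<times> {\<gamma>..})" for x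
      using LR(3)[of x] LR(1,2)[of x] 1 unfolding V_def by (meson atLeastAtMost_iff less_imp_le)
    then obtain \<gamma> where \<gamma>: "\<And>x z. z \<in> {L x..R x} \<Longrightarrow> tangent F ({z} \<times> {\<gamma> x..})" by metis
    have "\<exists>\<gamma>. \<forall>x\<in>{- c..c}. tangent F ({x} \<times> {\<gamma>..})" for c
    proof -
      obtain T where T: "finite T" "{- c..c} \<subseteq> (\<Union>x\<in>T. {L x<..<R x})" using Icc_interior_cover[OF LR(1,2)] .
      have "countable (\<gamma> ` T)" using T(1) by (simp add: countable_finite)
      then obtain \<gamma>' where \<gamma>': "\<And>x. x \<in> T \<Longrightarrow> \<gamma> x < \<gamma>'" using long_line_countable_bounded by (metis imageI)
      have "tangent F ({z} \<times> {\<gamma>'..})" if z: "z \<in> {- c..c}" for z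
      proof -
        obtain x where x: "x \<in> T" "z \<in> {L x..R x}" using T(2) z by fastforce
        have "{z} \<times> {\<gamma>'..} \<subseteq> {z} \<times> {\<gamma> x..}" using \<gamma>'[OF x(1)] by (auto intro: order_trans less_imp_le)
        then show ?thesis using tangent_subset[OF \<gamma>[OF x(2)]] by blast
      qed
      then show ?thesis by blast
    qed
    then show ?thesis unfolding vertical_end_def by blast
  next
    case 2
    have "horizontal_over {L x..R x}" for x
      using LR(3)[of x] LR(1,2)[of x] 2 unfolding V_def by (meson atLeastAtMost_iff less_imp_le)
    then obtain \<theta> where \<theta>: "\<And>x a k0 \<alpha>. incseq a \<Longrightarrow> a \<longlonglongrightarrow> \<alpha> \<Longrightarrow> (\<forall>k\<ge>k0. \<theta> x (a k) \<le> a (Suc k)) \<Longrightarrow>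
        tangent F ({L x..R x} \<times> {\<alpha>})" unfolding horizontal_over_def by metis
    have "horizontal_over {- c..c}" for c
    proof -
      obtain T where T: "finite T" "{- c..c} \<subseteq> (\<Union>x\<in>T. {L x<..<R x})" using Icc_interior_cover[OF LR(1,2)] .
      have "\<exists>t. \<forall>x\<in>T. \<theta> x y < t" for y
      proof -
        have "countable ((\<lambda>x. \<theta> x y) ` T)" using T(1) by (simp add: countable_finite)
        from long_line_countable_bounded[OF this] show ?thesis by blast
      qed
      \<comment> \<open>Outrunning \<theta>' implies outrunning each of the finitely many
        \<open>\<theta> x\<close>, so a sequence for \<theta>' serves all intervals at once.\<close>
      then obtain \<theta>' where \<theta>': "\<And>x y. x \<in> T \<Longrightarrow> \<theta> x y < \<theta>' y" by metis
      have "tangent F ({- c..c} \<times> {\<alpha>})"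
        if a: "incseq a" "a \<longlonglongrightarrow> \<alpha>" "\<forall>k\<ge>k0. \<theta>' (a k) \<le> a (Suc k)" for a k0 \<alpha>
        unfolding tangent_def
      proof (intro allI impI)
        fix p U \<phi> assume p: "p \<in> {- c..c} \<times> {\<alpha>}" "(U, \<phi>) \<in> F" "p \<in> U"
        then obtain x where x: "x \<in> T" "fst p \<in> {L x<..<R x}" using T(2) by fastforce
        have "\<forall>k\<ge>k0. \<theta> x (a k) \<le> a (Suc k)"
          using a(3) \<theta>'[OF x(1)] by (meson less_imp_le order_trans)
        then have t: "tangent F ({L x..R x} \<times> {\<alpha>})" by (rule \<theta>[OF a(1,2)])
        have px: "p \<in> {L x..R x} \<times> {\<alpha>}" using p(1) x(2) by auto
        obtain N where N: "open N" "p \<in> N"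
          "\<And>q. q \<in> N \<Longrightarrow> q \<in> {L x..R x} \<times> {\<alpha>} \<Longrightarrow> q \<in> U \<Longrightarrow> snd (\<phi> q) = snd (\<phi> p)"
          using tangentD[OF t px p(2,3)] by metis
        \<comment> \<open>Shrinking to the open interior keeps the nearby points of [-c, c] within
          the one interval over which tangency is known.\<close>
        have "open (N \<inter> {L x<..<R x} \<times> UNIV)" using N(1) by (intro open_Int open_Times) auto
        moreover have "p \<in> N \<inter> {L x<..<R x} \<times> UNIV" using N(2) x(2) by (cases p) auto
        moreover have "\<forall>q\<in>N \<inter> {L x<..<R x} \<times> UNIV \<inter> {- c..c} \<times> {\<alpha>} \<inter> U. snd (\<phi> q) = snd (\<phi> p)"
          using N(3) by (auto simp: less_imp_le)
        ultimately show "\<exists>N. open N \<and> p \<in> N \<and> (\<forall>q\<in>N \<inter> {- c..c} \<times> {\<alpha>} \<inter> U. snd (\<phi> q) = snd (\<phi> p))"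
          by blast
      qed
      then show ?thesis unfolding horizontal_over_def by blast
    qed
    then show ?thesis by blast
  qed
qed

section \<open>Closed unbounded sets of heights for the upward end\<close>

definition vertical_heights :: "long_line set"
  where "vertical_heights = {\<alpha>. b \<le> \<alpha> \<and> (\<forall>x. - \<alpha> < x \<and> x < \<alpha> \<longrightarrow> tangent F ({x} \<times> {\<alpha><..}))}"

text \<open>Here and in \<open>vertical_heights\<close> the same \<alpha> bounds width and height,
  as in the theorem. The conditions on the coordinates are strict because strict inequalities
  persist for nearby heights, which makes closedness accessible; the boundary is added afterwards by
  continuity.\<close>

definition horizontal_heights :: "long_line set"
  where "horizontal_heights = {\<alpha>. b \<le> \<alpha> \<and> tangent F ({- \<alpha><..<\<alpha>} \<times> {\<alpha>})}"

lemma abs_less_open_nhd: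
  fixes x \<alpha> :: long_line
  assumes "- \<alpha> < x" "x < \<alpha>"
  obtains w where "w < \<alpha>" "\<And>z. w < z \<Longrightarrow> - z < x \<and> x < z"
proof
  show "max x (- x) < \<alpha>" using assms by (simp add: long_line_minus_less_iff)
  show "- z < x \<and> x < z" if "max x (- x) < z" for z
    using that by (auto simp: long_line_minus_less_iff)
qed

text \<open>A point strictly above \<alpha> and strictly within its width is also so for heights
  \<open>z\<close> of the set close to \<alpha>; tangency from \<open>z\<close> on covers a
  neighbourhood of the point.\<close>

lemma closed_vertical_heights: "closed vertical_heights"
proof -
  have "\<alpha> \<in> vertical_heights" if \<alpha>: "\<alpha> \<in> closure vertical_heights" for \<alpha>
  proof -
    have "closure vertical_heights \<subseteq> {b..}" by (rule closure_minimal) (auto simp: vertical_heights_def)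
    then have "b \<le> \<alpha>" using \<alpha> by auto
    moreover have "tangent F ({x} \<times> {\<alpha><..})" if x: "- \<alpha> < x" "x < \<alpha>" for x
      unfolding tangent_def
    proof (intro allI impI)
      fix p U \<phi> assume p: "p \<in> {x} \<times> {\<alpha><..}" "(U, \<phi>) \<in> F" "p \<in> U"
      obtain w where w: "w < \<alpha>" "\<And>z. w < z \<Longrightarrow> - z < x \<and> x < z" using abs_less_open_nhd[OF x] by metis
      have "open {w<..<snd p}" "\<alpha> \<in> {w<..<snd p}" using w(1) p(1) by auto
      then have "{w<..<snd p} \<inter> vertical_heights \<noteq> {}"
        using \<alpha> open_Int_closure_eq_empty by blast
      then obtain z where z: "z \<in> vertical_heights" "w < z" "z < snd p" by auto
      have t: "tangent F ({x} \<times> {z<..})" using z(1) w(2)[OF z(2)] unfolding vertical_heights_def by blast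
      have pz: "p \<in> {x} \<times> {z<..}" using p(1) z(3) by auto
      obtain N where N: "open N" "p \<in> N"
        "\<And>q. q \<in> N \<Longrightarrow> q \<in> {x} \<times> {z<..} \<Longrightarrow> q \<in> U \<Longrightarrow> snd (\<phi> q) = snd (\<phi> p)"
        using tangentD[OF t pz p(2,3)] by metis
      have "open (N \<inter> UNIV \<times> {z<..})" using N(1) by (intro open_Int open_Times) auto
      moreover have "p \<in> N \<inter> UNIV \<times> {z<..}" using N(2) pz by auto
      moreover have "\<forall>q\<in>N \<inter> UNIV \<times> {z<..} \<inter> {x} \<times> {\<alpha><..} \<inter> U. snd (\<phi> q) = snd (\<phi> p)"
        using N(3) by auto
      ultimately show "\<exists>N. open N \<and> p \<in> N \<and> (\<forall>q\<in>N \<inter> {x} \<times> {\<alpha><..} \<inter> U. snd (\<phi> q) = snd (\<phi> p))"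
        by blast
    qed
    ultimately show ?thesis unfolding vertical_heights_def by blast
  qed
  then show ?thesis using closure_subset_eq by blast
qed

text \<open>In a box inside one chart, the difference of the transverse coordinates over two columns
  vanishes at heights of the set close to \<alpha>, hence at \<alpha>.\<close>

lemma closed_horizontal_heights: "closed horizontal_heights"
proof -
  have "\<alpha> \<in> horizontal_heights" if \<alpha>: "\<alpha> \<in> closure horizontal_heights" for \<alpha>
  proof -
    have "closure horizontal_heights \<subseteq> {b..}" by (rule closure_minimal) (auto simp: horizontal_heights_def)
    then have b\<alpha>: "b \<le> \<alpha>" using \<alpha> by auto
    have "tangent F ({- \<alpha><..<\<alpha>} \<times> {\<alpha>})"
    proof (rule tangentI[OF F])
      fix p assume "p \<in> {- \<alpha><..<\<alpha>} \<times> {\<alpha>}"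
      then obtain x where p: "p = (x, \<alpha>)" "- \<alpha> < x" "x < \<alpha>" by auto
      obtain U \<phi> where U: "(U, \<phi>) \<in> F" "(x, \<alpha>) \<in> U"
        using foliated_atlas_cover[OF F above_b[OF b\<alpha>]] .
      note c = foliated_atlas_chart[OF F U(1)]
      obtain x1 x2 y1 y2 where box: "x1 < x" "x < x2" "y1 < \<alpha>" "\<alpha> < y2" "{x1<..<x2} \<times> {y1<..<y2} \<subseteq> U"
        using long_line_open_box[OF c(1) U(2)] .
      have "snd (\<phi> (x', \<alpha>)) = snd (\<phi> (x, \<alpha>))" if x': "x1 < x'" "x' < x2" "- \<alpha> < x'" "x' < \<alpha>" for x'
      proof -
        obtain w where w: "w < \<alpha>" "\<And>z. w < z \<Longrightarrow> - z < x \<and> x < z" using abs_less_open_nhd[OF p(2,3)] by metis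
        obtain w' where w': "w' < \<alpha>" "\<And>z. w' < z \<Longrightarrow> - z < x' \<and> x' < z" using abs_less_open_nhd[OF x'(3,4)] by metis
        define W where "W = {max y1 (max w w')<..<y2}"
        let ?k = "\<lambda>z. snd (\<phi> (x', z)) - snd (\<phi> (x, z))"
        have sub: "(v, z) \<in> U" if "min x x' \<le> v" "v \<le> max x x'" "z \<in> W" for v z
        proof -
          have "x1 < v" using that(1) box(1) x'(1) by (auto simp: min_le_iff_disj)
          moreover have "v < x2" using that(2) box(2) x'(2) by (auto simp: le_max_iff_disj)
          ultimately show ?thesis using box(5) that(3) unfolding W_def by auto
        qed
        have kc: "continuous_on W (\<lambda>z. snd (\<phi> (v, z)))" if v: "min x x' \<le> v" "v \<le> max x x'" for v
          using sub[OF v]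
          by (intro continuous_on_snd continuous_on_compose2[OF c(5)] continuous_intros) auto
        have "?k \<alpha> = 0"
        proof (rule nonzero_meets_closure[OF _ _ _ \<alpha>])
          show "continuous_on W ?k" by (intro continuous_on_diff kc) (auto simp: le_max_iff_disj min_le_iff_disj)
          show "open W" "\<alpha> \<in> W" unfolding W_def using w w' box by auto
          fix z assume z: "z \<in> W" "z \<in> horizontal_heights"
          let ?A = "{min x x'..max x x'} \<times> {z}"
          have "- z < x" "x < z" "- z < x'" "x' < z" using z(1) w(2)[of z] w'(2)[of z] unfolding W_def by auto
          then have "?A \<subseteq> {- z<..<z} \<times> {z}"
            by (auto simp: min_le_iff_disj le_max_iff_disj)
          then have "tangent F ?A" using z(2) tangent_subset unfolding horizontal_heights_def by blast
          moreover have "connected ?A" by (intro connected_Times) auto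
          moreover have "?A \<subseteq> U" using sub z(1) by auto
          ultimately show "?k z = 0"
            using tangent_connected_const[of F ?A U \<phi> "(x', z)" "(x, z)"] U(1)
            by (simp add: le_max_iff_disj min_le_iff_disj)
        qed
        then show ?thesis by simp
      qed
      then have "\<forall>q\<in>{x1<..<x2} \<times> UNIV \<inter> {- \<alpha><..<\<alpha>} \<times> {\<alpha>} \<inter> U. snd (\<phi> q) = snd (\<phi> p)"
        using p(1) by auto
      moreover have "open ({x1<..<x2} \<times> (UNIV :: long_line set))" by (intro open_Times) auto
      moreover have "p \<in> {x1<..<x2} \<times> UNIV" using p(1) box by auto
      ultimately show "\<exists>U \<phi> N. (U, \<phi>) \<in> F \<and> p \<in> U \<and> open N \<and> p \<in> N \<and>
          (\<forall>q\<in>N \<inter> {- \<alpha><..<\<alpha>} \<times> {\<alpha>} \<inter> U. snd (\<phi> q) = snd (\<phi> p))"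
        using U p(1) by blast
    qed
    then show ?thesis using b\<alpha> unfolding horizontal_heights_def by blast
  qed
  then show ?thesis using closure_subset_eq by blast
qed

text \<open>A limit \<alpha> of steps that outrun \<Gamma> works: every \<open>x\<close> strictly
  between -\<alpha> and \<alpha> already lies in some [-a k, a k], and \<open>\<Gamma> (a k)\<close>
  is passed before \<alpha>.\<close>

lemma unbounded_vertical_heights:
  assumes vertical_end
  shows "\<exists>\<alpha>\<in>vertical_heights. z < \<alpha>"
proof -
  obtain \<Gamma> where \<Gamma>: "\<And>c x. x \<in> {- c..c} \<Longrightarrow> tangent F ({x} \<times> {\<Gamma> c..})"
    using assms unfolding vertical_end_def by metis
  have "\<exists>s. c < s \<and> \<Gamma> c < s" for c using gt_ex[of "max c (\<Gamma> c)"] by auto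
  then obtain s where s: "\<And>c. c < s c" "\<And>c. \<Gamma> c < s c" by metis
  define a where "a = rec_nat (max b z) (\<lambda>_. s)"
  have a0: "a 0 = max b z" and aS: "a (Suc k) = s (a k)" for k by (simp_all add: a_def)
  have inc: "incseq a" using s(1) by (intro incseq_SucI) (simp add: aS less_imp_le)
  define \<alpha> where "\<alpha> = Sup (range a)"
  note lim = incseq_tendsto_Sup_long_line[OF inc, folded \<alpha>_def]
  have lt: "a k < \<alpha>" "\<Gamma> (a k) < \<alpha>" for k
    using s[of "a k"] lim(2)[of "Suc k"] unfolding aS by (auto intro: less_le_trans)
  have "tangent F ({x} \<times> {\<alpha><..})" if x: "- \<alpha> < x" "x < \<alpha>" for x
  proof -
    obtain w where w: "w < \<alpha>" "\<And>z. w < z \<Longrightarrow> - z < x \<and> x < z" using abs_less_open_nhd[OF x] by metis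
    obtain k where "w < a k" using order_tendstoD(1)[OF lim(1) w(1)] by (auto simp: eventually_sequentially)
    then have "x \<in> {- a k..a k}" using w(2)[of "a k"] by auto
    moreover have "{x} \<times> {\<alpha><..} \<subseteq> {x} \<times> {\<Gamma> (a k)..}" using lt(2)[of k] by auto
    ultimately show ?thesis using \<Gamma> tangent_subset by blast
  qed
  moreover have "b \<le> \<alpha>" "z < \<alpha>" using lt(1)[of 0] a0 by auto
  ultimately show ?thesis unfolding vertical_heights_def by blast
qed

text \<open>A diagonal argument: the width at stage \<open>j\<close> is \<open>a j\<close> itself,
  whose threshold can be respected only from stage \<open>j\<close> on. The condition in
  \<open>horizontal_over\<close> is an eventual one, so tangency still holds over each [-a j, a j]
  at the common limit height.\<close>

lemma unbounded_horizontal_heights: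
  assumes "\<forall>c. horizontal_over {- c..c}"
  shows "\<exists>\<alpha>\<in>horizontal_heights. z < \<alpha>"
proof -
  obtain \<theta> where \<theta>: "\<And>c a k0 \<alpha>. incseq a \<Longrightarrow> a \<longlonglongrightarrow> \<alpha> \<Longrightarrow> (\<forall>k\<ge>k0. \<theta> c (a k) \<le> a (Suc k)) \<Longrightarrow>
      tangent F ({- c..c} \<times> {\<alpha>})" using assms unfolding horizontal_over_def by metis
  have "\<exists>s. hd L < s \<and> (\<forall>c\<in>set L. \<theta> c (hd L) < s)" for L
  proof -
    have "countable (insert (hd L) ((\<lambda>c. \<theta> c (hd L)) ` set L))" by (simp add: countable_finite)
    from long_line_countable_bounded[OF this] show ?thesis by auto
  qed
  then obtain s where s: "\<And>L. hd L < s L" "\<And>L c. c \<in> set L \<Longrightarrow> \<theta> c (hd L) < s L" by metis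
  \<comment> \<open>\<open>H\<close> records the history, so that every step respects the thresholds \<open>\<theta> c\<close> of all earlier \<open>c\<close>.\<close>
  define H where "H = rec_nat [max b z] (\<lambda>_ L. s L # L)"
  define a where "a k = hd (H k)" for k
  have H0: "H 0 = [max b z]" and HS: "H (Suc k) = s (H k) # H k" for k by (simp_all add: H_def)
  have aS: "a (Suc k) = s (H k)" for k by (simp add: a_def HS)
  have "a k < a (Suc k)" for k using s(1)[of "H k"] unfolding aS by (simp add: a_def)
  then have inc: "incseq a" by (intro incseq_SucI less_imp_le)
  have "H k \<noteq> []" for k by (cases k) (simp_all add: H0 HS)
  then have mem: "a j \<in> set (H (j + i))" for i j
    by (induction i) (simp_all add: a_def HS)
  define \<alpha> where "\<alpha> = Sup (range a)"
  note lim = incseq_tendsto_Sup_long_line[OF inc, folded \<alpha>_def]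
  have lt: "a k < \<alpha>" for k
    using s(1)[of "H k"] lim(2)[of "Suc k"] unfolding aS a_def[symmetric] by (auto intro: less_le_trans)
  have tj: "tangent F ({- a j..a j} \<times> {\<alpha>})" for j
  proof (rule \<theta>[OF inc lim(1), of j])
    show "\<forall>k\<ge>j. \<theta> (a j) (a k) \<le> a (Suc k)"
    proof (intro allI impI)
      fix k assume "j \<le> k"
      then have "a j \<in> set (H k)" using mem[of j "k - j"] by simp
      from s(2)[OF this] show "\<theta> (a j) (a k) \<le> a (Suc k)" unfolding aS by (simp add: a_def less_imp_le)
    qed
  qed
  have "tangent F ({- \<alpha><..<\<alpha>} \<times> {\<alpha>})"
    unfolding tangent_def
  proof (intro allI impI)
    fix p U \<phi> assume p: "p \<in> {- \<alpha><..<\<alpha>} \<times> {\<alpha>}" "(U, \<phi>) \<in> F" "p \<in> U"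
    then have "- \<alpha> < fst p" "fst p < \<alpha>" by auto
    then obtain w where w: "w < \<alpha>" "\<And>z. w < z \<Longrightarrow> - z < fst p \<and> fst p < z"
      using abs_less_open_nhd by metis
    obtain k where "w < a k" using order_tendstoD(1)[OF lim(1) w(1)] by (auto simp: eventually_sequentially)
    then have k: "- a k < fst p" "fst p < a k" using w(2) by auto
    have pk: "p \<in> {- a k..a k} \<times> {\<alpha>}" using p(1) k by auto
    obtain N where N: "open N" "p \<in> N"
      "\<And>q. q \<in> N \<Longrightarrow> q \<in> {- a k..a k} \<times> {\<alpha>} \<Longrightarrow> q \<in> U \<Longrightarrow> snd (\<phi> q) = snd (\<phi> p)"
      using tangentD[OF tj pk p(2,3)] by metis
    have "open (N \<inter> {- a k<..<a k} \<times> UNIV)" using N(1) by (intro open_Int open_Times) auto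
    moreover have "p \<in> N \<inter> {- a k<..<a k} \<times> UNIV" using N(2) k by (cases p) auto
    moreover have "\<forall>q\<in>N \<inter> {- a k<..<a k} \<times> UNIV \<inter> {- \<alpha><..<\<alpha>} \<times> {\<alpha>} \<inter> U. snd (\<phi> q) = snd (\<phi> p)"
      using N(3) by (auto simp: less_imp_le)
    ultimately show "\<exists>N. open N \<and> p \<in> N \<and> (\<forall>q\<in>N \<inter> {- \<alpha><..<\<alpha>} \<times> {\<alpha>} \<inter> U. snd (\<phi> q) = snd (\<phi> p))"
      by blast
  qed
  moreover have "b \<le> \<alpha>" "z < \<alpha>" using lt[of 0] by (auto simp: a_def H0)
  ultimately show ?thesis unfolding horizontal_heights_def by blast
qed

lemma closure_sym_interval:
  assumes "b \<le> \<alpha>"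
  shows "closure {- \<alpha><..<\<alpha>} = {- \<alpha>..\<alpha>}"
proof -
  have "0 < \<alpha>" using assms b_pos by simp
  then have "- \<alpha> < \<alpha>" by (meson less_trans long_line_minus_neg_iff)
  then show ?thesis by simp
qed

text \<open>Tangency extends to the sides and the bottom of the region by continuity. A corner is
  approached in both coordinates at once, so the difference of coordinates is studied as a function
  of the column and of two heights together.\<close>

lemma vertical_heights_tangent:
  assumes \<alpha>: "\<alpha> \<in> vertical_heights" and x: "x \<in> {- \<alpha>..\<alpha>}"
  shows "tangent F ({x} \<times> {\<alpha>..})"
proof (rule tangentI[OF F])
  fix p assume "p \<in> {x} \<times> {\<alpha>..}"
  then obtain y where p: "p = (x, y)" "\<alpha> \<le> y" by auto
  have b\<alpha>: "b \<le> \<alpha>" using \<alpha> unfolding vertical_heights_def by blast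
  then have "(x, y) \<in> M" using above_b p(2) by (meson order_trans)
  then obtain U \<phi> where U: "(U, \<phi>) \<in> F" "(x, y) \<in> U" using foliated_atlas_cover[OF F] by blast
  note c = foliated_atlas_chart[OF F U(1)]
  obtain x1 x2 y1 y2 where box: "x1 < x" "x < x2" "y1 < y" "y < y2" "{x1<..<x2} \<times> {y1<..<y2} \<subseteq> U"
    using long_line_open_box[OF c(1) U(2)] .
  have "snd (\<phi> (x, y')) = snd (\<phi> (x, y))" if y': "y1 < y'" "y' < y2" "\<alpha> \<le> y'" for y'
  proof -
    define W where "W = {x1<..<x2} \<times> {y1<..<y2} \<times> {y1<..<y2}"
    define k where "k = (\<lambda>(v, w, w'). snd (\<phi> (v, w)) - snd (\<phi> (v, w')))"
    have cl: "closure {\<alpha><..} = {\<alpha>..}" by simp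
    have "k (x, y', y) = 0"
    proof (rule nonzero_meets_closure[of W k _ "{- \<alpha><..<\<alpha>} \<times> {\<alpha><..} \<times> {\<alpha><..}"])
      show "open W" unfolding W_def by (intro open_Times) auto
      show "(x, y', y) \<in> W" unfolding W_def using box y' by auto
      show "(x, y', y) \<in> closure ({- \<alpha><..<\<alpha>} \<times> {\<alpha><..} \<times> {\<alpha><..})"
        unfolding closure_Times cl closure_sym_interval[OF b\<alpha>] using x y' p by auto
      show "continuous_on W k"
        unfolding k_def case_prod_unfold
        by (intro continuous_on_diff continuous_on_snd continuous_on_compose2[OF c(5)] continuous_on_Pair
            continuous_on_fst continuous_on_id) (use box(5) in \<open>auto simp: W_def\<close>)
      fix z assume z: "z \<in> W" "z \<in> {- \<alpha><..<\<alpha>} \<times> {\<alpha><..} \<times> {\<alpha><..}"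
      obtain v w w' where zv: "z = (v, w, w')" by (cases z)
      let ?A = "{v} \<times> {min w w'..max w w'}"
      have "?A \<subseteq> {v} \<times> {\<alpha><..}" using z(2) unfolding zv by (auto simp: min_le_iff_disj)
      moreover have "tangent F ({v} \<times> {\<alpha><..})" using \<alpha> z(2) unfolding zv vertical_heights_def by auto
      ultimately have "tangent F ?A" using tangent_subset by blast
      moreover have "connected ?A" by (intro connected_Times) auto
      moreover have "?A \<subseteq> {x1<..<x2} \<times> {y1<..<y2}"
        using z(1) unfolding zv W_def
        by (auto simp: min_le_iff_disj le_max_iff_disj intro: less_le_trans order_le_less_trans)
      moreover from this have "?A \<subseteq> U" using box(5) by blast
      ultimately show "k z = 0"
        using tangent_connected_const[of F ?A U \<phi> "(v, w)" "(v, w')"] U(1) unfolding zv k_def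
        by (simp add: le_max_iff_disj min_le_iff_disj)
    qed
    then show ?thesis unfolding k_def by simp
  qed
  then have "\<forall>q\<in>UNIV \<times> {y1<..<y2} \<inter> {x} \<times> {\<alpha>..} \<inter> U. snd (\<phi> q) = snd (\<phi> p)"
    using p(1) by auto
  moreover have "open ((UNIV :: long_line set) \<times> {y1<..<y2})" by (intro open_Times) auto
  moreover have "p \<in> UNIV \<times> {y1<..<y2}" using p(1) box by auto
  ultimately show "\<exists>U \<phi> N. (U, \<phi>) \<in> F \<and> p \<in> U \<and> open N \<and> p \<in> N \<and>
      (\<forall>q\<in>N \<inter> {x} \<times> {\<alpha>..} \<inter> U. snd (\<phi> q) = snd (\<phi> p))"
    using U p(1) by blast
qed

lemma horizontal_heights_tangent:
  assumes \<alpha>: "\<alpha> \<in> horizontal_heights"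
  shows "tangent F ({- \<alpha>..\<alpha>} \<times> {\<alpha>})"
proof (rule tangentI[OF F])
  fix p assume "p \<in> {- \<alpha>..\<alpha>} \<times> {\<alpha>}"
  then obtain x where p: "p = (x, \<alpha>)" "x \<in> {- \<alpha>..\<alpha>}" by auto
  have b\<alpha>: "b \<le> \<alpha>" using \<alpha> unfolding horizontal_heights_def by blast
  obtain U \<phi> where U: "(U, \<phi>) \<in> F" "(x, \<alpha>) \<in> U" using foliated_atlas_cover[OF F above_b[OF b\<alpha>]] .
  note c = foliated_atlas_chart[OF F U(1)]
  obtain x1 x2 y1 y2 where box: "x1 < x" "x < x2" "y1 < \<alpha>" "\<alpha> < y2" "{x1<..<x2} \<times> {y1<..<y2} \<subseteq> U"
    using long_line_open_box[OF c(1) U(2)] .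
  have "snd (\<phi> (x', \<alpha>)) = snd (\<phi> (x, \<alpha>))" if x': "x1 < x'" "x' < x2" "x' \<in> {- \<alpha>..\<alpha>}" for x'
  proof -
    define W where "W = {x1<..<x2} \<times> {x1<..<x2}"
    define k where "k = (\<lambda>(v, v'). snd (\<phi> (v, \<alpha>)) - snd (\<phi> (v', \<alpha>)))"
    have "k (x', x) = 0"
    proof (rule nonzero_meets_closure[of W k _ "{- \<alpha><..<\<alpha>} \<times> {- \<alpha><..<\<alpha>}"])
      show "open W" unfolding W_def by (intro open_Times) auto
      show "(x', x) \<in> W" unfolding W_def using box x' by auto
      show "(x', x) \<in> closure ({- \<alpha><..<\<alpha>} \<times> {- \<alpha><..<\<alpha>})"
        unfolding closure_Times closure_sym_interval[OF b\<alpha>] using x' p by auto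
      show "continuous_on W k"
        unfolding k_def case_prod_unfold
        by (intro continuous_on_diff continuous_on_snd continuous_on_compose2[OF c(5)] continuous_on_Pair
            continuous_on_fst continuous_on_id continuous_on_const) (use box in \<open>auto simp: W_def\<close>)
      fix z assume z: "z \<in> W" "z \<in> {- \<alpha><..<\<alpha>} \<times> {- \<alpha><..<\<alpha>}"
      obtain v v' where zv: "z = (v, v')" by (cases z)
      let ?A = "{min v v'..max v v'} \<times> {\<alpha>}"
      have "?A \<subseteq> {- \<alpha><..<\<alpha>} \<times> {\<alpha>}"
        using z(2) unfolding zv by (auto simp: min_le_iff_disj le_max_iff_disj)
      then have "tangent F ?A" using \<alpha> tangent_subset unfolding horizontal_heights_def by blast
      moreover have "connected ?A" by (intro connected_Times) auto
      moreover have "?A \<subseteq> {x1<..<x2} \<times> {y1<..<y2}"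
        using z(1) box(3,4) unfolding zv W_def
        by (auto simp: min_le_iff_disj le_max_iff_disj intro: less_le_trans order_le_less_trans)
      moreover from this have "?A \<subseteq> U" using box(5) by blast
      ultimately show "k z = 0"
        using tangent_connected_const[of F ?A U \<phi> "(v, \<alpha>)" "(v', \<alpha>)"] U(1) unfolding zv k_def
        by (simp add: le_max_iff_disj min_le_iff_disj)
    qed
    then show ?thesis unfolding k_def by simp
  qed
  then have "\<forall>q\<in>{x1<..<x2} \<times> UNIV \<inter> {- \<alpha>..\<alpha>} \<times> {\<alpha>} \<inter> U. snd (\<phi> q) = snd (\<phi> p)"
    using p(1) by auto
  moreover have "open ({x1<..<x2} \<times> (UNIV :: long_line set))" by (intro open_Times) auto
  moreover have "p \<in> {x1<..<x2} \<times> UNIV" using p(1) box by auto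
  ultimately show "\<exists>U \<phi> N. (U, \<phi>) \<in> F \<and> p \<in> U \<and> open N \<and> p \<in> N \<and>
      (\<forall>q\<in>N \<inter> {- \<alpha>..\<alpha>} \<times> {\<alpha>} \<inter> U. snd (\<phi> q) = snd (\<phi> p))"
    using U p(1) by blast
qed

lemma upward_end:
  obtains C where "closed C" "C \<subseteq> {b..}" "\<And>z. \<exists>\<alpha>\<in>C. z < \<alpha>"
    "(\<forall>\<alpha>\<in>C. tangent F ({- \<alpha>..\<alpha>} \<times> {\<alpha>})) \<or> (\<forall>\<alpha>\<in>C. \<forall>x\<in>{- \<alpha>..\<alpha>}. tangent F ({x} \<times> {\<alpha>..}))"
proof (cases vertical_end)
  case True
  show ?thesis
  proof (rule that[OF closed_vertical_heights])
    show "vertical_heights \<subseteq> {b..}" unfolding vertical_heights_def by auto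
  qed (use unbounded_vertical_heights[OF True] vertical_heights_tangent in blast)+
next
  case False
  then have h: "\<forall>c. horizontal_over {- c..c}" using end_dichotomy by blast
  show ?thesis
  proof (rule that[OF closed_horizontal_heights])
    show "horizontal_heights \<subseteq> {b..}" unfolding horizontal_heights_def by auto
  qed (use unbounded_horizontal_heights[OF h] horizontal_heights_tangent in blast)+
qed

end

section \<open>Leaves composed of axis-parallel segments\<close>

definition arm_right :: "(long_line \<times> long_line) set \<Rightarrow> long_line \<Rightarrow> long_line \<Rightarrow> bool"
  where "arm_right S x y \<longleftrightarrow> (\<exists>x'>x. {x..x'} \<times> {y} \<subseteq> S)"

definition arm_left :: "(long_line \<times> long_line) set \<Rightarrow> long_line \<Rightarrow> long_line \<Rightarrow> bool"
  where "arm_left S x y \<longleftrightarrow> (\<exists>x'<x. {x'..x} \<times> {y} \<subseteq> S)"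

definition arm_up :: "(long_line \<times> long_line) set \<Rightarrow> long_line \<Rightarrow> long_line \<Rightarrow> bool"
  where "arm_up S x y \<longleftrightarrow> (\<exists>y'>y. {x} \<times> {y..y'} \<subseteq> S)"

definition arm_down :: "(long_line \<times> long_line) set \<Rightarrow> long_line \<Rightarrow> long_line \<Rightarrow> bool"
  where "arm_down S x y \<longleftrightarrow> (\<exists>y'<y. {x} \<times> {y'..y} \<subseteq> S)"

text \<open>A set made of axis-parallel segments has no end point where it continues in two of the
  four directions: opposite ones on a side, one horizontal and one vertical at a corner.\<close>

definition two_arms :: "(long_line \<times> long_line) set \<Rightarrow> long_line \<Rightarrow> long_line \<Rightarrow> bool"
  where "two_arms S x y \<longleftrightarrow> arm_right S x y \<and> arm_left S x y \<or> arm_up S x y \<and> arm_down S x y \<or>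
    (arm_right S x y \<or> arm_left S x y) \<and> (arm_up S x y \<or> arm_down S x y)"

lemma arm_shrink:
  assumes "open N" "(x, y) \<in> N"
  shows "arm_right S x y \<Longrightarrow> \<exists>x'>x. {x..x'} \<times> {y} \<subseteq> S \<inter> N"
    and "arm_left S x y \<Longrightarrow> \<exists>x'<x. {x'..x} \<times> {y} \<subseteq> S \<inter> N"
    and "arm_up S x y \<Longrightarrow> \<exists>y'>y. {x} \<times> {y..y'} \<subseteq> S \<inter> N"
    and "arm_down S x y \<Longrightarrow> \<exists>y'<y. {x} \<times> {y'..y} \<subseteq> S \<inter> N"
proof -
  obtain x1 x2 y1 y2 where n: "x1 < x" "x < x2" "y1 < y" "y < y2" "{x1<..<x2} \<times> {y1<..<y2} \<subseteq> N"
    using long_line_open_box[OF assms] by metis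
  have above: "\<exists>z>w. {w..z} \<subseteq> {w..w'} \<inter> {w1<..<w2}" if w: "w1 < w" "w < w2" "w < w'" for w w' w1 w2 :: long_line
  proof -
    obtain z where "w < z" "z < min w' w2" using dense[of w "min w' w2"] w by auto
    then show ?thesis using w(1) by (intro exI[of _ z]) auto
  qed
  have below: "\<exists>z<w. {z..w} \<subseteq> {w'..w} \<inter> {w1<..<w2}" if w: "w1 < w" "w < w2" "w' < w" for w w' w1 w2 :: long_line
  proof -
    obtain z where "max w' w1 < z" "z < w" using dense[of "max w' w1" w] w by auto
    then show ?thesis using w(2) by (intro exI[of _ z]) auto
  qed
  have hN: "I \<times> {y} \<subseteq> N" if "I \<subseteq> {x1<..<x2}" for I using n that by fastforce
  have vN: "{x} \<times> I \<subseteq> N" if "I \<subseteq> {y1<..<y2}" for I using n that by fastforce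
  show "\<exists>x'>x. {x..x'} \<times> {y} \<subseteq> S \<inter> N" if "arm_right S x y"
  proof -
    obtain x' where x': "x < x'" "{x..x'} \<times> {y} \<subseteq> S" using \<open>arm_right S x y\<close> unfolding arm_right_def by blast
    obtain z where "x < z" "{x..z} \<subseteq> {x..x'} \<inter> {x1<..<x2}" using above[OF n(1,2) x'(1)] by blast
    then show ?thesis using x'(2) hN[of "{x..z}"] by blast
  qed
  show "\<exists>x'<x. {x'..x} \<times> {y} \<subseteq> S \<inter> N" if "arm_left S x y"
  proof -
    obtain x' where x': "x' < x" "{x'..x} \<times> {y} \<subseteq> S" using \<open>arm_left S x y\<close> unfolding arm_left_def by blast
    obtain z where "z < x" "{z..x} \<subseteq> {x'..x} \<inter> {x1<..<x2}" using below[OF n(1,2) x'(1)] by blast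
    then show ?thesis using x'(2) hN[of "{z..x}"] by blast
  qed
  show "\<exists>y'>y. {x} \<times> {y..y'} \<subseteq> S \<inter> N" if "arm_up S x y"
  proof -
    obtain y' where y': "y < y'" "{x} \<times> {y..y'} \<subseteq> S" using \<open>arm_up S x y\<close> unfolding arm_up_def by blast
    obtain z where "y < z" "{y..z} \<subseteq> {y..y'} \<inter> {y1<..<y2}" using above[OF n(3,4) y'(1)] by blast
    then show ?thesis using y'(2) vN[of "{y..z}"] by blast
  qed
  show "\<exists>y'<y. {x} \<times> {y'..y} \<subseteq> S \<inter> N" if "arm_down S x y"
  proof -
    obtain y' where y': "y' < y" "{x} \<times> {y'..y} \<subseteq> S" using \<open>arm_down S x y\<close> unfolding arm_down_def by blast
    obtain z where "z < y" "{z..y} \<subseteq> {y'..y} \<inter> {y1<..<y2}" using below[OF n(3,4) y'(1)] by blast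
    then show ?thesis using y'(2) vN[of "{z..y}"] by blast
  qed
qed

lemma two_arms_arcs:
  assumes "two_arms S x y" "open N" "(x, y) \<in> N"
  shows "\<exists>A B. connected A \<and> connected B \<and> A \<subseteq> S \<inter> N \<and> B \<subseteq> S \<inter> N \<and>
    A \<inter> B = {(x, y)} \<and> A \<noteq> {(x, y)} \<and> B \<noteq> {(x, y)}"
proof -
  have h: "\<exists>x1 x2. connected ({x1..x2} \<times> {y}) \<and> {x1..x2} \<times> {y} \<subseteq> S \<inter> N \<and>
      {x1..x2} \<times> {y} \<noteq> {(x, y)} \<and> x \<in> {x1..x2}" if arm: "arm_right S x y \<or> arm_left S x y"
  proof -
    obtain x1 x2 where "{x1..x2} \<times> {y} \<subseteq> S \<inter> N" "x1 < x2" "x \<in> {x1..x2}"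
      using arm arm_shrink(1)[OF assms(2,3), of S] arm_shrink(2)[OF assms(2,3), of S]
      by (metis atLeastAtMost_iff less_imp_le order_refl)
    moreover from this have "(x1, y) \<in> {x1..x2} \<times> {y}" "(x2, y) \<in> {x1..x2} \<times> {y}" by auto
    with \<open>x1 < x2\<close> have "{x1..x2} \<times> {y} \<noteq> {(x, y)}" by (metis Pair_inject less_irrefl singletonD)
    moreover have "connected ({x1..x2} \<times> {y})" by (intro connected_Times) auto
    ultimately show ?thesis by blast
  qed
  have v: "\<exists>y1 y2. connected ({x} \<times> {y1..y2}) \<and> {x} \<times> {y1..y2} \<subseteq> S \<inter> N \<and>
      {x} \<times> {y1..y2} \<noteq> {(x, y)} \<and> y \<in> {y1..y2}" if arm: "arm_up S x y \<or> arm_down S x y"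
  proof -
    obtain y1 y2 where "{x} \<times> {y1..y2} \<subseteq> S \<inter> N" "y1 < y2" "y \<in> {y1..y2}"
      using arm arm_shrink(3)[OF assms(2,3), of S] arm_shrink(4)[OF assms(2,3), of S]
      by (metis atLeastAtMost_iff less_imp_le order_refl)
    moreover from this have "(x, y1) \<in> {x} \<times> {y1..y2}" "(x, y2) \<in> {x} \<times> {y1..y2}" by auto
    with \<open>y1 < y2\<close> have "{x} \<times> {y1..y2} \<noteq> {(x, y)}" by (metis Pair_inject less_irrefl singletonD)
    moreover have "connected ({x} \<times> {y1..y2})" by (intro connected_Times) auto
    ultimately show ?thesis by blast
  qed
  consider "arm_right S x y" "arm_left S x y" | "arm_up S x y" "arm_down S x y"
    | "arm_right S x y \<or> arm_left S x y" "arm_up S x y \<or> arm_down S x y"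
    using assms(1) unfolding two_arms_def by blast
  then show ?thesis
  proof cases
    case 1
    obtain x1 where x1: "x < x1" "{x..x1} \<times> {y} \<subseteq> S \<inter> N" using arm_shrink(1)[OF assms(2,3) 1(1)] by blast
    obtain x2 where x2: "x2 < x" "{x2..x} \<times> {y} \<subseteq> S \<inter> N" using arm_shrink(2)[OF assms(2,3) 1(2)] by blast
    have "(x1, y) \<in> {x..x1} \<times> {y}" "(x2, y) \<in> {x2..x} \<times> {y}" using x1(1) x2(1) by auto
    moreover have "connected ({x..x1} \<times> {y})" "connected ({x2..x} \<times> {y})" by (auto intro: connected_Times)
    moreover have "{x..x1} \<times> {y} \<inter> {x2..x} \<times> {y} = {(x, y)}" using x1(1) x2(1) by auto
    moreover have "(x1, y) \<noteq> (x, y)" "(x2, y) \<noteq> (x, y)" using x1(1) x2(1) by auto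
    ultimately show ?thesis using x1(2) x2(2)
      by (intro exI[of _ "{x..x1} \<times> {y}"] exI[of _ "{x2..x} \<times> {y}"] conjI) (assumption | metis singletonD)+
  next
    case 2
    obtain y1 where y1: "y < y1" "{x} \<times> {y..y1} \<subseteq> S \<inter> N" using arm_shrink(3)[OF assms(2,3) 2(1)] by blast
    obtain y2 where y2: "y2 < y" "{x} \<times> {y2..y} \<subseteq> S \<inter> N" using arm_shrink(4)[OF assms(2,3) 2(2)] by blast
    have "(x, y1) \<in> {x} \<times> {y..y1}" "(x, y2) \<in> {x} \<times> {y2..y}" using y1(1) y2(1) by auto
    moreover have "connected ({x} \<times> {y..y1})" "connected ({x} \<times> {y2..y})" by (auto intro: connected_Times)
    moreover have "{x} \<times> {y..y1} \<inter> {x} \<times> {y2..y} = {(x, y)}" using y1(1) y2(1) by auto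
    moreover have "(x, y1) \<noteq> (x, y)" "(x, y2) \<noteq> (x, y)" using y1(1) y2(1) by auto
    ultimately show ?thesis using y1(2) y2(2)
      by (intro exI[of _ "{x} \<times> {y..y1}"] exI[of _ "{x} \<times> {y2..y}"] conjI) (assumption | metis singletonD)+
  next
    case 3
    obtain x1 x2 where x: "connected ({x1..x2} \<times> {y})" "{x1..x2} \<times> {y} \<subseteq> S \<inter> N"
      "{x1..x2} \<times> {y} \<noteq> {(x, y)}" "x \<in> {x1..x2}" using h[OF 3(1)] by blast
    obtain y1 y2 where y: "connected ({x} \<times> {y1..y2})" "{x} \<times> {y1..y2} \<subseteq> S \<inter> N"
      "{x} \<times> {y1..y2} \<noteq> {(x, y)}" "y \<in> {y1..y2}" using v[OF 3(2)] by blast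
    have "{x1..x2} \<times> {y} \<inter> {x} \<times> {y1..y2} = {(x, y)}" using x(4) y(4) by auto
    then show ?thesis using x(1-3) y(1-3) by blast
  qed
qed

lemma connected_Un_point: "connected A \<Longrightarrow> connected B \<Longrightarrow> p \<in> A \<Longrightarrow> p \<in> B \<Longrightarrow> connected (A \<union> B)"
  by (rule connected_Un) auto

text \<open>All sides and half-lines of the six patterns stay outside the central box;
  \<open>outer\<close> is how they are known to lie in \<open>M\<close>.\<close>

locale outer_foliation =
  fixes M :: "(long_line \<times> long_line) set" and F :: "(long_line \<times> long_line, real, real) atlas"
    and b :: long_line
  assumes F: "foliated_atlas M F" and b_pos: "0 < b"
    and outer: "b \<le> x \<or> x \<le> - b \<or> b \<le> y \<or> y \<le> - b \<Longrightarrow> (x, y) \<in> M"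
begin

lemma leaf_axisI:
  assumes "tangent F S" "connected S" "closed S" "S \<subseteq> M" "S \<noteq> {}"
    and arms: "\<And>x y. (x, y) \<in> S \<Longrightarrow> two_arms S x y"
  shows "S \<in> leaves F"
proof (rule tangent_leafI[OF F assms(1,2,5,4,3)])
  fix p N assume "p \<in> S" "open N" "p \<in> N"
  then show "\<exists>A B. connected A \<and> connected B \<and> A \<subseteq> S \<inter> N \<and> B \<subseteq> S \<inter> N \<and> A \<inter> B = {p} \<and> A \<noteq> {p} \<and> B \<noteq> {p}"
    using two_arms_arcs[OF arms, of "fst p" "snd p" N] by simp
qed

lemma line_leaf:
  assumes "tangent F (UNIV \<times> {c})" "b \<le> c \<or> c \<le> - b"
  shows "UNIV \<times> {c} \<in> leaves F"
proof (rule leaf_axisI[OF assms(1)])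
  fix x y assume "(x, y) \<in> (UNIV :: long_line set) \<times> {c}"
  moreover obtain x1 x2 where "x1 < x" "x < x2" using lt_ex gt_ex by metis
  ultimately show "two_arms (UNIV \<times> {c}) x y"
    unfolding two_arms_def arm_right_def arm_left_def by auto
qed (use outer assms(2) in \<open>auto intro: connected_Times closed_Times\<close>)

text \<open>Leaving the directions of the half-lines \<open>I\<close> and \<open>J\<close> open
  covers the corners in all four quadrants as well as the bent line whose arms run through
  [-\<alpha>, \<alpha>].\<close>

lemma corner_leaf:
  assumes I: "I = {..d} \<or> I = {d..}" and J: "J = {..c} \<or> J = {c..}"
    and t: "tangent F (I \<times> {c})" "tangent F ({d} \<times> J)"
    and cd: "b \<le> c \<or> c \<le> - b" "b \<le> d \<or> d \<le> - b"
  shows "I \<times> {c} \<union> {d} \<times> J \<in> leaves F"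
proof (rule leaf_axisI)
  have cl: "closed I" "closed J" using I J by auto
  then show "tangent F (I \<times> {c} \<union> {d} \<times> J)" using t by (intro tangent_Un closed_Times) auto
  show "closed (I \<times> {c} \<union> {d} \<times> J)" using cl by (intro closed_Un closed_Times) auto
  have conn: "connected I" "connected J" using I J by auto
  have mem: "d \<in> I" "c \<in> J" using I J by auto
  show "connected (I \<times> {c} \<union> {d} \<times> J)"
    using conn mem by (intro connected_Un connected_Times) auto
  show "I \<times> {c} \<union> {d} \<times> J \<subseteq> M" using outer cd by auto
  show "I \<times> {c} \<union> {d} \<times> J \<noteq> {}" using mem by auto
  let ?S = "I \<times> {c} \<union> {d} \<times> J"
  \<comment> \<open>An end point has one arm along its own segment; only at the corner does the
    other segment have to supply the second one.\<close>
  have h: "(x = d \<longrightarrow> arm_right ?S x c \<or> arm_left ?S x c) \<and> (x \<noteq> d \<longrightarrow> arm_right ?S x c \<and> arm_left ?S x c)"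
    if x: "x \<in> I" for x
  proof -
    obtain x1 x2 where x12: "x1 < x" "x < x2" using lt_ex gt_ex by metis
    from I show ?thesis
    proof
      assume I: "I = {..d}"
      have "{x1..x} \<times> {c} \<subseteq> ?S" using x I by auto
      then have arm: "arm_left ?S x c" unfolding arm_left_def using x12(1) by blast
      have "{x..d} \<times> {c} \<subseteq> ?S" using I by auto
      moreover have "x < d" if "x \<noteq> d" using x I that by simp
      ultimately have "x \<noteq> d \<longrightarrow> arm_right ?S x c" unfolding arm_right_def by blast
      then show ?thesis using arm by blast
    next
      assume I: "I = {d..}"
      have "{x..x2} \<times> {c} \<subseteq> ?S" using x I by auto
      then have arm: "arm_right ?S x c" unfolding arm_right_def using x12(2) by blast
      have "{d..x} \<times> {c} \<subseteq> ?S" using I by auto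
      moreover have "d < x" if "x \<noteq> d" using x I that by simp
      ultimately have "x \<noteq> d \<longrightarrow> arm_left ?S x c" unfolding arm_left_def by blast
      then show ?thesis using arm by blast
    qed
  qed
  have v: "(y = c \<longrightarrow> arm_up ?S d y \<or> arm_down ?S d y) \<and> (y \<noteq> c \<longrightarrow> arm_up ?S d y \<and> arm_down ?S d y)"
    if y: "y \<in> J" for y
  proof -
    obtain y1 y2 where y12: "y1 < y" "y < y2" using lt_ex gt_ex by metis
    from J show ?thesis
    proof
      assume J: "J = {..c}"
      have "{d} \<times> {y1..y} \<subseteq> ?S" using y J by auto
      then have arm: "arm_down ?S d y" unfolding arm_down_def using y12(1) by blast
      have "{d} \<times> {y..c} \<subseteq> ?S" using J by auto
      moreover have "y < c" if "y \<noteq> c" using y J that by simp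
      ultimately have "y \<noteq> c \<longrightarrow> arm_up ?S d y" unfolding arm_up_def by blast
      then show ?thesis using arm by blast
    next
      assume J: "J = {c..}"
      have "{d} \<times> {y..y2} \<subseteq> ?S" using y J by auto
      then have arm: "arm_up ?S d y" unfolding arm_up_def using y12(2) by blast
      have "{d} \<times> {c..y} \<subseteq> ?S" using J by auto
      moreover have "c < y" if "y \<noteq> c" using y J that by simp
      ultimately have "y \<noteq> c \<longrightarrow> arm_down ?S d y" unfolding arm_down_def by blast
      then show ?thesis using arm by blast
    qed
  qed
  fix x y assume "(x, y) \<in> ?S"
  then consider "x = d" "y = c" | "x \<in> I" "y = c" "x \<noteq> d" | "x = d" "y \<in> J" "y \<noteq> c" by blast
  then show "two_arms ?S x y"
    by cases (use h v mem in \<open>auto simp: two_arms_def\<close>)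
qed

text \<open>The three pieces are joined at (-r, r) and (r, r), where a horizontal and a vertical arm
  are paired; the legs have no lower end, so there are no end points.\<close>

lemma U_leaf:
  assumes ge: "b \<le> r"
    and t: "tangent F ({r} \<times> {..r})" "tangent F ({- r} \<times> {..r})" "tangent F ({- r..r} \<times> {r})"
  shows "{r, - r} \<times> {..r} \<union> {- r..r} \<times> {r} \<in> leaves F"
proof (rule leaf_axisI)
  have "0 < r" using ge b_pos by simp
  then have lt: "- r < r" by (meson less_trans long_line_minus_neg_iff)
  let ?S = "{r, - r} \<times> {..r} \<union> {- r..r} \<times> {r}"
  have eq: "?S = {r} \<times> {..r} \<union> ({- r} \<times> {..r} \<union> {- r..r} \<times> {r})" by auto
  show "tangent F ?S" unfolding eq using t by (intro tangent_Un closed_Times closed_Un) auto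
  show "closed ?S" unfolding eq by (intro closed_Times closed_Un) auto
  have c1: "connected ({- r} \<times> {..r} \<union> {- r..r} \<times> {r})"
    by (rule connected_Un_point[of _ _ "(- r, r)"]) (use less_imp_le[OF lt] in \<open>auto intro: connected_Times\<close>)
  show "connected ?S"
    unfolding eq by (rule connected_Un_point[OF _ c1, of _ "(r, r)"]) (use less_imp_le[OF lt] in \<open>auto intro: connected_Times\<close>)
  show "?S \<subseteq> M" using outer ge by auto
  show "?S \<noteq> {}" by auto
  have corner: "{- r..r} \<times> {r} \<subseteq> ?S" by auto
  have tr: "arm_right ?S (- r) r" "arm_left ?S r r"
    unfolding arm_right_def arm_left_def using corner lt by blast+
  have down: "arm_down ?S z y" if "z = r \<or> z = - r" "y \<le> r" for z y
  proof -
    obtain y1 where "y1 < y" using lt_ex by blast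
    moreover have "{z} \<times> {y1..y} \<subseteq> ?S" using that by auto
    ultimately show ?thesis unfolding arm_down_def by blast
  qed
  have up: "arm_up ?S z y" if "z = r \<or> z = - r" "y < r" for z y
  proof -
    have "{z} \<times> {y..r} \<subseteq> ?S" using that by auto
    then show ?thesis unfolding arm_up_def using that by blast
  qed
  have mid: "arm_right ?S x r" "arm_left ?S x r" if "- r < x" "x < r" for x
  proof -
    have "{x..r} \<times> {r} \<subseteq> ?S" "{- r..x} \<times> {r} \<subseteq> ?S" using that by auto
    then show "arm_right ?S x r" "arm_left ?S x r"
      unfolding arm_right_def arm_left_def using that by blast+
  qed
  fix x y assume xy: "(x, y) \<in> ?S"
  then consider "x = r \<or> x = - r" "y < r" | "x = r \<or> x = - r" "y = r" | "- r < x" "x < r" "y = r"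
    by force
  then show "two_arms ?S x y"
  proof cases
    case 1
    then show ?thesis using up[OF 1] down[OF 1(1) less_imp_le[OF 1(2)]] unfolding two_arms_def by blast
  next
    case 2 then show ?thesis using tr down[of x y] unfolding two_arms_def by auto
  next
    case 3 then show ?thesis using mid unfolding two_arms_def by blast
  qed
qed

lemma square_leaf:
  assumes ge: "b \<le> r"
    and t: "tangent F ({r} \<times> {- r..r})" "tangent F ({- r} \<times> {- r..r})"
      "tangent F ({- r..r} \<times> {r})" "tangent F ({- r..r} \<times> {- r})"
  shows "{r, - r} \<times> {- r..r} \<union> {- r..r} \<times> {r, - r} \<in> leaves F"
proof (rule leaf_axisI)
  have "0 < r" using ge b_pos by simp
  then have lt: "- r < r" by (meson less_trans long_line_minus_neg_iff)
  let ?S = "{r, - r} \<times> {- r..r} \<union> {- r..r} \<times> {r, - r}"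
  have eq: "?S = {r} \<times> {- r..r} \<union> ({- r..r} \<times> {r} \<union> ({- r} \<times> {- r..r} \<union> {- r..r} \<times> {- r}))" by auto
  show "tangent F ?S" unfolding eq using t by (intro tangent_Un closed_Times closed_Un) auto
  show "closed ?S" unfolding eq by (intro closed_Times closed_Un) auto
  have c1: "connected ({- r} \<times> {- r..r} \<union> {- r..r} \<times> {- r})"
    by (rule connected_Un_point[of _ _ "(- r, - r)"]) (use less_imp_le[OF lt] in \<open>auto intro: connected_Times\<close>)
  have c2: "connected ({- r..r} \<times> {r} \<union> ({- r} \<times> {- r..r} \<union> {- r..r} \<times> {- r}))"
    by (rule connected_Un_point[OF _ c1, of _ "(- r, r)"]) (use less_imp_le[OF lt] in \<open>auto intro: connected_Times\<close>)
  show "connected ?S"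
    unfolding eq by (rule connected_Un_point[OF _ c2, of _ "(r, r)"]) (use less_imp_le[OF lt] in \<open>auto intro: connected_Times\<close>)
  show "?S \<subseteq> M" using outer ge by auto
  show "?S \<noteq> {}" using lt by auto
  have right: "arm_right ?S x z" if "z = r \<or> z = - r" "- r \<le> x" "x < r" for x z
  proof -
    have "{x..r} \<times> {z} \<subseteq> ?S" using that by auto
    then show ?thesis unfolding arm_right_def using that by blast
  qed
  have left: "arm_left ?S x z" if "z = r \<or> z = - r" "- r < x" "x \<le> r" for x z
  proof -
    have "{- r..x} \<times> {z} \<subseteq> ?S" using that by auto
    then show ?thesis unfolding arm_left_def using that by blast
  qed
  have up: "arm_up ?S z y" if "z = r \<or> z = - r" "- r \<le> y" "y < r" for y z
  proof -
    have "{z} \<times> {y..r} \<subseteq> ?S" using that by auto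
    then show ?thesis unfolding arm_up_def using that by blast
  qed
  have down: "arm_down ?S z y" if "z = r \<or> z = - r" "- r < y" "y \<le> r" for y z
  proof -
    have "{z} \<times> {- r..y} \<subseteq> ?S" using that by auto
    then show ?thesis unfolding arm_down_def using that by blast
  qed
  fix x y assume xy: "(x, y) \<in> ?S"
  then have rng: "- r \<le> x" "x \<le> r" "- r \<le> y" "y \<le> r" using lt by auto
  consider "x = r \<or> x = - r" "- r < y" "y < r" | "x = r \<or> x = - r" "y = r \<or> y = - r"
    | "- r < x" "x < r" "y = r \<or> y = - r"
    using xy rng by force
  then show "two_arms ?S x y"
  proof cases
    case 1 then show ?thesis using up[of x y] down[of x y] rng unfolding two_arms_def by blast
  next
    case 2
    have "arm_right ?S x y \<or> arm_left ?S x y" using 2 right[of y x] left[of y x] lt rng by (metis order.order_iff_strict)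
    moreover have "arm_up ?S x y \<or> arm_down ?S x y" using 2 up[of x y] down[of x y] lt rng by (metis order.order_iff_strict)
    ultimately show ?thesis unfolding two_arms_def by blast
  next
    case 3 then show ?thesis using right[of y x] left[of y x] rng unfolding two_arms_def by blast
  qed
qed

lemma half_line_in_leaf:
  assumes "tangent F A" "connected A" "A \<noteq> {}" "\<And>x y. (x, y) \<in> A \<Longrightarrow> b \<le> x \<or> x \<le> - b \<or> b \<le> y \<or> y \<le> - b"
  shows "in_leaf F A"
proof (rule tangent_connected_in_leaf[OF F assms(1-3)])
  show "A \<subseteq> M" using assms(4) outer by auto
qed

end

section \<open>Rotations\<close>

text \<open>The converse direction matters: facts found for the upward end of a rotated atlas are
  read back as facts about preimages.\<close>

lemma tangent_image_atlas_iff: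
  assumes g: "bij g" "continuous_on UNIV g" "continuous_on UNIV (inv g)"
  shows "tangent (image_atlas g F) A \<longleftrightarrow> tangent F (g -` A)"
proof
  assume "tangent F (g -` A)"
  then have "tangent (image_atlas g F) (g ` (g -` A))" using tangent_image_atlas[OF g(1,3)] by blast
  then show "tangent (image_atlas g F) A" using g(1) by (simp add: bij_is_surj)
next
  assume t: "tangent (image_atlas g F) A"
  have inv [simp]: "inv g (g x) = x" for x
    using g(1) by (simp add: bij_is_inj)
  show "tangent F (g -` A)"
    unfolding tangent_def
  proof (intro allI impI)
    fix p U \<phi> assume p: "p \<in> g -` A" "(U, \<phi>) \<in> F" "p \<in> U"
    have "(g ` U, restrict (\<phi> \<circ> inv g) (g ` U)) \<in> image_atlas g F"
      unfolding image_atlas_def using p(2) by force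
    then obtain N where N: "open N" "g p \<in> N" "\<And>q. q \<in> N \<Longrightarrow> q \<in> A \<Longrightarrow> q \<in> g ` U \<Longrightarrow>
        snd (restrict (\<phi> \<circ> inv g) (g ` U) q) = snd (restrict (\<phi> \<circ> inv g) (g ` U) (g p))"
      using tangentD[OF t, of "g p"] p by (metis imageI vimageD)
    have "open (g -` N)" using g(2) N(1) by (simp add: open_vimage)
    moreover have "snd (\<phi> q) = snd (\<phi> p)" if "q \<in> g -` N \<inter> g -` A \<inter> U" for q
      using N(3)[of "g q"] that p(3) by simp
    ultimately show "\<exists>N. open N \<and> p \<in> N \<and> (\<forall>q\<in>N \<inter> g -` A \<inter> U. snd (\<phi> q) = snd (\<phi> p))"
      using N(2) by (intro exI[of _ "g -` N"]) auto
  qed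
qed

lemma quarter_turn_homeo: "bij quarter_turn" "continuous_on UNIV quarter_turn" "continuous_on UNIV (inv quarter_turn)"
proof -
  have inv: "inv quarter_turn = (\<lambda>(x, y). (y, - x))"
    by (rule inv_unique_comp) (auto simp: quarter_turn_def fun_eq_iff)
  show "bij quarter_turn"
    by (rule o_bij[of "\<lambda>(x, y). (y, - x)"]) (auto simp: quarter_turn_def fun_eq_iff)
  show "continuous_on UNIV (inv quarter_turn)"
    unfolding inv case_prod_unfold by (intro continuous_intros)
  show "continuous_on UNIV quarter_turn"
    unfolding quarter_turn_def case_prod_unfold by (intro continuous_intros)
qed

lemma funpow_homeo:
  fixes g :: "'a::topological_space \<Rightarrow> 'a"
  assumes g: "bij g" "continuous_on UNIV g" "continuous_on UNIV (inv g)"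
  shows "bij (g ^^ k)" "continuous_on UNIV (g ^^ k)" "continuous_on UNIV (inv (g ^^ k))"
proof -
  have "bij (g ^^ k) \<and> continuous_on UNIV (g ^^ k) \<and> continuous_on UNIV (inv (g ^^ k))"
  proof (induction k)
    case 0
    have "g ^^ 0 = id" by (rule funpow.simps(1))
    then show ?case by (simp only: bij_id inv_id continuous_on_id' simp_thms)
  next
    case (Suc k)
    then have *: "bij (g ^^ k)" "continuous_on UNIV (g ^^ k)" "continuous_on UNIV (inv (g ^^ k))" by auto
    have "inv (g \<circ> g ^^ k) = inv (g ^^ k) \<circ> inv g" using * g by (intro o_inv_distrib)
    moreover have "bij (g \<circ> g ^^ k)" using * g by (intro bij_comp)
    moreover have "continuous_on UNIV (g \<circ> g ^^ k)" "continuous_on UNIV (inv (g ^^ k) \<circ> inv g)"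
      using * g continuous_on_subset by (blast intro: continuous_on_compose)+
    ultimately show ?case by (simp only: funpow.simps)
  qed
  then show "bij (g ^^ k)" "continuous_on UNIV (g ^^ k)" "continuous_on UNIV (inv (g ^^ k))" by auto
qed

lemmas turn_homeo = funpow_homeo[OF quarter_turn_homeo]

lemma turn_4: "quarter_turn ^^ (k + 4) = quarter_turn ^^ k"
proof -
  have "quarter_turn ^^ 4 = id" by (auto simp: quarter_turn_def fun_eq_iff eval_nat_numeral)
  then show ?thesis by (simp add: funpow_add)
qed

text \<open>The upward end after \<open>k + j\<close> turns is another end of the foliation after
  \<open>k\<close> turns, so one result on upward ends serves all four.\<close>

lemma tangent_turn_add:
  "tangent (image_atlas (quarter_turn ^^ (k + j)) F) A \<longleftrightarrow>
   tangent (image_atlas (quarter_turn ^^ k) F) ((quarter_turn ^^ j) -` A)"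
proof -
  have "quarter_turn ^^ (k + j) = quarter_turn ^^ j \<circ> quarter_turn ^^ k"
    by (metis add.commute funpow_add)
  then show ?thesis
    unfolding tangent_image_atlas_iff[OF turn_homeo] by (simp add: vimage_comp)
qed

lemma compact_long_plane_bounded:
  fixes K :: "(long_line \<times> long_line) set"
  assumes "compact K"
  obtains b where "0 < b" "K \<subseteq> {- b<..<b} \<times> {- b<..<b}"
proof -
  have "p \<in> (\<Union>n. {- n<..<n} \<times> {- n<..<n})" for p :: "long_line \<times> long_line"
  proof -
    obtain v where v: "- v \<le> fst p" "fst p \<le> v" "- v \<le> snd p" "snd p \<le> v"
      using long_line_abs_bounds2[of "fst p" "snd p"] by blast
    obtain n where "v < n" using gt_ex by blast
    then have "- n < - v" by simp
    then have "p \<in> {- n<..<n} \<times> {- n<..<n}"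
      using v \<open>v < n\<close> by (cases p) (simp del: long_line_minus_less, meson less_le_trans order_le_less_trans)
    then show ?thesis by blast
  qed
  then have cover: "K \<subseteq> (\<Union>n\<in>UNIV. {- n<..<n} \<times> {- n<..<n})" by blast
  have "\<exists>T. finite T \<and> K \<subseteq> (\<Union>n\<in>T. {- n<..<n} \<times> {- n<..<n})"
    by (rule compactE_image[OF assms _ cover]) (auto intro: open_Times)
  then obtain T where T: "finite T" "K \<subseteq> (\<Union>n\<in>T. {- n<..<n} \<times> {- n<..<n})" by blast
  have "countable (insert 0 T)" using T(1) by (simp add: countable_finite)
  from long_line_countable_bounded[OF this] obtain b where b: "0 < b" "\<And>n. n \<in> T \<Longrightarrow> n < b" by auto
  have "{- n<..<n} \<subseteq> {- b<..<b}" if "n \<in> T" for n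
  proof -
    have "- b < - n" using b(2)[OF that] by simp
    then show ?thesis using b(2)[OF that] by (auto simp del: long_line_minus_less intro: less_trans)
  qed
  then have "K \<subseteq> {- b<..<b} \<times> {- b<..<b}" using T(2) by blast
  then show ?thesis using that b(1) by blast
qed

lemma turn_box:
  assumes "K \<subseteq> {- b<..<b} \<times> {- b<..<b}"
  shows "(quarter_turn ^^ k) ` K \<subseteq> {- b<..<b} \<times> {- b<..<b}"
proof (induction k)
  case 0 then show ?case using assms by simp
next
  case (Suc k)
  have "quarter_turn ` ({- b<..<b} \<times> {- b<..<b}) \<subseteq> {- b<..<b} \<times> {- b<..<b}"
    by (auto simp: quarter_turn_def long_line_minus_less_iff)
  then show ?case using Suc by (auto simp: image_comp[symmetric])
qed

text \<open>One sequence is built with a point of every \<open>C i\<close> in each of its gaps; its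
  limit is then a limit of points of each \<open>C i\<close>.\<close>

lemma unbounded_closed_Int:
  fixes C :: "nat \<Rightarrow> long_line set"
  assumes "\<And>i. closed (C i)" "\<And>i z. \<exists>\<alpha>\<in>C i. z < \<alpha>"
  shows "\<exists>\<alpha>\<in>(\<Inter>i. C i). z < \<alpha>"
proof -
  obtain A where A: "\<And>i z. A i z \<in> C i" "\<And>i z. z < A i z" using assms(2) by metis
  have "\<exists>s. \<forall>i. A i z < s" for z
    using long_line_countable_bounded[of "range (\<lambda>i. A i z)"] by auto
  then obtain s where s: "\<And>i z. A i z < s z" by metis
  define a where "a = rec_nat z (\<lambda>_. s)"
  have a0: "a 0 = z" and aS: "a (Suc k) = s (a k)" for k by (simp_all add: a_def)
  have lt: "a k < A i (a k)" "A i (a k) < a (Suc k)" for i k using A(2) s aS by auto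
  then have inc: "incseq a" by (intro incseq_SucI) (meson less_imp_le less_trans)
  define \<alpha> where "\<alpha> = Sup (range a)"
  note lim = incseq_tendsto_Sup_long_line[OF inc, folded \<alpha>_def]
  have "\<alpha> \<in> C i" for i
  proof (rule closed_sequentially[OF assms(1)[of i]])
    show "A i (a k) \<in> C i" for k by (rule A(1))
    show "(\<lambda>k. A i (a k)) \<longlonglongrightarrow> \<alpha>"
      by (rule tendsto_sandwich[OF _ _ lim(1) LIMSEQ_Suc[OF lim(1)]]) (use less_imp_le[OF lt(1)] less_imp_le[OF lt(2)] in auto)
  qed
  moreover have "z < \<alpha>" using lt[of 0] lim(2)[of 1] a0 by (metis One_nat_def less_le_trans less_trans)
  ultimately show ?thesis by blast
qed

text \<open>The index counts the four ends in cyclic order, with \<open>h\<close> for horizontal and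
  \<open>v\<close> for vertical. The six alternatives are the two-colourings of a 4-cycle up to
  rotation, in the order of the cases of the theorem.\<close>

lemma rotation_cases:
  fixes h v :: "nat \<Rightarrow> bool"
  assumes hv: "\<And>k. h k \<or> v k" and per: "\<And>k. h (k + 4) = h k" "\<And>k. v (k + 4) = v k"
  obtains k where
    "h k \<and> h (k + 1) \<and> h (k + 2) \<and> h (k + 3) \<or>
     h k \<and> h (k + 1) \<and> v (k + 2) \<and> h (k + 3) \<or>
     h k \<and> h (k + 1) \<and> v (k + 2) \<and> v (k + 3) \<or>
     h k \<and> v (k + 1) \<and> h (k + 2) \<and> v (k + 3) \<or>
     h k \<and> v (k + 1) \<and> v (k + 2) \<and> v (k + 3) \<or>
     v k \<and> v (k + 1) \<and> v (k + 2) \<and> v (k + 3)"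
proof -
  note c = hv[of 0] hv[of 1] hv[of 2] hv[of 3]
  note p = per[of 0] per[of 1] per[of 2]
  show ?thesis
    using that[of 0] that[of 1] that[of 2] that[of 3] c p
    by (simp add: eval_nat_numeral) argo
qed

text \<open>These preimages move upward sets to the right, to the bottom and to the left, which
  fixes the cyclic order of the ends as up, right, down, left.\<close>

lemma turn_vimage:
  "(quarter_turn ^^ 1) -` (A \<times> B) = B \<times> uminus ` A"
  "(quarter_turn ^^ 2) -` (A \<times> B) = uminus ` A \<times> uminus ` B"
  "(quarter_turn ^^ 3) -` (A \<times> B) = uminus ` B \<times> A"
proof -
  have m: "- x \<in> S \<longleftrightarrow> x \<in> uminus ` S" for x :: long_line and S
    by (metis image_iff long_line_minus_minus)
  show "(quarter_turn ^^ 1) -` (A \<times> B) = B \<times> uminus ` A"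
    "(quarter_turn ^^ 2) -` (A \<times> B) = uminus ` A \<times> uminus ` B"
    "(quarter_turn ^^ 3) -` (A \<times> B) = uminus ` B \<times> A"
    by (auto simp: quarter_turn_def eval_nat_numeral m)
qed

lemma (in outer_foliation) half_lines_in_leaf:
  assumes "b \<le> \<alpha>"
  shows "tangent F ({x} \<times> {..- \<alpha>}) \<Longrightarrow> in_leaf F ({x} \<times> {..- \<alpha>})"
    and "tangent F ({x} \<times> {\<alpha>..}) \<Longrightarrow> in_leaf F ({x} \<times> {\<alpha>..})"
    and "tangent F ({..- \<alpha>} \<times> {x}) \<Longrightarrow> in_leaf F ({..- \<alpha>} \<times> {x})"
    and "tangent F ({\<alpha>..} \<times> {x}) \<Longrightarrow> in_leaf F ({\<alpha>..} \<times> {x})"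
proof -
  have le: "z \<le> - b" if "z \<le> - \<alpha>" for z
    using order_trans[OF that, of "- b"] assms by simp
  show "tangent F ({x} \<times> {..- \<alpha>}) \<Longrightarrow> in_leaf F ({x} \<times> {..- \<alpha>})"
    "tangent F ({x} \<times> {\<alpha>..}) \<Longrightarrow> in_leaf F ({x} \<times> {\<alpha>..})"
    "tangent F ({..- \<alpha>} \<times> {x}) \<Longrightarrow> in_leaf F ({..- \<alpha>} \<times> {x})"
    "tangent F ({\<alpha>..} \<times> {x}) \<Longrightarrow> in_leaf F ({\<alpha>..} \<times> {x})"
    using assms by (auto intro!: half_line_in_leaf connected_Times dest: le)
qed

lemma tangent_extend:
  fixes F :: "(long_line \<times> long_line, real, real) atlas"
  shows "tangent F ({x} \<times> {..- \<alpha>}) \<Longrightarrow> tangent F ({x} \<times> {- \<alpha>..\<alpha>}) \<Longrightarrow> tangent F ({x} \<times> {..\<alpha>})"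
    and "tangent F ({..- \<alpha>} \<times> {x}) \<Longrightarrow> tangent F ({- \<alpha>..\<alpha>} \<times> {x}) \<Longrightarrow> tangent F ({..\<alpha>} \<times> {x})"
    and "tangent F ({..\<alpha>} \<times> {x}) \<Longrightarrow> tangent F ({\<alpha>..} \<times> {x}) \<Longrightarrow> tangent F (UNIV \<times> {x})"
proof -
  show "tangent F ({x} \<times> {..\<alpha>})" if "tangent F ({x} \<times> {..- \<alpha>})" "tangent F ({x} \<times> {- \<alpha>..\<alpha>})"
  proof (rule tangent_subset)
    show "tangent F ({x} \<times> {..- \<alpha>} \<union> {x} \<times> {- \<alpha>..\<alpha>})"
      using that by (intro tangent_Un closed_Times) auto
  qed auto
  show "tangent F ({..\<alpha>} \<times> {x})" if "tangent F ({..- \<alpha>} \<times> {x})" "tangent F ({- \<alpha>..\<alpha>} \<times> {x})"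
  proof (rule tangent_subset)
    show "tangent F ({..- \<alpha>} \<times> {x} \<union> {- \<alpha>..\<alpha>} \<times> {x})"
      using that by (intro tangent_Un closed_Times) auto
  qed auto
  show "tangent F (UNIV \<times> {x})" if "tangent F ({..\<alpha>} \<times> {x})" "tangent F ({\<alpha>..} \<times> {x})"
  proof (rule tangent_subset)
    show "tangent F ({..\<alpha>} \<times> {x} \<union> {\<alpha>..} \<times> {x})"
      using that by (intro tangent_Un closed_Times) auto
  qed auto
qed

theorem theorem7p3:
  fixes K :: "(long_line \<times> long_line) set"
    and F :: "(long_line \<times> long_line, real, real) atlas"
  assumes "compact K" and "foliation (UNIV - K) F"
  shows "\<exists>C. closed_unbounded C \<and> (\<exists>k::nat. let G = image_atlas (quarter_turn ^^ k) F in
      (\<forall>\<alpha>\<in>C.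
        {\<alpha>, - \<alpha>} \<times> {- \<alpha>..\<alpha>} \<union> {- \<alpha>..\<alpha>} \<times> {\<alpha>, - \<alpha>} \<in> leaves G)
    \<or> (\<forall>\<alpha>\<in>C.
        {\<alpha>, - \<alpha>} \<times> {..\<alpha>} \<union> {- \<alpha>..\<alpha>} \<times> {\<alpha>} \<in> leaves G \<and>
        (\<forall>x\<in>{- \<alpha>..\<alpha>}. in_leaf G ({x} \<times> {..- \<alpha>})))
    \<or> (\<forall>\<alpha>\<in>C.
        {\<alpha>} \<times> {..\<alpha>} \<union> {..\<alpha>} \<times> {\<alpha>} \<in> leaves G \<and>
        (\<forall>x\<in>{- \<alpha>..\<alpha>}. in_leaf G ({x} \<times> {..- \<alpha>}) \<and> in_leaf G ({..- \<alpha>} \<times> {x})))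
    \<or> (\<forall>\<alpha>\<in>C.
        UNIV \<times> {\<alpha>} \<in> leaves G \<and>
        UNIV \<times> {- \<alpha>} \<in> leaves G \<and>
        (\<forall>x\<in>{- \<alpha>..\<alpha>}. in_leaf G ({..- \<alpha>} \<times> {x}) \<and> in_leaf G ({\<alpha>..} \<times> {x})))
    \<or> (\<forall>\<alpha>\<in>C.
        UNIV \<times> {\<alpha>} \<in> leaves G \<and>
        {..- \<alpha>} \<times> {- \<alpha>} \<union> {- \<alpha>} \<times> {..- \<alpha>} \<in> leaves G \<and>
        {\<alpha>..} \<times> {- \<alpha>} \<union> {\<alpha>} \<times> {..- \<alpha>} \<in> leaves G \<and>
        (\<forall>x\<in>{- \<alpha>..\<alpha>}. in_leaf G ({..- \<alpha>} \<times> {x}) \<and> in_leaf G ({\<alpha>..} \<times> {x}) \<and>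
          in_leaf G ({x} \<times> {..- \<alpha>})))
    \<or> (\<forall>\<alpha>\<in>C.
        {..- \<alpha>} \<times> {\<alpha>} \<union> {- \<alpha>} \<times> {\<alpha>..} \<in> leaves G \<and>
        {\<alpha>..} \<times> {\<alpha>} \<union> {\<alpha>} \<times> {\<alpha>..} \<in> leaves G \<and>
        {..- \<alpha>} \<times> {- \<alpha>} \<union> {- \<alpha>} \<times> {..- \<alpha>} \<in> leaves G \<and>
        {\<alpha>..} \<times> {- \<alpha>} \<union> {\<alpha>} \<times> {..- \<alpha>} \<in> leaves G \<and>
        (\<forall>x\<in>{- \<alpha>..\<alpha>}. in_leaf G ({x} \<times> {\<alpha>..}) \<and> in_leaf G ({x} \<times> {..- \<alpha>}) \<and>
          in_leaf G ({\<alpha>..} \<times> {x}) \<and> in_leaf G ({..- \<alpha>} \<times> {x}))))"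
proof -
  obtain b where b: "0 < b" "K \<subseteq> {- b<..<b} \<times> {- b<..<b}"
    using compact_long_plane_bounded[OF assms(1)] .
  have F: "foliated_atlas (UNIV - K) F" using assms(2) unfolding foliation_def by blast
  define G where "G k = image_atlas (quarter_turn ^^ k) F" for k
  define M where "M k = (quarter_turn ^^ k) ` (UNIV - K)" for k
  have G: "foliated_atlas (M k) (G k)" for k
    unfolding G_def M_def by (rule image_atlas_foliated[OF turn_homeo F])
  have outer: "(x, y) \<in> M k" if "b \<le> x \<or> x \<le> - b \<or> b \<le> y \<or> y \<le> - b" for x y k
  proof -
    have "(x, y) \<notin> {- b<..<b} \<times> {- b<..<b}" using that by auto
    then have "(x, y) \<notin> (quarter_turn ^^ k) ` K" using turn_box[OF b(2), of k] by blast
    moreover have "(x, y) \<in> range (quarter_turn ^^ k)" using turn_homeo(1) by (metis UNIV_I bij_is_surj)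
    ultimately show ?thesis unfolding M_def by blast
  qed
  \<comment> \<open>The same \<open>b\<close> serves every rotation, since the box around
    \<open>K\<close> is mapped into itself by quarter turns.\<close>
  have "\<exists>C. closed C \<and> C \<subseteq> {b..} \<and> (\<forall>z. \<exists>\<alpha>\<in>C. z < \<alpha>) \<and>
      ((\<forall>\<alpha>\<in>C. tangent (G k) ({- \<alpha>..\<alpha>} \<times> {\<alpha>})) \<or> (\<forall>\<alpha>\<in>C. \<forall>x\<in>{- \<alpha>..\<alpha>}. tangent (G k) ({x} \<times> {\<alpha>..})))" for k
  proof -
    interpret foliated_upwards "M k" "G k" b
      by unfold_locales (use G outer b(1) in auto)
    show ?thesis using upward_end by metis
  qed
  then obtain CC where CC: "\<And>k. closed (CC k)" "\<And>k. CC k \<subseteq> {b..}" "\<And>k z. \<exists>\<alpha>\<in>CC k. z < \<alpha>"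
    "\<And>k. (\<forall>\<alpha>\<in>CC k. tangent (G k) ({- \<alpha>..\<alpha>} \<times> {\<alpha>})) \<or>
      (\<forall>\<alpha>\<in>CC k. \<forall>x\<in>{- \<alpha>..\<alpha>}. tangent (G k) ({x} \<times> {\<alpha>..}))" by metis
  define C where "C = (\<Inter>k. CC k)"
  have Cb: "b \<le> \<alpha>" if "\<alpha> \<in> C" for \<alpha> using CC(2) that unfolding C_def by auto
  have "closed_unbounded C"
    unfolding closed_unbounded_def
  proof
    have "closed C" unfolding C_def using CC(1) by blast
    moreover have "C \<subseteq> {0<..}" using Cb b(1) by (auto intro: less_le_trans)
    ultimately show "closedin (top_of_set {0<..}) C" by (rule closed_subset[rotated])
    have "\<exists>\<alpha>\<in>C. z < \<alpha>" for z unfolding C_def by (rule unbounded_closed_Int[OF CC(1,3)])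
    then show "\<not> (\<exists>b\<in>{0<..}. \<forall>c\<in>C. c \<le> b)" by (meson leD)
  qed
  \<comment> \<open>Both are stated for the common set \<open>C\<close>: the sets
    \<open>CC k\<close> and \<open>CC (k + 4)\<close> were chosen separately and need not agree,
    whereas \<open>h\<close> and \<open>v\<close> are periodic because
    \<open>G (k + 4) = G k\<close>.\<close>
  define h where "h k \<longleftrightarrow> (\<forall>\<alpha>\<in>C. tangent (G k) ({- \<alpha>..\<alpha>} \<times> {\<alpha>}))" for k
  define v where "v k \<longleftrightarrow> (\<forall>\<alpha>\<in>C. \<forall>x\<in>{- \<alpha>..\<alpha>}. tangent (G k) ({x} \<times> {\<alpha>..}))" for k
  have "h k \<or> v k" for k using CC(4)[of k] unfolding h_def v_def C_def by blast
  moreover have "h (k + 4) = h k" "v (k + 4) = v k" for k unfolding h_def v_def G_def turn_4 by auto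
  ultimately obtain k where k:
    "h k \<and> h (k + 1) \<and> h (k + 2) \<and> h (k + 3) \<or>
     h k \<and> h (k + 1) \<and> v (k + 2) \<and> h (k + 3) \<or>
     h k \<and> h (k + 1) \<and> v (k + 2) \<and> v (k + 3) \<or>
     h k \<and> v (k + 1) \<and> h (k + 2) \<and> v (k + 3) \<or>
     h k \<and> v (k + 1) \<and> v (k + 2) \<and> v (k + 3) \<or>
     v k \<and> v (k + 1) \<and> v (k + 2) \<and> v (k + 3)"
    by (rule rotation_cases)
  interpret outer_foliation "M k" "G k" b
    by unfold_locales (use G outer b(1) in auto)
  have add: "tangent (G (k + j)) A \<longleftrightarrow> tangent (G k) ((quarter_turn ^^ j) -` A)" for j A
    unfolding G_def by (rule tangent_turn_add)
  have sym: "- x \<in> {- \<alpha>..\<alpha>} \<longleftrightarrow> x \<in> {- \<alpha>..\<alpha>}" for x \<alpha> :: long_line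
    by (auto simp: long_line_minus_le_iff)
  \<comment> \<open>From here on everything is read in the single foliation \<open>G k\<close>: the
    indices \<open>k\<close>, \<open>k + 1\<close>, \<open>k + 2\<close>, \<open>k + 3\<close>
    describe its upper, right, lower and left end.\<close>
  have up: "tangent (G k) ({- \<alpha>..\<alpha>} \<times> {\<alpha>})" if "h k" "\<alpha> \<in> C" for \<alpha>
    using that unfolding h_def by blast
  have right: "tangent (G k) ({\<alpha>} \<times> {- \<alpha>..\<alpha>})" if "h (k + 1)" "\<alpha> \<in> C" for \<alpha>
    using that unfolding h_def add turn_vimage by simp
  have down: "tangent (G k) ({- \<alpha>..\<alpha>} \<times> {- \<alpha>})" if "h (k + 2)" "\<alpha> \<in> C" for \<alpha>
    using that unfolding h_def add turn_vimage by simp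
  have left: "tangent (G k) ({- \<alpha>} \<times> {- \<alpha>..\<alpha>})" if "h (k + 3)" "\<alpha> \<in> C" for \<alpha>
    using that unfolding h_def add turn_vimage by simp
  have up': "tangent (G k) ({x} \<times> {\<alpha>..})" if "v k" "\<alpha> \<in> C" "x \<in> {- \<alpha>..\<alpha>}" for \<alpha> x
    using that unfolding v_def by blast
  have right': "tangent (G k) ({\<alpha>..} \<times> {x})" if "v (k + 1)" "\<alpha> \<in> C" "x \<in> {- \<alpha>..\<alpha>}" for \<alpha> x
  proof -
    have "- x \<in> {- \<alpha>..\<alpha>}" using that(3) sym by blast
    from that(1)[unfolded v_def add turn_vimage, rule_format, OF that(2) this] show ?thesis by simp
  qed
  have down': "tangent (G k) ({x} \<times> {..- \<alpha>})" if "v (k + 2)" "\<alpha> \<in> C" "x \<in> {- \<alpha>..\<alpha>}" for \<alpha> x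
  proof -
    have "- x \<in> {- \<alpha>..\<alpha>}" using that(3) sym by blast
    from that(1)[unfolded v_def add turn_vimage, rule_format, OF that(2) this] show ?thesis by simp
  qed
  have left': "tangent (G k) ({..- \<alpha>} \<times> {x})" if "v (k + 3)" "\<alpha> \<in> C" "x \<in> {- \<alpha>..\<alpha>}" for \<alpha> x
    using that unfolding v_def add turn_vimage by simp
  \<comment> \<open>The half-lines at the positions \<alpha> and -\<alpha> are the ones that prolong
    the sides or meet in the corners.\<close>
  have ends: "\<alpha> \<in> {- \<alpha>..\<alpha>}" "- \<alpha> \<in> {- \<alpha>..\<alpha>}" if "\<alpha> \<in> C" for \<alpha>
  proof -
    have "0 \<le> \<alpha>" using Cb[OF that] b(1) by simp
    then have "- \<alpha> \<le> \<alpha>" by (meson long_line_minus_nonpos_iff order_trans)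
    then show "\<alpha> \<in> {- \<alpha>..\<alpha>}" "- \<alpha> \<in> {- \<alpha>..\<alpha>}" by auto
  qed
  have Cb': "- \<alpha> \<le> - b" if "\<alpha> \<in> C" for \<alpha> using Cb[OF that] by simp
  note half = half_lines_in_leaf[OF Cb]
  have line: "UNIV \<times> {\<alpha>} \<in> leaves (G k)" if "h k" "v (k + 1)" "v (k + 3)" "\<alpha> \<in> C" for \<alpha>
    using tangent_extend(2)[OF left'[OF that(3,4)] up[OF that(1,4)]] right'[OF that(2,4)] ends[OF that(4)] Cb[OF that(4)]
    by (intro line_leaf tangent_extend(3)) auto
  have line': "UNIV \<times> {- \<alpha>} \<in> leaves (G k)" if "h (k + 2)" "v (k + 1)" "v (k + 3)" "\<alpha> \<in> C" for \<alpha>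
    using tangent_extend(2)[OF left'[OF that(3,4)] down[OF that(1,4)]] right'[OF that(2,4)] ends[OF that(4)] Cb'[OF that(4)]
    by (intro line_leaf tangent_extend(3)) auto
  have SW: "{..- \<alpha>} \<times> {- \<alpha>} \<union> {- \<alpha>} \<times> {..- \<alpha>} \<in> leaves (G k)" if "v (k + 2)" "v (k + 3)" "\<alpha> \<in> C" for \<alpha>
    using left'[OF that(2,3)] down'[OF that(1,3)] ends[OF that(3)] Cb'[OF that(3)] by (intro corner_leaf) auto
  have SE: "{\<alpha>..} \<times> {- \<alpha>} \<union> {\<alpha>} \<times> {..- \<alpha>} \<in> leaves (G k)" if "v (k + 1)" "v (k + 2)" "\<alpha> \<in> C" for \<alpha>
    using right'[OF that(1,3)] down'[OF that(2,3)] ends[OF that(3)] Cb[OF that(3)] Cb'[OF that(3)]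
    by (intro corner_leaf) auto
  have NW: "{..- \<alpha>} \<times> {\<alpha>} \<union> {- \<alpha>} \<times> {\<alpha>..} \<in> leaves (G k)" if "v k" "v (k + 3)" "\<alpha> \<in> C" for \<alpha>
    using left'[OF that(2,3)] up'[OF that(1,3)] ends[OF that(3)] Cb[OF that(3)] Cb'[OF that(3)]
    by (intro corner_leaf) auto
  have NE: "{\<alpha>..} \<times> {\<alpha>} \<union> {\<alpha>} \<times> {\<alpha>..} \<in> leaves (G k)" if "v k" "v (k + 1)" "\<alpha> \<in> C" for \<alpha>
    using right'[OF that(2,3)] up'[OF that(1,3)] ends[OF that(3)] Cb[OF that(3)] by (intro corner_leaf) auto
  have bent: "{\<alpha>} \<times> {..\<alpha>} \<union> {..\<alpha>} \<times> {\<alpha>} \<in> leaves (G k)"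
    if "h k" "h (k + 1)" "v (k + 2)" "v (k + 3)" "\<alpha> \<in> C" for \<alpha>
  proof -
    have "tangent (G k) ({..\<alpha>} \<times> {\<alpha>})"
      by (rule tangent_extend(2)[OF left'[OF that(4,5) ends(1)[OF that(5)]] up[OF that(1,5)]])
    moreover have "tangent (G k) ({\<alpha>} \<times> {..\<alpha>})"
      by (rule tangent_extend(1)[OF down'[OF that(3,5) ends(1)[OF that(5)]] right[OF that(2,5)]])
    ultimately have "{..\<alpha>} \<times> {\<alpha>} \<union> {\<alpha>} \<times> {..\<alpha>} \<in> leaves (G k)"
      using Cb[OF that(5)] by (intro corner_leaf) auto
    then show ?thesis by (simp add: Un_commute)
  qed
  have U: "{\<alpha>, - \<alpha>} \<times> {..\<alpha>} \<union> {- \<alpha>..\<alpha>} \<times> {\<alpha>} \<in> leaves (G k)"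
    if "h k" "h (k + 1)" "v (k + 2)" "h (k + 3)" "\<alpha> \<in> C" for \<alpha>
    using U_leaf[OF Cb[OF that(5)]
      tangent_extend(1)[OF down'[OF that(3,5) ends(1)[OF that(5)]] right[OF that(2,5)]]
      tangent_extend(1)[OF down'[OF that(3,5) ends(2)[OF that(5)]] left[OF that(4,5)]]
      up[OF that(1,5)]] .
  have square: "{\<alpha>, - \<alpha>} \<times> {- \<alpha>..\<alpha>} \<union> {- \<alpha>..\<alpha>} \<times> {\<alpha>, - \<alpha>} \<in> leaves (G k)"
    if "h k" "h (k + 1)" "h (k + 2)" "h (k + 3)" "\<alpha> \<in> C" for \<alpha>
    using square_leaf[OF Cb[OF that(5)] right[OF that(2,5)] left[OF that(4,5)] up[OF that(1,5)]
      down[OF that(3,5)]] .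
  show ?thesis
    unfolding Let_def
  proof (intro exI[of _ C] conjI exI[of _ k] \<open>closed_unbounded C\<close>, fold G_def,
      use k in \<open>elim disjE conjE\<close>, goal_cases)
    case 1
    show ?case
      by (rule disjI1, intro ballI conjI)
        (use 1 in \<open>blast intro: square\<close>)+
  next
    case 2
    show ?case
      by (rule disjI2, rule disjI1, intro ballI conjI)
        (use 2 in \<open>blast intro: U half(1) down'\<close>)+
  next
    case 3
    show ?case
      by (rule disjI2, rule disjI2, rule disjI1, intro ballI conjI)
        (use 3 in \<open>blast intro: bent half(1) half(3) down' left'\<close>)+
  next
    case 4
    show ?case
      by (rule disjI2, rule disjI2, rule disjI2, rule disjI1, intro ballI conjI)
        (use 4 in \<open>blast intro: line line' half(3) half(4) left' right'\<close>)+
  next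
    case 5
    show ?case
      by (rule disjI2, rule disjI2, rule disjI2, rule disjI2, rule disjI1, intro ballI conjI)
        (use 5 in \<open>blast intro: line SW SE half(3) half(4) half(1) left' right' down'\<close>)+
  next
    case 6
    show ?case
      by (rule disjI2, rule disjI2, rule disjI2, rule disjI2, rule disjI2, intro ballI conjI)
        (use 6 in \<open>blast intro: NW NE SW SE half(2) half(1) half(4) half(3) up' down' right' left'\<close>)+
  qed
qed

end
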